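(* Let $q$ be a prime power, $A=\mathbb{F}_q[T]$, and let $M^4(1)$ be the coarse moduli scheme over $A$ of Drinfeld $A$-modules of rank $4$, i.e. the affine toric $A$-threefold attached to the cone $\sigma_M\subset\mathbb{R}^3$ (lattice $\mathbb{Z}^3$) spanned by $$e_1=\left(q^3+q^2+q+1,\,-q-1,\,-q^2-q-1\right),\quad e_2=(0,1,0),\quad e_3=(0,0,1).$$ Let $\Sigma_{\mathrm{min}}$ be the fan obtained from $\sigma_M$ by the star subdivision centered in the ray spanned by $(q^2+1,-1,-q)$ followed by the star subdivision centered in the ray spanned by $(1,0,0)$. Then the star subdivisions of $\Sigma_{\mathrm{min}}$ centered in the rays spanned by $$(kq^2+q+1,\,-k,\,-kq-1),\qquad 1\le k\le q,$$ followed by the star subdivisions centered in the rays spanned by $$(kq^2+lq+1,\,-k,\,-kq-l),\qquad 0\le k\le q,$$ where $$\begin{cases}2\le l\le q & \text{if } 1\le k\le q,\\ 1\le l\le q-1 & \text{if } k=0,\end{cases}$$ define the unique (minimal) essential smooth model $M^4_{\mathrm{ess}}(1)$ of $M^4(1)$.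
   Context: Moduli scheme. A Drinfeld $A$-module of rank $4$ over a field $L$ with a structure morphism $\alpha_L:A\to L$ is given by $T\mapsto \alpha_L(T)+a_1\tau+a_2\tau^2+a_3\tau^3+\Delta\tau^4$ with $\Delta\in L^*$, $\tau$ the $q$-Frobenius. Their coarse moduli scheme $M^4(1)$ is (known fact) the affine toric $A$-scheme $\operatorname{Spec}A[\check\sigma_M\cap(\mathbb{Z}^3)^*]$, where $\check\sigma_M$ is the cone dual to $\sigma_M$. More generally, a fan $\Sigma$ in $\mathbb{R}^3$ (rational with respect to $\mathbb{Z}^3$) defines a toric $A$-scheme, obtained by gluing the schemes $\operatorname{Spec}A[\check\sigma\cap(\mathbb{Z}^3)^*]$ for $\sigma\in\Sigma$. A subdivision of the cone $\sigma_M$ defines a proper birational toric morphism to $M^4(1)$. The toric variety of the fan $\Sigma_{\mathrm{min}}$ is denoted $M^4_{\mathrm{min}}(1)$. Star subdivision. The star subdivision of a simplicial fan $\Sigma$ centered in a ray $\rho$ contained in its support is the fan obtained by replacing every cone $\sigma\in\Sigma$ containing $\rho$ by the cones $\rho+\tau$, where $\tau$ runs over the faces of $\sigma$ not containing $\rho$. Sheds. For a simplicial cone $\sigma$, let $l_\sigma$ be the linear form taking the value $1$ on the primitive lattice generators of the extremal rays of $\sigma$. The shed of $\sigma$ is the polytope $\sigma\cap l_\sigma^{-1}[0,1]$. The shed of a fan is the union of the sheds of its cones. Smooth and essential models. A smooth (toric) model of $M^4(1)$ is the toric variety of a regular subdivision of $\sigma_M$, i.e. one in which every maximal cone is generated by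 a basis of $\mathbb{Z}^3$. An exceptional divisor over $M^4(1)$ (corresponding to a ray in $\sigma_M$ other than those spanned by $e_1,e_2,e_3$) is called essential if it is present in any smooth model, i.e. if the ray belongs to every regular subdivision of $\sigma_M$. A smooth model is called essential if it is obtained by a chain of blow-ups (star subdivisions) of $M^4(1)$ all of whose exceptional divisors are essential. It is minimal if the volume of its shed is minimal among smooth models. *)

theory Defs
  imports "HOL-Analysis.Analysis" "HOL-Library.Poly_Mapping" "HOL-Computational_Algebra.Polynomial"
begin

section \<open>Cones and fans in three-space\<close>

definition lattice :: "(real^3) set" where
  "lattice = {x. \<forall>i. x $ i \<in> \<int>}"

definition primitive :: "real^3 \<Rightarrow> bool" where
  "primitive v \<longleftrightarrow> v \<in> lattice \<and> v \<noteq> 0 \<and> (\<forall>t. 0 < t \<and> t < 1 \<longrightarrow> t *\<^sub>R v \<notin> lattice)"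

definition lattice_basis :: "(real^3) set \<Rightarrow> bool" where
  "lattice_basis B \<longleftrightarrow> B \<subseteq> lattice \<and> independent B \<and>
     (\<forall>x\<in>lattice. \<exists>c :: real^3 \<Rightarrow> int. x = (\<Sum>b\<in>B. of_int (c b) *\<^sub>R b))"

definition ray :: "real^3 \<Rightarrow> (real^3) set" where
  "ray v = convex_cone hull {v}"

definition rational_cone :: "(real^3) set \<Rightarrow> bool" where
  "rational_cone \<sigma> \<longleftrightarrow> (\<exists>S. finite S \<and> S \<subseteq> lattice \<and> \<sigma> = convex_cone hull S)"

definition strongly_convex :: "(real^3) set \<Rightarrow> bool" where
  "strongly_convex \<sigma> \<longleftrightarrow> (\<forall>x. x \<in> \<sigma> \<and> - x \<in> \<sigma> \<longrightarrow> x = 0)"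

text \<open>The library counts the empty set as a face; a face of a cone is a cone, hence nonempty.\<close>

definition cone_face :: "(real^3) set \<Rightarrow> (real^3) set \<Rightarrow> bool" where
  "cone_face \<tau> \<sigma> \<longleftrightarrow> \<tau> face_of \<sigma> \<and> \<tau> \<noteq> {}"

definition fan :: "(real^3) set set \<Rightarrow> bool" where
  "fan \<Sigma> \<longleftrightarrow> finite \<Sigma> \<and>
     (\<forall>\<sigma>\<in>\<Sigma>. rational_cone \<sigma> \<and> strongly_convex \<sigma>) \<and>
     (\<forall>\<sigma>\<in>\<Sigma>. \<forall>\<tau>. cone_face \<tau> \<sigma> \<longrightarrow> \<tau> \<in> \<Sigma>) \<and>
     (\<forall>\<sigma>\<in>\<Sigma>. \<forall>\<sigma>'\<in>\<Sigma>. cone_face (\<sigma> \<inter> \<sigma>') \<sigma> \<and> cone_face (\<sigma> \<inter> \<sigma>') \<sigma>')"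

text \<open>The fan of the affine toric variety of a single cone.\<close>

definition face_fan :: "(real^3) set \<Rightarrow> (real^3) set set" where
  "face_fan \<sigma> = {\<tau>. cone_face \<tau> \<sigma>}"

definition maximal_cone :: "(real^3) set set \<Rightarrow> (real^3) set \<Rightarrow> bool" where
  "maximal_cone \<Sigma> \<sigma> \<longleftrightarrow> \<sigma> \<in> \<Sigma> \<and> (\<forall>\<tau>\<in>\<Sigma>. \<sigma> \<subseteq> \<tau> \<longrightarrow> \<tau> = \<sigma>)"

definition regular_subdivision :: "(real^3) set \<Rightarrow> (real^3) set set \<Rightarrow> bool" where
  "regular_subdivision \<sigma> \<Sigma> \<longleftrightarrow> fan \<Sigma> \<and> \<Union>\<Sigma> = \<sigma> \<and>
     (\<forall>\<tau>. maximal_cone \<Sigma> \<tau> \<longrightarrow> (\<exists>B. lattice_basis B \<and> \<tau> = convex_cone hull B))"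

text \<open>
  Fans contain all faces of their cones, so the faces of \<open>\<sigma>\<close> avoiding \<open>\<rho>\<close>
  themselves survive the subdivision as members of the first set.  In the second set,
  \<open>+\<close> is the Minkowski sum.
\<close>

definition star_subdivision :: "(real^3) set \<Rightarrow> (real^3) set set \<Rightarrow> (real^3) set set" where
  "star_subdivision \<rho> \<Sigma> =
     {\<sigma> \<in> \<Sigma>. \<not> \<rho> \<subseteq> \<sigma>} \<union>
     {\<rho> + \<tau> | \<sigma> \<tau>. \<sigma> \<in> \<Sigma> \<and> \<rho> \<subseteq> \<sigma> \<and> cone_face \<tau> \<sigma> \<and> \<not> \<rho> \<subseteq> \<tau>}"


section \<open>Sheds\<close>

definition primitive_generators :: "(real^3) set \<Rightarrow> (real^3) set" where
  "primitive_generators \<sigma> = {v. primitive v \<and> cone_face (ray v) \<sigma>}"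

text \<open>
  For simplicial \<open>\<sigma>\<close> such a form exists; it is unique on the span of \<open>\<sigma>\<close>, which is
  all that matters for the shed.
\<close>

definition shed_form :: "(real^3) set \<Rightarrow> real^3 \<Rightarrow> real" where
  "shed_form \<sigma> = (SOME l. linear l \<and> (\<forall>v\<in>primitive_generators \<sigma>. l v = 1))"

definition cone_shed :: "(real^3) set \<Rightarrow> (real^3) set" where
  "cone_shed \<sigma> = \<sigma> \<inter> shed_form \<sigma> -` {0..1}"

definition shed :: "(real^3) set set \<Rightarrow> (real^3) set" where
  "shed \<Sigma> = (\<Union>\<sigma>\<in>\<Sigma>. cone_shed \<sigma>)"


section \<open>Essential and minimal regular subdivisions\<close>

definition exceptional_ray :: "(real^3) set \<Rightarrow> (real^3) set \<Rightarrow> bool" where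
  "exceptional_ray \<sigma> \<rho> \<longleftrightarrow> (\<exists>v. primitive v \<and> \<rho> = ray v) \<and> \<rho> \<subseteq> \<sigma> \<and> \<not> cone_face \<rho> \<sigma>"

definition essential_ray :: "(real^3) set \<Rightarrow> (real^3) set \<Rightarrow> bool" where
  "essential_ray \<sigma> \<rho> \<longleftrightarrow> exceptional_ray \<sigma> \<rho> \<and>
     (\<forall>\<Sigma>. regular_subdivision \<sigma> \<Sigma> \<longrightarrow> \<rho> \<in> \<Sigma>)"

definition essential_subdivision :: "(real^3) set \<Rightarrow> (real^3) set set \<Rightarrow> bool" where
  "essential_subdivision \<sigma> \<Sigma> \<longleftrightarrow> regular_subdivision \<sigma> \<Sigma> \<and>
     (\<exists>\<rho>s. (\<forall>\<rho>\<in>set \<rho>s. essential_ray \<sigma> \<rho>) \<and> \<Sigma> = fold star_subdivision \<rho>s (face_fan \<sigma>))"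

definition minimal_subdivision :: "(real^3) set \<Rightarrow> (real^3) set set \<Rightarrow> bool" where
  "minimal_subdivision \<sigma> \<Sigma> \<longleftrightarrow> regular_subdivision \<sigma> \<Sigma> \<and>
     (\<forall>\<Sigma>'. regular_subdivision \<sigma> \<Sigma>' \<longrightarrow>
        measure lebesgue (shed \<Sigma>) \<le> measure lebesgue (shed \<Sigma>'))"


section \<open>Toric schemes\<close>

text \<open>
  The dual lattice is identified with \<open>int^3\<close> via the standard pairing, and
  \<open>(int^3) \<Rightarrow>\<^sub>0 'r\<close> (finitely supported functions with the convolution product)
  is the ring of Laurent polynomials in three variables over the base ring, that is, the
  coordinate ring of the torus.
\<close>

definition dual_monoid :: "(real^3) set \<Rightarrow> (int^3) set" where
  "dual_monoid \<sigma> = {m. \<forall>x\<in>\<sigma>. 0 \<le> (\<Sum>i\<in>UNIV. of_int (m $ i) * x $ i)}"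

definition monoid_algebra :: "(int^3) set \<Rightarrow> ((int^3) \<Rightarrow>\<^sub>0 'r::comm_ring_1) set" where
  "monoid_algebra S = {f. Poly_Mapping.keys f \<subseteq> S}"

text \<open>
  A toric scheme over \<open>'r\<close> is given by its atlas of affine charts: the coordinate rings of
  the charts, all of them subrings of the Laurent polynomial ring.  The charts are glued
  along the inclusions among these subrings: for a face \<open>\<tau>\<close> of \<open>\<sigma>\<close> the ring of \<open>\<tau>\<close>
  contains the ring of \<open>\<sigma>\<close> and is a localization of it.
\<close>

definition toric_scheme ::
    "(real^3) set set \<Rightarrow> ((int^3) \<Rightarrow>\<^sub>0 'r::comm_ring_1) set set" where
  "toric_scheme \<Sigma> = (\<lambda>\<sigma>. monoid_algebra (dual_monoid \<sigma>)) ` \<Sigma>"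

text \<open>The predicates below describe models of the affine toric scheme of the cone \<open>\<sigma>\<close>.\<close>

definition essential_smooth_model ::
    "(real^3) set \<Rightarrow> ((int^3) \<Rightarrow>\<^sub>0 'r::comm_ring_1) set set \<Rightarrow> bool" where
  "essential_smooth_model \<sigma> X \<longleftrightarrow> (\<exists>\<Sigma>. essential_subdivision \<sigma> \<Sigma> \<and> X = toric_scheme \<Sigma>)"

definition minimal_smooth_model ::
    "(real^3) set \<Rightarrow> ((int^3) \<Rightarrow>\<^sub>0 'r::comm_ring_1) set set \<Rightarrow> bool" where
  "minimal_smooth_model \<sigma> X \<longleftrightarrow> (\<exists>\<Sigma>. minimal_subdivision \<sigma> \<Sigma> \<and> X = toric_scheme \<Sigma>)"


section \<open>The moduli scheme of rank four\<close>

definition sigma_M :: "nat \<Rightarrow> (real^3) set" where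
  "sigma_M q = convex_cone hull
     {vector [real q ^ 3 + real q ^ 2 + real q + 1, - (real q + 1), - (real q ^ 2 + real q + 1)],
      vector [0, 1, 0], vector [0, 0, 1]}"

definition Sigma_min :: "nat \<Rightarrow> (real^3) set set" where
  "Sigma_min q =
     star_subdivision (ray (vector [1, 0, 0]))
       (star_subdivision (ray (vector [real q ^ 2 + 1, - 1, - real q]))
         (face_fan (sigma_M q)))"

definition first_center :: "nat \<Rightarrow> nat \<Rightarrow> (real^3) set" where
  "first_center q k =
     ray (vector [real k * real q ^ 2 + real q + 1, - real k, - (real k * real q + 1)])"

definition second_center :: "nat \<Rightarrow> nat \<times> nat \<Rightarrow> (real^3) set" where
  "second_center q = (\<lambda>(k, l).
     ray (vector [real k * real q ^ 2 + real l * real q + 1, - real k, - (real k * real q + real l)]))"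

end

theory Submission
  imports Defs
begin

text \<open>
  Project the cone along \<open>e\<^sub>2\<close> to the \<open>(x, z)\<close>-plane. Over each lattice point \<open>(1 + q s, - s)\<close>,
  \<open>0 \<le> s \<le> N = q\<^sup>2 + q + 1\<close>, of height \<open>x + q z = 1\<close> there is a lowest lattice point \<open>W s\<close> of the
  cone. These points are irreducible in the monoid of lattice points of the cone, since only
  multiples of \<open>e\<^sub>2\<close> have height 0; hence their rays belong to every regular subdivision.

  In a regular subdivision all of whose rays are spanned by \<open>e\<^sub>2\<close>, \<open>e\<^sub>3\<close> and the \<open>W s\<close>, the point
  \<open>W s + e\<^sub>2\<close> has only one decomposition into generators, so the vertical wall spanned by \<open>W s\<close> and
  \<open>e\<^sub>2\<close> is one of the cones. A cone spanned by \<open>W a\<close> and \<open>W b\<close> must not cross the walls in between,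
  and this leaves only one possible set of maximal cones. It is unimodular. The star subdivisions
  of the theorem lead to it in any order, because each new ray lies on or above the cone spanned by
  its two current neighbours and therefore creates its own wall.

  The shed is even minimal for inclusion. If a lattice form is positive on the cone and takes the
  value 1 on the generators of a maximal cone, it is at least 1 on all lattice points, hence the
  shed of that cone is contained in every other shed. For the maximal cones without such a form the
  height plays its role, except against cones that contain \<open>e\<^sub>2\<close>; those project into a single
  sector between neighbouring \<open>W s\<close> and \<open>W (s + 1)\<close>.
\<close>

section \<open>Simplicial cones\<close>

text \<open>The obstacle in the uniqueness claim is that nothing is known about the intermediate
  fans of a chain of star subdivisions: only the last one is regular. Hence the chain is not
  followed cone by cone; the one property carried along is which vectors generate the cones. Because
  \<open>q^3 + q^2 + q + 1 = (q^2 + 1) (q + 1)\<close>, one facet of the cone is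
  \<open>x + (q^2 + 1) y = 0\<close>. So the depth of \<open>W s\<close> is the integer part of
  \<open>(1 + q s) / (q^2 + 1)\<close>, which increases at \<open>s = q\<close> and then at
  \<open>s = k q + 1\<close> for \<open>k >= 2\<close>. The early increase at \<open>q\<close>
  instead of \<open>q + 1\<close> makes \<open>W q\<close> exceptional: it gets joined to all
  \<open>W (k q + 1)\<close>. The cells without \<open>e\<^sub>2\<close> are reached by crossing
  facets, starting from the sectors between neighbouring walls. The linear relation across each such
  facet has coefficient -1 at the vertex left behind, which yields both the presence of the next
  cell and its unimodularity. The form equal to 1 on a sector cell can be negative elsewhere on the
  cone, so it can be used only against cones inside the same sector.\<close>

lemma convex_cone_sum:
  assumes "convex_cone K" "\<And>i. i \<in> I \<Longrightarrow> f i \<in> K"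
  shows "sum f I \<in> K"
  using assms(2)
  by (induction I rule: infinite_finite_induct)
     (auto simp: assms(1) convex_cone_contains_0 convex_cone_add)

lemma convex_cone_hull_finite:
  assumes "finite S"
  shows "convex_cone hull S = {\<Sum>b\<in>S. c b *\<^sub>R b | c. \<forall>b\<in>S. 0 \<le> c b}"
proof (rule hull_unique)
  show "S \<subseteq> {\<Sum>b\<in>S. c b *\<^sub>R b | c. \<forall>b\<in>S. 0 \<le> c b}"
  proof
    fix x assume "x \<in> S"
    then have "x = (\<Sum>b\<in>S. (if b = x then 1 else 0) *\<^sub>R b)"
      using assms by (simp add: if_distrib[of "\<lambda>c. c *\<^sub>R _"] cong: if_cong)
    then show "x \<in> {\<Sum>b\<in>S. c b *\<^sub>R b | c. \<forall>b\<in>S. 0 \<le> c b}"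
      by (intro CollectI exI[of _ "\<lambda>b. if b = x then 1 else 0"]) auto
  qed
  show "convex_cone {\<Sum>b\<in>S. c b *\<^sub>R b | c. \<forall>b\<in>S. 0 \<le> c b}"
    unfolding convex_cone_iff
  proof (intro conjI ballI allI impI)
    show "0 \<in> {\<Sum>b\<in>S. c b *\<^sub>R b | c. \<forall>b\<in>S. 0 \<le> c b}"
      by (intro CollectI exI[of _ "\<lambda>_. 0"]) auto
  next
    fix x y assume "x \<in> {\<Sum>b\<in>S. c b *\<^sub>R b | c. \<forall>b\<in>S. 0 \<le> c b}"
      "y \<in> {\<Sum>b\<in>S. c b *\<^sub>R b | c. \<forall>b\<in>S. 0 \<le> c b}"
    then obtain c d where "x = (\<Sum>b\<in>S. c b *\<^sub>R b)" "\<forall>b\<in>S. 0 \<le> c b"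
      "y = (\<Sum>b\<in>S. d b *\<^sub>R b)" "\<forall>b\<in>S. 0 \<le> d b" by blast
    then show "x + y \<in> {\<Sum>b\<in>S. c b *\<^sub>R b | c. \<forall>b\<in>S. 0 \<le> c b}"
      by (intro CollectI exI[of _ "\<lambda>b. c b + d b"])
         (auto simp: scaleR_add_left sum.distrib)
  next
    fix x and r :: real assume "x \<in> {\<Sum>b\<in>S. c b *\<^sub>R b | c. \<forall>b\<in>S. 0 \<le> c b}" "0 \<le> r"
    then obtain c where "x = (\<Sum>b\<in>S. c b *\<^sub>R b)" "\<forall>b\<in>S. 0 \<le> c b" by blast
    then show "r *\<^sub>R x \<in> {\<Sum>b\<in>S. c b *\<^sub>R b | c. \<forall>b\<in>S. 0 \<le> c b}"
      using \<open>0 \<le> r\<close>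
      by (intro CollectI exI[of _ "\<lambda>b. r * c b"]) (auto simp: scaleR_sum_right)
  qed
  fix K :: "'a set" assume "S \<subseteq> K" "convex_cone K"
  then show "{\<Sum>b\<in>S. c b *\<^sub>R b | c. \<forall>b\<in>S. 0 \<le> c b} \<subseteq> K"
    by (auto intro!: convex_cone_sum convex_cone_scaleR)
qed

lemma convex_cone_hull_subset_span: "convex_cone hull S \<subseteq> span S"
  by (intro hull_minimal span_superset subspace_imp_convex_cone subspace_span)

text \<open>The form in which simplicial cones are handled from here on: faces are cut out by the
  vanishing of coordinates. As \<open>representation B\<close> is zero outside \<open>B\<close>, the
  conditions can range over all vectors.\<close>

lemma in_cone_iff:
  fixes B :: "'a::euclidean_space set"
  assumes B: "independent B" and S: "S \<subseteq> B"
  shows "x \<in> convex_cone hull S \<longleftrightarrow> x \<in> span B \<and> (\<forall>b. 0 \<le> representation B x b) \<and>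
           (\<forall>b. b \<notin> S \<longrightarrow> representation B x b = 0)"
    (is "?l \<longleftrightarrow> ?r")
proof
  have fS: "finite S" and fB: "finite B"
    using B S independent_imp_finite finite_subset by blast+
  show ?r if ?l
  proof -
    obtain c where x: "x = (\<Sum>b\<in>S. c b *\<^sub>R b)" and c: "\<forall>b\<in>S. 0 \<le> c b"
      using \<open>?l\<close> convex_cone_hull_finite[OF fS] by auto
    define d where "d = (\<lambda>b. if b \<in> S then c b else 0)"
    have xs: "x \<in> span B"
      using \<open>?l\<close> convex_cone_hull_subset_span[of S] span_mono[OF S] by blast
    have "representation B x = d"
    proof (rule representation_eqI[OF B xs])
      show "finite {b. d b \<noteq> 0}"
        by (rule finite_subset[OF _ fS]) (auto simp: d_def)
      show "(\<Sum>b | d b \<noteq> 0. d b *\<^sub>R b) = x"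
        unfolding x by (rule sum.mono_neutral_cong_left[OF fS]) (auto simp: d_def)
    qed (use S in \<open>auto simp: d_def split: if_splits\<close>)
    then show ?r using xs c by (auto simp: d_def)
  qed
  assume r: ?r
  then have "x = (\<Sum>b\<in>B. representation B x b *\<^sub>R b)"
    using sum_representation_eq[OF B _ fB, of x] by auto
  also have "\<dots> = (\<Sum>b\<in>S. representation B x b *\<^sub>R b)"
    using r by (intro sum.mono_neutral_right) (use fB S in auto)
  finally show ?l using r by (auto simp: convex_cone_hull_finite[OF fS])
qed

text \<open>A face that contains \<open>x + y\<close>, the midpoint of \<open>2 x\<close> and
  \<open>2 y\<close>, contains \<open>x\<close> and \<open>y\<close>; so it contains each nonzero
  summand of a conic combination that represents one of its points. \<open>S\<close> is any finite
  set, since \<open>generated_by_star_subdivision\<close> applies this to cones not known to be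
  simplicial.\<close>

lemma cone_face_eq_hull:
  assumes "finite S" and f: "cone_face \<tau> (convex_cone hull S)"
  shows "\<tau> = convex_cone hull (S \<inter> \<tau>)"
proof -
  have fo: "\<tau> face_of convex_cone hull S" and ne: "\<tau> \<noteq> {}"
    using f by (auto simp: cone_face_def)
  have con: "conic \<tau>"
    using fo conic_convex_cone_hull face_of_conic by blast
  have cc: "convex_cone \<tau>"
    using con ne face_of_imp_convex[OF fo] by (simp add: convex_cone_def)
  have split: "x \<in> \<tau>" if "x + y \<in> \<tau>" "x \<in> convex_cone hull S" "y \<in> convex_cone hull S" for x y
  proof -
    have K: "2 *\<^sub>R x \<in> convex_cone hull S" "2 *\<^sub>R y \<in> convex_cone hull S"
      using that by (simp_all add: convex_cone_hull_mul)
    have "2 *\<^sub>R x \<in> \<tau>"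
    \<comment> \<open>For \<open>x = y\<close> the open segment is empty, but then
      \<open>2 x\<close> is the given point of the face.\<close>
    proof (cases "x = y")
      case True
      then show ?thesis using that(1) by (simp add: scaleR_2)
    next
      case False
      have "x + y \<in> open_segment (2 *\<^sub>R x) (2 *\<^sub>R y)"
        using False unfolding in_segment by (intro conjI exI[of _ "1/2"]) simp_all
      then show ?thesis using face_ofD[OF fo] K that(1) by blast
    qed
    then show ?thesis using conic_mul[OF con, of "2 *\<^sub>R x" "1/2"] by simp
  qed
  show ?thesis
  proof
    show "convex_cone hull (S \<inter> \<tau>) \<subseteq> \<tau>"
      by (rule hull_minimal) (auto simp: cc)
    show "\<tau> \<subseteq> convex_cone hull (S \<inter> \<tau>)"
    proof
      fix x assume x: "x \<in> \<tau>"
      then have "x \<in> convex_cone hull S" using face_of_imp_subset[OF fo] by blast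
      then obtain c where c: "\<forall>b\<in>S. 0 \<le> c b" and xc: "x = (\<Sum>b\<in>S. c b *\<^sub>R b)"
        using convex_cone_hull_finite[OF assms(1)] by auto
      have K: "c b *\<^sub>R b \<in> convex_cone hull S" if "b \<in> S" for b
        using that c by (simp add: convex_cone_hull_mul hull_inc)
      have "c b *\<^sub>R b \<in> convex_cone hull (S \<inter> \<tau>)" if b: "b \<in> S" for b
      proof (cases "c b = 0")
        case False
        have "x = c b *\<^sub>R b + (\<Sum>b\<in>S - {b}. c b *\<^sub>R b)"
          unfolding xc using assms(1) b by (simp add: sum.remove)
        moreover have "(\<Sum>b\<in>S - {b}. c b *\<^sub>R b) \<in> convex_cone hull S"
          by (intro convex_cone_sum convex_cone_convex_cone_hull K) auto
        ultimately have "c b *\<^sub>R b \<in> \<tau>"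
          using split[of "c b *\<^sub>R b" "\<Sum>b\<in>S - {b}. c b *\<^sub>R b"] x K[OF b] by simp
        then have "b \<in> \<tau>" using conic_mul[OF con, of "c b *\<^sub>R b" "1 / c b"] c b False by simp
        then show ?thesis using b c by (simp add: convex_cone_hull_mul hull_inc)
      qed (simp add: convex_cone_hull_contains_0)
      then show "x \<in> convex_cone hull (S \<inter> \<tau>)"
        unfolding xc by (intro convex_cone_sum convex_cone_convex_cone_hull)
    qed
  qed
qed

text \<open>A coordinate outside \<open>S\<close> is nonnegative at both ends of a segment in the
  cone; if it vanishes at an inner point, it vanishes at both ends.\<close>

lemma cone_face_hull_subset:
  assumes B: "independent B" and S: "S \<subseteq> B"
  shows "cone_face (convex_cone hull S) (convex_cone hull B)"
  unfolding cone_face_def face_of_def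
proof (intro conjI ballI impI)
  show "convex_cone hull S \<subseteq> convex_cone hull B" by (rule hull_mono[OF S])
  show "convex (convex_cone hull S)" by (rule convex_convex_cone_hull)
  show "convex_cone hull S \<noteq> {}" by (rule convex_cone_hull_nonempty)
  fix a b x assume a: "a \<in> convex_cone hull B" and b: "b \<in> convex_cone hull B"
    and x: "x \<in> convex_cone hull S" and seg: "x \<in> open_segment a b"
  obtain u where u: "0 < u" "u < 1" and xu: "x = (1 - u) *\<^sub>R a + u *\<^sub>R b"
    using seg by (auto simp: in_segment)
  note iff = in_cone_iff[OF B order_refl] in_cone_iff[OF B S]
  have ab: "a \<in> span B" "b \<in> span B" using a b iff by auto
  have rep: "representation B x c = (1 - u) * representation B a c + u * representation B b c" for c
    using ab by (simp add: xu representation_add[OF B] representation_scale[OF B] span_scale)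
  have "representation B a c = 0 \<and> representation B b c = 0" if "c \<notin> S" for c
  proof -
    have "0 \<le> (1 - u) * representation B a c" "0 \<le> u * representation B b c"
      using a b u iff by auto
    moreover have "representation B x c = 0" using x that iff by auto
    ultimately have "(1 - u) * representation B a c = 0 \<and> u * representation B b c = 0"
      using rep[of c] by linarith
    then show ?thesis using u by auto
  qed
  then show "a \<in> convex_cone hull S" "b \<in> convex_cone hull S"
    using a b iff by auto
qed

lemma cone_face_iff:
  assumes B: "independent B"
  shows "cone_face \<tau> (convex_cone hull B) \<longleftrightarrow> (\<exists>S\<subseteq>B. \<tau> = convex_cone hull S)"
  using cone_face_eq_hull[OF independent_imp_finite[OF B], of \<tau>] cone_face_hull_subset[OF B]
  by (auto intro: exI[of _ "B \<inter> \<tau>"])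

lemma representation_combination:
  fixes B :: "'a::euclidean_space set"
  assumes "independent B" "b \<in> B"
  shows "representation B (\<Sum>b\<in>B. c b *\<^sub>R b) b = c b"
proof -
  have fB: "finite B" using assms(1) independent_imp_finite by blast
  have "representation B (\<Sum>b\<in>B. c b *\<^sub>R b) b = (\<Sum>a\<in>B. representation B (c a *\<^sub>R a) b)"
    using assms by (subst representation_sum) (auto intro: span_scale span_base)
  also have "\<dots> = (\<Sum>a\<in>B. if a = b then c b else 0)"
    using assms by (intro sum.cong refl)
      (simp add: representation_scale[OF assms(1) span_base] representation_basis[OF assms(1)])
  finally show ?thesis using fB assms(2) by simp
qed

lemma sum_representation_cone:
  fixes B :: "'a::euclidean_space set"
  assumes "independent B" "x \<in> convex_cone hull B" "linear f"
  shows "f x = (\<Sum>b\<in>B. representation B x b *\<^sub>R f b)"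
proof -
  have "x = (\<Sum>b\<in>B. representation B x b *\<^sub>R b)"
    using sum_representation_eq[OF assms(1), of x B] in_cone_iff[OF assms(1) order_refl, of x] assms(2)
      independent_imp_finite[OF assms(1)] by simp
  then have "f x = f (\<Sum>b\<in>B. representation B x b *\<^sub>R b)" by simp
  then show ?thesis using assms(3) by (simp add: linear_sum linear_scale)
qed

lemma linear_nonneg_on_cone:
  assumes "linear f" "\<And>b. b \<in> B \<Longrightarrow> 0 \<le> f b" "x \<in> convex_cone hull B"
  shows "0 \<le> (f x :: real)"
proof -
  have "convex_cone {x. 0 \<le> f x}"
    using assms(1) by (auto simp: convex_cone_iff linear_add linear_scale linear_0)
  then have "convex_cone hull B \<subseteq> {x. 0 \<le> f x}" using assms(2) by (intro hull_minimal) auto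
  then show ?thesis using assms(3) by blast
qed

lemma linear_pos_on_cone:
  assumes S: "finite S" and f: "linear f" "\<And>b. b \<in> S \<Longrightarrow> 0 < (f b :: real)"
    and x: "x \<in> convex_cone hull S" "x \<noteq> 0"
  shows "0 < f x"
proof -
  obtain c where c: "\<forall>b\<in>S. 0 \<le> c b" and xc: "x = (\<Sum>b\<in>S. c b *\<^sub>R b)"
    using x(1) unfolding convex_cone_hull_finite[OF S] by blast
  have "\<exists>b\<in>S. c b \<noteq> 0"
  proof (rule ccontr)
    assume "\<not> ?thesis"
    then have "(\<Sum>b\<in>S. c b *\<^sub>R b) = 0" by (intro sum.neutral) auto
    then show False using x(2) xc by simp
  qed
  then obtain b where b: "b \<in> S" "0 < c b" using c by force
  have "f x = (\<Sum>b\<in>S. c b * f b)" unfolding xc using f(1) by (simp add: linear_sum linear_scale)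
  also have "\<dots> > 0" using S b c f(2) by (intro sum_pos2[of S b]) (auto simp: less_imp_le)
  finally show ?thesis .
qed

section \<open>Simplicial complexes of cones\<close>

text \<open>A complex is given by the sets of generators of its maximal cones; identifying cones with
  generating sets requires that no two generators in use span the same ray, which the intersection
  condition enforces.\<close>

definition cone_complex :: "'a::euclidean_space set set \<Rightarrow> bool" where
  "cone_complex T \<longleftrightarrow> finite T \<and> (\<forall>B\<in>T. independent B) \<and>
     (\<forall>B\<in>T. \<forall>B'\<in>T. convex_cone hull B \<inter> convex_cone hull B' \<subseteq> convex_cone hull (B \<inter> B'))"

definition support :: "'a::real_vector set set \<Rightarrow> 'a set" where
  "support T = (\<Union>B\<in>T. convex_cone hull B)"

definition cone_fan :: "'a::real_vector set set \<Rightarrow> 'a set set" where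
  "cone_fan T = {convex_cone hull S | S B. B \<in> T \<and> S \<subseteq> B}"

lemma cone_complexD:
  assumes "cone_complex T" "B \<in> T"
  shows "independent B" "finite B"
  using assms by (auto simp: cone_complex_def independent_imp_finite)

text \<open>The common point lies in the span of the common generators, and enlarging an independent
  set does not change coordinates. Coordinates of a point thus belong to the complex rather than to
  one of its cones.\<close>

lemma representation_complex:
  assumes T: "cone_complex T" "B \<in> T" "B' \<in> T"
    and x: "x \<in> convex_cone hull B" "x \<in> convex_cone hull B'"
  shows "representation B x = representation B' x"
proof -
  have "x \<in> convex_cone hull (B \<inter> B')" using T x by (auto simp: cone_complex_def)
  then have "x \<in> span (B \<inter> B')" using convex_cone_hull_subset_span by blast
  then have "representation B x = representation (B \<inter> B') x"
    "representation B' x = representation (B \<inter> B') x"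
    using representation_extend[OF cone_complexD(1)[OF T(1,2)]]
      representation_extend[OF cone_complexD(1)[OF T(1,3)]] by simp_all
  then show ?thesis by simp
qed

text \<open>The generators with nonzero coordinate span the smallest cone of the complex that
  contains \<open>x\<close>. Most incidence arguments below rest on this.\<close>

lemma complex_carrier:
  assumes T: "cone_complex T" "B \<in> T" "B' \<in> T" "S \<subseteq> B'"
    and x: "x \<in> convex_cone hull B" "x \<in> convex_cone hull S"
  shows "{b. representation B x b \<noteq> 0} \<subseteq> S"
proof -
  have "x \<in> convex_cone hull B'" using x(2) hull_mono[OF T(4), of convex_cone] by blast
  then have "representation B x = representation B' x"
    by (rule representation_complex[OF T(1-3) x(1)])
  moreover have "\<forall>b. b \<notin> S \<longrightarrow> representation B' x b = 0"
    using x(2) by (simp add: in_cone_iff[OF cone_complexD(1)[OF T(1,3)] T(4)])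
  ultimately show ?thesis by auto
qed

lemma complex_cone_Int:
  assumes T: "cone_complex T" "B \<in> T" "B' \<in> T" "S \<subseteq> B" "S' \<subseteq> B'"
  shows "convex_cone hull S \<inter> convex_cone hull S' = convex_cone hull (S \<inter> S')"
proof
  show "convex_cone hull (S \<inter> S') \<subseteq> convex_cone hull S \<inter> convex_cone hull S'"
    by (simp add: hull_mono)
  show "convex_cone hull S \<inter> convex_cone hull S' \<subseteq> convex_cone hull (S \<inter> S')"
  proof
    fix x assume x: "x \<in> convex_cone hull S \<inter> convex_cone hull S'"
    then have xB: "x \<in> convex_cone hull B" using hull_mono[OF T(4), of convex_cone] by blast
    have "{b. representation B x b \<noteq> 0} \<subseteq> S" "{b. representation B x b \<noteq> 0} \<subseteq> S'"
      using complex_carrier[OF T(1,2,2,4) xB] complex_carrier[OF T(1,2,3,5) xB] x by simp_all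
    then have z: "\<forall>b. b \<notin> S \<inter> S' \<longrightarrow> representation B x b = 0" by blast
    have "S \<inter> S' \<subseteq> B" using T(4) by blast
    then show "x \<in> convex_cone hull (S \<inter> S')"
      using z xB by (simp add: in_cone_iff[OF cone_complexD(1)[OF T(1,2)]])
  qed
qed

lemma fan_cone_fan:
  assumes T: "cone_complex T" and lat: "\<And>B. B \<in> T \<Longrightarrow> B \<subseteq> lattice"
  shows "fan (cone_fan T)"
  unfolding fan_def
proof (intro conjI ballI allI impI)
  have fT: "finite T" and fB: "\<And>B. B \<in> T \<Longrightarrow> finite B"
    using T cone_complexD by (auto simp: cone_complex_def)
  have "cone_fan T = (\<Union>B\<in>T. (hull) convex_cone ` Pow B)" by (auto simp: cone_fan_def)
  then show "finite (cone_fan T)" using fT fB by auto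
  fix \<sigma> assume "\<sigma> \<in> cone_fan T"
  then obtain S B where \<sigma>: "B \<in> T" "S \<subseteq> B" "\<sigma> = convex_cone hull S" by (auto simp: cone_fan_def)
  note B = cone_complexD[OF T \<sigma>(1)]
  have iS: "independent S" using B(1) \<sigma>(2) independent_mono by blast
  show "rational_cone \<sigma>" unfolding rational_cone_def using \<sigma> lat[OF \<sigma>(1)] B
    by (intro exI[of _ S]) (auto dest: finite_subset)
  show "strongly_convex \<sigma>" unfolding strongly_convex_def
  proof (intro allI impI)
    fix x assume x: "x \<in> \<sigma> \<and> - x \<in> \<sigma>"
    then have xs: "x \<in> span S" "\<forall>b. 0 \<le> representation S x b" "\<forall>b. 0 \<le> representation S (-x) b"
      using \<sigma>(3) in_cone_iff[OF iS order_refl] by auto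
    have "representation S x b = 0" for b
      using xs(2) spec[OF xs(3), of b] representation_neg[OF iS xs(1)] by (simp add: order_antisym)
    then show "x = 0"
      using sum_representation_eq[OF iS xs(1), of S] independent_imp_finite[OF iS] by simp
  qed
  {
    fix \<tau> assume "cone_face \<tau> \<sigma>"
    then obtain S' where "S' \<subseteq> S" "\<tau> = convex_cone hull S'"
      using cone_face_iff[OF iS] \<sigma>(3) by blast
    then show "\<tau> \<in> cone_fan T"
      using \<sigma>(1,2) unfolding cone_fan_def by blast
  }
  fix \<sigma>' assume "\<sigma>' \<in> cone_fan T"
  then obtain S' B' where \<sigma>': "B' \<in> T" "S' \<subseteq> B'" "\<sigma>' = convex_cone hull S'"
    by (auto simp: cone_fan_def)
  have iS': "independent S'" using cone_complexD[OF T \<sigma>'(1)] \<sigma>'(2) independent_mono by blast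
  have eq: "\<sigma> \<inter> \<sigma>' = convex_cone hull (S \<inter> S')"
    using complex_cone_Int[OF T \<sigma>(1) \<sigma>'(1) \<sigma>(2) \<sigma>'(2)] \<sigma>(3) \<sigma>'(3) by simp
  show "cone_face (\<sigma> \<inter> \<sigma>') \<sigma>" "cone_face (\<sigma> \<inter> \<sigma>') \<sigma>'"
    unfolding eq unfolding \<sigma>(3) \<sigma>'(3)
    using cone_face_hull_subset[OF iS, of "S \<inter> S'"] cone_face_hull_subset[OF iS', of "S \<inter> S'"]
    by auto
qed

lemma Union_cone_fan: "\<Union>(cone_fan T) = support T"
proof -
  have "x \<in> support T" if "x \<in> convex_cone hull S" "B \<in> T" "S \<subseteq> B" for x S B
    using that hull_mono[OF that(3), of convex_cone] by (auto simp: support_def)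
  then show ?thesis by (auto simp: cone_fan_def) (auto simp: support_def)
qed

text \<open>Move from the relatively interior point \<open>u + v\<close> of the facet slightly
  towards \<open>z\<close>. Convexity keeps the point in the support, the closed cones that do not
  have both \<open>u\<close> and \<open>v\<close> as generators stay away from it, and its
  \<open>b\<close>-coordinate is negative by \<open>rel\<close>. So it lies in another cone with the
  same facet.\<close>

lemma complex_across_facet:
  fixes T :: "'a::euclidean_space set set"
  assumes T: "cone_complex T" "\<forall>B\<in>T. card B = 3" and B1: "{u, v, b} \<in> T" and uv: "u \<noteq> v" "b \<noteq> u" "b \<noteq> v"
    and K: "convex_cone (support T)" and z: "z \<in> support T"
    and rel: "z = \<alpha> *\<^sub>R u + \<beta> *\<^sub>R v - \<gamma> *\<^sub>R b" "0 < \<gamma>"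
  shows "\<exists>z'. z' \<notin> {u, v, b} \<and> {u, v, z'} \<in> T"
proof -
  let ?B1 = "{u, v, b}"
  note i1 = cone_complexD(1)[OF T(1) B1]
  have x1: "u + v \<in> convex_cone hull ?B1"
    by (intro convex_cone_hull_add) (simp_all add: hull_inc)
  have rep: "representation ?B1 (c *\<^sub>R u + d *\<^sub>R v + e *\<^sub>R b) w =
      (if w = u then c else if w = v then d else if w = b then e else 0)" for c d e w
  proof -
    have "representation ?B1 (c *\<^sub>R u + d *\<^sub>R v + e *\<^sub>R b) w =
        c * representation ?B1 u w + d * representation ?B1 v w + e * representation ?B1 b w"
      by (simp add: representation_add[OF i1] representation_scale[OF i1] span_add span_scale span_base)
    then show ?thesis using uv by (auto simp: representation_basis[OF i1])
  qed
  have fT: "finite T" using T(1) by (simp add: cone_complex_def)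
  define U where "U = (\<Union>B\<in>{B\<in>T. \<not> {u, v} \<subseteq> B}. convex_cone hull B)"
  have "closed U" unfolding U_def using fT cone_complexD(2)[OF T(1)]
    by (intro closed_UN) (auto intro: closed_convex_cone_hull)
  moreover have xU: "u + v \<in> - U"
  proof
    assume "u + v \<in> U"
    then obtain B where B: "B \<in> T" "\<not> {u, v} \<subseteq> B" "u + v \<in> convex_cone hull B" by (auto simp: U_def)
    note complex_carrier[OF T(1) B1 B(1) order_refl x1 B(3)]
    moreover have "representation ?B1 (u + v) w = (if w = u then 1 else if w = v then 1 else 0)" for w
      using rep[of 1 1 0 w] by auto
    then have "u \<in> {w. representation ?B1 (u + v) w \<noteq> 0}" "v \<in> {w. representation ?B1 (u + v) w \<noteq> 0}"
      by simp_all
    ultimately show False using B(2) by blast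
  qed
  moreover have "((\<lambda>e. (u + v) + e *\<^sub>R z) \<longlongrightarrow> (u + v) + 0 *\<^sub>R z) (at_right 0)"
    by (intro tendsto_intros)
  ultimately have "\<forall>\<^sub>F e in at_right 0. (u + v) + e *\<^sub>R z \<in> - U"
    using topological_tendstoD[of "\<lambda>e. (u + v) + e *\<^sub>R z" "u + v" "at_right 0" "- U"]
    by (simp add: open_Compl)
  then have "\<forall>\<^sub>F e in at_right (0::real). 0 < e \<and> (u + v) + e *\<^sub>R z \<in> - U"
    using eventually_at_right_less[of "0::real"] by eventually_elim simp
  then obtain e :: real where e: "0 < e" "(u + v) + e *\<^sub>R z \<notin> U"
    using eventually_happens[of _ "at_right (0::real)"] by auto
  have "u + v \<in> support T" using x1 B1 by (auto simp: support_def)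
  then have "(u + v) + e *\<^sub>R z \<in> support T"
    using convex_cone_add[OF K _ convex_cone_scaleR[OF K _ z, of e]] e(1) by simp
  then obtain B where B: "B \<in> T" "(u + v) + e *\<^sub>R z \<in> convex_cone hull B" by (auto simp: support_def)
  have uvB: "{u, v} \<subseteq> B" using B e(2) by (auto simp: U_def)
  have "card (B - {u, v}) = 1"
    using uvB T(2) B(1) uv cone_complexD(2)[OF T(1) B(1)] by (simp add: card_Diff_subset)
  then obtain z' where z': "B - {u, v} = {z'}" by (auto simp: card_1_singleton_iff)
  then have BB: "B = {u, v, z'}" "z' \<notin> {u, v}" using uvB by auto
  have "z' \<noteq> b"
  proof
    assume "z' = b"
    then have "(u + v) + e *\<^sub>R z \<in> convex_cone hull ?B1" using B BB by simp
    then have "0 \<le> representation ?B1 ((u + v) + e *\<^sub>R z) b"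
      using in_cone_iff[OF i1 order_refl] by blast
    moreover have "(u + v) + e *\<^sub>R z = (1 + e * \<alpha>) *\<^sub>R u + (1 + e * \<beta>) *\<^sub>R v + (- e * \<gamma>) *\<^sub>R b"
      by (simp add: rel(1) algebra_simps)
    ultimately have "0 \<le> - e * \<gamma>" using rep[of "1 + e * \<alpha>" "1 + e * \<beta>" "- e * \<gamma>" b] uv by simp
    then show False using e(1) rel(2) by (simp add: mult_le_0_iff)
  qed
  then show ?thesis using BB B(1) by blast
qed

section \<open>Star subdivisions of complexes\<close>

text \<open>\<open>S\<close> is meant to be the set of generators of the smallest cone containing
  \<open>v\<close>. Then \<open>S \<subseteq> B\<close> says that the cone of \<open>B\<close>
  contains \<open>v\<close>, and exchanging an element of \<open>S\<close> for \<open>v\<close>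
  preserves independence.\<close>

definition star_complex :: "'a::real_vector set \<Rightarrow> 'a \<Rightarrow> 'a set set \<Rightarrow> 'a set set" where
  "star_complex S v T = {B \<in> T. \<not> S \<subseteq> B} \<union> {insert v (B - {b}) | B b. B \<in> T \<and> S \<subseteq> B \<and> b \<in> S}"

text \<open>\<open>B0\<close> serves to define the coordinates \<open>r\<close> of \<open>v\<close>
  and their support \<open>S\<close>; by \<open>representation_complex\<close> every other cone
  through \<open>v\<close> gives the same ones.\<close>

locale star_center =
  fixes T :: "'a::euclidean_space set set" and v :: 'a and B0 :: "'a set" and r :: "'a \<Rightarrow> real"
    and S :: "'a set"
  assumes T: "cone_complex T" and B0: "B0 \<in> T" and vB0: "v \<in> convex_cone hull B0"
    and v0: "v \<noteq> 0" and vT: "\<And>B. B \<in> T \<Longrightarrow> v \<notin> B"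
    and r_def: "r = representation B0 v" and S_def: "S = {b. representation B0 v b \<noteq> 0}"
begin

lemma r_nonneg: "0 \<le> r b" and r_zero_iff: "r b = 0 \<longleftrightarrow> b \<notin> S" and r_pos: "b \<in> S \<Longrightarrow> 0 < r b"
proof -
  show *: "0 \<le> r b" for b
    using vB0 by (simp add: r_def in_cone_iff[OF cone_complexD(1)[OF T B0] order_refl])
  show **: "r b = 0 \<longleftrightarrow> b \<notin> S" for b by (simp add: r_def S_def)
  show "b \<in> S \<Longrightarrow> 0 < r b" using *[of b] **[of b] by linarith
qed

lemma S_subset: "S \<subseteq> B0"
  using representation_ne_zero by (auto simp: S_def)

lemma finite_S: "finite S" using S_subset cone_complexD(2)[OF T B0] finite_subset by blast

lemma S_nonempty: "S \<noteq> {}"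
proof
  assume "S = {}"
  then have "\<forall>b. representation B0 v b = 0" by (auto simp: S_def)
  moreover have "v \<in> span B0"
    using vB0 convex_cone_hull_subset_span by blast
  ultimately have "v = 0"
    using sum_representation_eq[OF cone_complexD(1)[OF T B0], of v B0] cone_complexD(2)[OF T B0]
    by simp
  then show False using v0 by simp
qed

lemma v_in_S: "v \<in> convex_cone hull S"
  using vB0 S_subset unfolding in_cone_iff[OF cone_complexD(1)[OF T B0] S_subset]
    in_cone_iff[OF cone_complexD(1)[OF T B0] order_refl]
  by (simp add: S_def)

lemma v_in_cone_iff:
  assumes "B \<in> T" "S' \<subseteq> B"
  shows "v \<in> convex_cone hull S' \<longleftrightarrow> S \<subseteq> S'"
proof
  show "v \<in> convex_cone hull S' \<Longrightarrow> S \<subseteq> S'"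
    using complex_carrier[OF T B0 assms vB0] by (simp add: S_def)
  show "S \<subseteq> S' \<Longrightarrow> v \<in> convex_cone hull S'"
    using v_in_S hull_mono[of S S' convex_cone] by blast
qed

lemma representation_v:
  assumes "B \<in> T" "S \<subseteq> B"
  shows "representation B v = r"
  using representation_complex[OF T assms(1) B0 _ vB0] v_in_cone_iff[OF assms(1) order_refl] assms(2)
  by (simp add: r_def)

lemma v_notin_span:
  assumes "B \<in> T" "S \<subseteq> B" "b \<in> S"
  shows "v \<notin> span (B - {b})"
proof
  assume v: "v \<in> span (B - {b})"
  have "representation B v = representation (B - {b}) v"
    using representation_extend[OF cone_complexD(1)[OF T assms(1)] v] by simp
  then have "r b = 0"
    using representation_ne_zero[of "B - {b}" v b] representation_v[OF assms(1,2)] by auto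
  then show False using r_zero_iff assms(3) by blast
qed

lemma independent_insert_v:
  assumes "B \<in> T" "S \<subseteq> B" "b \<in> S"
  shows "independent (insert v (B - {b}))"
  using v_notin_span[OF assms] independent_mono[OF cone_complexD(1)[OF T assms(1)], of "B - {b}"]
  by (intro independent_insertI) auto

text \<open>In the cone that omits \<open>b\<close>, the coefficient of \<open>v\<close> is the quotient of the \<open>b\<close>-coordinates
  of \<open>x\<close> and \<open>v\<close>, which is minimal among all such quotients.\<close>

lemma in_insert_cone_iff:
  assumes B: "B \<in> T" "S \<subseteq> B" and b: "b \<in> S" and S': "S' \<subseteq> B - {b}"
  shows "x \<in> convex_cone hull insert v S' \<longleftrightarrow> x \<in> convex_cone hull B \<and>
    (\<forall>c. representation B x b / r b * r c \<le> representation B x c) \<and>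
    (\<forall>c. c \<notin> S' \<longrightarrow> representation B x c = representation B x b / r b * r c)"
    (is "?l \<longleftrightarrow> ?r")
proof -
  note iB = cone_complexD(1)[OF T B(1)]
  note rv = representation_v[OF B]
  have vB: "v \<in> convex_cone hull B" using v_in_cone_iff[OF B(1) order_refl] B(2) by simp
  have vs: "v \<in> span B" using vB convex_cone_hull_subset_span by blast
  have rb: "0 < r b" using r_pos b .
  have bS': "b \<notin> S'" and S'B: "S' \<subseteq> B" using S' by auto
  have fS': "finite S'" using S'B cone_complexD(2)[OF T B(1)] finite_subset by blast
  have "?l \<longleftrightarrow> (\<exists>\<alpha>\<ge>0. x - \<alpha> *\<^sub>R v \<in> convex_cone hull S')"
  proof
    assume ?l
    have vS': "v \<notin> S'" using vT B(1) S'B by blast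
    from \<open>?l\<close> obtain c where c: "\<forall>b\<in>insert v S'. 0 \<le> c b"
      and x: "x = (\<Sum>b\<in>insert v S'. c b *\<^sub>R b)"
      using convex_cone_hull_finite[of "insert v S'"] fS' by auto
    have "x - c v *\<^sub>R v = (\<Sum>b\<in>S'. c b *\<^sub>R b)" using x vS' fS' by simp
    also have "\<dots> \<in> convex_cone hull S'"
      using c by (intro convex_cone_sum convex_cone_convex_cone_hull convex_cone_hull_mul hull_inc) auto
    finally show "\<exists>\<alpha>\<ge>0. x - \<alpha> *\<^sub>R v \<in> convex_cone hull S'" using c by blast
  next
    assume "\<exists>\<alpha>\<ge>0. x - \<alpha> *\<^sub>R v \<in> convex_cone hull S'"
    then obtain \<alpha> where \<alpha>: "\<alpha> \<ge> 0" "x - \<alpha> *\<^sub>R v \<in> convex_cone hull S'" by blast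
    have "x - \<alpha> *\<^sub>R v \<in> convex_cone hull insert v S'"
      using \<alpha>(2) hull_mono[of S' "insert v S'" convex_cone] by blast
    then have "\<alpha> *\<^sub>R v + (x - \<alpha> *\<^sub>R v) \<in> convex_cone hull insert v S'"
      using \<alpha>(1) by (intro convex_cone_hull_add convex_cone_hull_mul) (simp_all add: hull_inc)
    then show ?l by simp
  qed
  also have "\<dots> \<longleftrightarrow> ?r"
  proof
    assume "\<exists>\<alpha>\<ge>0. x - \<alpha> *\<^sub>R v \<in> convex_cone hull S'"
    then obtain \<alpha> where \<alpha>: "\<alpha> \<ge> 0" "x - \<alpha> *\<^sub>R v \<in> convex_cone hull S'" by blast
    have y: "x - \<alpha> *\<^sub>R v \<in> span B" "\<And>c. 0 \<le> representation B (x - \<alpha> *\<^sub>R v) c"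
      "\<And>c. c \<notin> S' \<Longrightarrow> representation B (x - \<alpha> *\<^sub>R v) c = 0"
      using \<alpha>(2) by (auto simp: in_cone_iff[OF iB S'B])
    have "representation B (\<alpha> *\<^sub>R v + (x - \<alpha> *\<^sub>R v)) c = \<alpha> * r c + representation B (x - \<alpha> *\<^sub>R v) c" for c
      using y(1) vs rv by (simp only: representation_add[OF iB] representation_scale[OF iB] span_scale)
    then have rx: "representation B x c = \<alpha> * r c + representation B (x - \<alpha> *\<^sub>R v) c" for c by simp
    have al: "representation B x b / r b = \<alpha>" using rx[of b] y(3)[OF bS'] rb by simp
    have "\<alpha> *\<^sub>R v + (x - \<alpha> *\<^sub>R v) \<in> convex_cone hull B"
      using \<alpha> vB hull_mono[OF S'B, of convex_cone]
      by (intro convex_cone_hull_add convex_cone_hull_mul) auto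
    then show ?r unfolding al using rx y by simp
  next
    assume r: ?r
    define \<alpha> where "\<alpha> = representation B x b / r b"
    have xB: "x \<in> span B" and x0: "0 \<le> representation B x b"
      using r by (auto simp: in_cone_iff[OF iB order_refl])
    have a0: "\<alpha> \<ge> 0" using x0 rb by (simp add: \<alpha>_def)
    have rx: "representation B (x - \<alpha> *\<^sub>R v) c = representation B x c - \<alpha> * r c" for c
      using xB vs rv by (simp add: representation_diff[OF iB] representation_scale[OF iB] span_scale)
    have "x - \<alpha> *\<^sub>R v \<in> convex_cone hull S'"
      unfolding in_cone_iff[OF iB S'B] rx
      using r xB vs by (auto simp: \<alpha>_def[symmetric] span_diff span_scale)
    then show "\<exists>\<alpha>\<ge>0. x - \<alpha> *\<^sub>R v \<in> convex_cone hull S'" using a0 by blast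
  qed
  finally show ?thesis .
qed

lemma cone_star_union:
  assumes B: "B \<in> T" "S \<subseteq> B"
  shows "convex_cone hull B = (\<Union>b\<in>S. convex_cone hull insert v (B - {b}))"
proof
  note iB = cone_complexD(1)[OF T B(1)]
  show "(\<Union>b\<in>S. convex_cone hull insert v (B - {b})) \<subseteq> convex_cone hull B"
    using in_insert_cone_iff[OF B _ order_refl] by blast
  show "convex_cone hull B \<subseteq> (\<Union>b\<in>S. convex_cone hull insert v (B - {b}))"
  proof
    fix x assume x: "x \<in> convex_cone hull B"
    \<comment> \<open>Subtract from \<open>x\<close> the largest multiple of \<open>v\<close> that
      keeps all coordinates nonnegative; \<open>b\<close> is a coordinate that reaches 0.\<close>
    obtain b where b: "b \<in> S" "\<And>c. c \<in> S \<Longrightarrow> representation B x b / r b \<le> representation B x c / r c"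
      using ex_is_arg_min_if_finite[OF finite_S S_nonempty, of "\<lambda>c. representation B x c / r c"]
      by (auto simp: is_arg_min_linorder)
    have "representation B x b / r b * r c \<le> representation B x c" for c
    proof (cases "c \<in> S")
      case True
      then show ?thesis using b(2)[OF True] r_pos[OF True] by (simp add: pos_le_divide_eq)
    next
      case False
      then show ?thesis using x r_zero_iff[of c] by (simp add: in_cone_iff[OF iB order_refl])
    qed
    moreover have "representation B x c = representation B x b / r b * r c" if "c \<notin> B - {b}" for c
    proof (cases "c = b")
      case False
      then have "c \<notin> B" using that by blast
      then have "representation B x c = 0" "r c = 0"
        using r_zero_iff[of c] B(2) representation_ne_zero[of B x c] by auto
      then show ?thesis by simp
    qed (use r_pos[OF b(1)] in simp)
    ultimately have "x \<in> convex_cone hull insert v (B - {b})"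
      using in_insert_cone_iff[OF B b(1) order_refl] x by blast
    then show "x \<in> (\<Union>b\<in>S. convex_cone hull insert v (B - {b}))" using b(1) by blast
  qed
qed

lemma support_star: "support (star_complex S v T) = support T"
proof -
  have "support (star_complex S v T) =
      (\<Union>B\<in>{B\<in>T. \<not> S \<subseteq> B}. convex_cone hull B) \<union>
      (\<Union>B\<in>{B\<in>T. S \<subseteq> B}. \<Union>b\<in>S. convex_cone hull insert v (B - {b}))"
    by (auto simp: support_def star_complex_def)
  also have "(\<Union>B\<in>{B\<in>T. S \<subseteq> B}. \<Union>b\<in>S. convex_cone hull insert v (B - {b})) =
      (\<Union>B\<in>{B\<in>T. S \<subseteq> B}. convex_cone hull B)"
    using cone_star_union by auto
  finally show ?thesis by (auto simp: support_def)
qed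

text \<open>An element \<open>d\<close> of \<open>S\<close> outside \<open>B'\<close> has coordinate
  0 at a common point. The coefficient of \<open>v\<close> times \<open>r d\<close> is at most that
  coordinate, so \<open>v\<close> does not occur and the point lies in an old common face.\<close>

lemma insert_cone_Int_old:
  assumes B: "B \<in> T" "S \<subseteq> B" and b: "b \<in> S" and B': "B' \<in> T" "\<not> S \<subseteq> B'"
  shows "convex_cone hull insert v (B - {b}) \<inter> convex_cone hull B'
    \<subseteq> convex_cone hull (insert v (B - {b}) \<inter> B')"
proof
  note iB = cone_complexD(1)[OF T B(1)]
  fix x assume x: "x \<in> convex_cone hull insert v (B - {b}) \<inter> convex_cone hull B'"
  have xB: "x \<in> convex_cone hull B" and xr: "\<And>c. representation B x b / r b * r c \<le> representation B x c"
    using x in_insert_cone_iff[OF B b order_refl, of x] by blast+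
  have supp: "representation B x c = 0" if "c \<notin> B'" for c
    using complex_carrier[OF T B(1) B'(1) order_refl xB] x that by blast
  obtain d where d: "d \<in> S" "d \<notin> B'" using B'(2) by blast
  have "representation B x b / r b * r d \<le> 0" using xr[of d] supp[OF d(2)] by simp
  then have "\<not> 0 < representation B x b" using r_pos[OF d(1)] r_pos[OF b]
    by (metis divide_pos_pos mult_pos_pos not_le)
  moreover have "0 \<le> representation B x b" using xB by (simp add: in_cone_iff[OF iB order_refl])
  ultimately have xb: "representation B x b = 0" by linarith
  have sub: "(B - {b}) \<inter> B' \<subseteq> B" by blast
  have "x \<in> convex_cone hull ((B - {b}) \<inter> B')"
    using xB xb supp unfolding in_cone_iff[OF iB sub] in_cone_iff[OF iB order_refl] by auto
  then show "x \<in> convex_cone hull (insert v (B - {b}) \<inter> B')"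
    using hull_mono[of "(B - {b}) \<inter> B'" "insert v (B - {b}) \<inter> B'" convex_cone] by blast
qed

text \<open>On both sides the coefficient of \<open>v\<close> is the minimum of the same quotients,
  so the two coefficients agree and what remains lies in both old cones.\<close>

lemma insert_cone_Int_insert:
  assumes B: "B \<in> T" "S \<subseteq> B" and b: "b \<in> S" and B': "B' \<in> T" "S \<subseteq> B'" and b': "b' \<in> S"
  shows "convex_cone hull insert v (B - {b}) \<inter> convex_cone hull insert v (B' - {b'})
    \<subseteq> convex_cone hull (insert v (B - {b}) \<inter> insert v (B' - {b'}))"
proof
  note iB = cone_complexD(1)[OF T B(1)]
  fix x assume x: "x \<in> convex_cone hull insert v (B - {b}) \<inter> convex_cone hull insert v (B' - {b'})"
  let ?r = "representation B x"
  have xB: "x \<in> convex_cone hull B" "x \<in> convex_cone hull B'"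
    and xr: "\<And>c. ?r b / r b * r c \<le> ?r c"
    using x in_insert_cone_iff[OF B b order_refl, of x] in_insert_cone_iff[OF B' b' order_refl, of x]
    by blast+
  have same: "representation B' x = ?r"
    using representation_complex[OF T B'(1) B(1) xB(2,1)] .
  have xr': "\<And>c. ?r b' / r b' * r c \<le> ?r c"
    using x in_insert_cone_iff[OF B' b' order_refl, of x] unfolding same by blast
  have eq: "?r b / r b = ?r b' / r b'"
  proof (rule antisym)
    show "?r b / r b \<le> ?r b' / r b'" using xr[of b'] r_pos[OF b'] by (simp add: pos_le_divide_eq)
    show "?r b' / r b' \<le> ?r b / r b" using xr'[of b] r_pos[OF b] by (simp add: pos_le_divide_eq)
  qed
  have supp: "?r c = 0" if "c \<notin> B \<inter> B'" for c
    using complex_carrier[OF T B(1) B'(1) order_refl xB] representation_ne_zero[of B x c] that by blast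
  let ?S' = "B \<inter> B' - {b, b'}"
  have off: "?r c = ?r b / r b * r c" if c: "c \<notin> ?S'" for c
  proof -
    consider "c = b" | "c = b'" | "c \<notin> B \<inter> B'" using c by blast
    then show ?thesis
    proof cases
      case 1
      then show ?thesis using r_pos[OF b] by simp
    next
      case 2
      then show ?thesis unfolding eq using r_pos[OF b'] by simp
    next
      case 3
      then have "r c = 0" using r_zero_iff[of c] B(2) B'(2) by blast
      then show ?thesis using supp[OF 3] by simp
    qed
  qed
  have sub: "?S' \<subseteq> B - {b}" by blast
  have "x \<in> convex_cone hull insert v ?S'"
    unfolding in_insert_cone_iff[OF B b sub] using xB(1) xr off by blast
  then show "x \<in> convex_cone hull (insert v (B - {b}) \<inter> insert v (B' - {b'}))"
    using hull_mono[of "insert v ?S'" "insert v (B - {b}) \<inter> insert v (B' - {b'})" convex_cone] by blast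
qed

lemma cone_complex_star: "cone_complex (star_complex S v T)"
  unfolding cone_complex_def
proof (intro conjI ballI)
  have fT: "finite T" using T by (simp add: cone_complex_def)
  have "{insert v (B - {b}) | B b. B \<in> T \<and> S \<subseteq> B \<and> b \<in> S} \<subseteq> (\<lambda>(B, b). insert v (B - {b})) ` (T \<times> S)"
    by auto
  then show "finite (star_complex S v T)"
    unfolding star_complex_def using fT finite_S finite_subset by fastforce
  show "independent B" if "B \<in> star_complex S v T" for B
    using that cone_complexD(1)[OF T] independent_insert_v by (auto simp: star_complex_def)
  fix N N' assume N: "N \<in> star_complex S v T" "N' \<in> star_complex S v T"
  consider "N \<in> T" "\<not> S \<subseteq> N" | B b where "N = insert v (B - {b})" "B \<in> T" "S \<subseteq> B" "b \<in> S"
    using N(1) by (auto simp: star_complex_def)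
  then show "convex_cone hull N \<inter> convex_cone hull N' \<subseteq> convex_cone hull (N \<inter> N')"
  proof cases
    case 1
    consider "N' \<in> T" | B' b' where "N' = insert v (B' - {b'})" "B' \<in> T" "S \<subseteq> B'" "b' \<in> S"
      using N(2) by (auto simp: star_complex_def)
    then show ?thesis
    proof cases
      case n: 1
      then show ?thesis using T 1 by (simp add: cone_complex_def)
    next
      case n: 2
      show ?thesis using insert_cone_Int_old[OF n(2-4) 1] n(1) by (simp add: Int_commute)
    qed
  next
    case o: 2
    consider "N' \<in> T" "\<not> S \<subseteq> N'" | B' b' where "N' = insert v (B' - {b'})" "B' \<in> T" "S \<subseteq> B'" "b' \<in> S"
      using N(2) by (auto simp: star_complex_def)
    then show ?thesis
    proof cases
      case n: 1
      show ?thesis using insert_cone_Int_old[OF o(2-4) n] o(1) by simp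
    next
      case n: 2
      show ?thesis using insert_cone_Int_insert[OF o(2-4) n(2-4)] o(1) n(1) by simp
    qed
  qed
qed

end

lemma convex_cone_hull_insert_plus:
  fixes v :: "'a::real_vector"
  shows "convex_cone hull {v} + convex_cone hull S = convex_cone hull insert v S"
  using convex_cone_hull_Un[of "{v}" S] by (auto simp: set_plus_def)

lemma ray_subset_iff:
  fixes v :: "real^3"
  assumes "convex_cone K"
  shows "ray v \<subseteq> K \<longleftrightarrow> v \<in> K"
  unfolding ray_def using hull_minimal[of "{v}" K convex_cone] assms hull_inc[of v "{v}" convex_cone]
  by auto

text \<open>Turns the definition, which speaks of faces of all dimensions, into an exchange of
  generators in the members of the complex. A face spanned by \<open>S'\<close> that does not
  include all of \<open>S\<close> survives inside a piece that omits some
  \<open>b \<in> S - S'\<close>.\<close>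

lemma star_subdivision_cone_fan:
  fixes T :: "(real^3) set set"
  assumes "star_center T v B0 (representation B0 v) S"
  shows "star_subdivision (ray v) (cone_fan T) = cone_fan (star_complex S v T)"
proof -
  interpret star_center T v B0 "representation B0 v" S by fact
  have sub: "ray v \<subseteq> convex_cone hull S' \<longleftrightarrow> S \<subseteq> S'" if "B \<in> T" "S' \<subseteq> B" for B S'
    by (simp add: ray_subset_iff convex_cone_convex_cone_hull v_in_cone_iff[OF that])
  show ?thesis
  proof (intro equalityI subsetI)
    fix \<tau> assume "\<tau> \<in> star_subdivision (ray v) (cone_fan T)"
    then consider (old) "\<tau> \<in> cone_fan T" "\<not> ray v \<subseteq> \<tau>"
      | (new) \<sigma> \<tau>' where "\<tau> = ray v + \<tau>'" "\<sigma> \<in> cone_fan T" "ray v \<subseteq> \<sigma>" "cone_face \<tau>' \<sigma>" "\<not> ray v \<subseteq> \<tau>'"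
      by (auto simp: star_subdivision_def)
    then show "\<tau> \<in> cone_fan (star_complex S v T)"
    proof cases
      case old
      then obtain S' B where S': "B \<in> T" "S' \<subseteq> B" "\<tau> = convex_cone hull S'" by (auto simp: cone_fan_def)
      then have n: "\<not> S \<subseteq> S'" using old sub by blast
      show ?thesis
      proof (cases "S \<subseteq> B")
        case False
        then have "B \<in> star_complex S v T" using S' by (simp add: star_complex_def)
        then show ?thesis using S' unfolding cone_fan_def by blast
      next
        case True
        obtain b where b: "b \<in> S" "b \<notin> S'" using n by blast
        then have "insert v (B - {b}) \<in> star_complex S v T" "S' \<subseteq> insert v (B - {b})"
          using S' True unfolding star_complex_def by blast+
        then show ?thesis using S' unfolding cone_fan_def by blast
      qed
    next
      case new
      then obtain S1 B where S1: "B \<in> T" "S1 \<subseteq> B" "\<sigma> = convex_cone hull S1" by (auto simp: cone_fan_def)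
      have "independent S1" using cone_complexD(1)[OF T S1(1)] S1(2) independent_mono by blast
      then obtain S' where S': "S' \<subseteq> S1" "\<tau>' = convex_cone hull S'"
        using new(4) S1(3) cone_face_iff by blast
      have "S' \<subseteq> B" using S' S1 by blast
      then have n: "\<not> S \<subseteq> S'" and y: "S \<subseteq> B" using new sub S1 S' by blast+
      obtain b where b: "b \<in> S" "b \<notin> S'" using n by blast
      have "insert v (B - {b}) \<in> star_complex S v T" "insert v S' \<subseteq> insert v (B - {b})"
        using S1 b y \<open>S' \<subseteq> B\<close> unfolding star_complex_def by blast+
      moreover have "\<tau> = convex_cone hull insert v S'"
        using new(1) S'(2) convex_cone_hull_insert_plus[of v S'] by (simp add: ray_def)
      ultimately show ?thesis unfolding cone_fan_def by blast
    qed
  next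
    fix \<tau> assume "\<tau> \<in> cone_fan (star_complex S v T)"
    then obtain S' N where S': "N \<in> star_complex S v T" "S' \<subseteq> N" "\<tau> = convex_cone hull S'"
      by (auto simp: cone_fan_def)
    have old: "\<tau> \<in> star_subdivision (ray v) (cone_fan T)" if "B \<in> T" "S' \<subseteq> B" "\<not> S \<subseteq> S'" for B
    proof -
      have "\<tau> \<in> cone_fan T" using that S'(3) by (auto simp: cone_fan_def)
      then show ?thesis using sub[OF that(1,2)] that(3) S'(3) by (simp add: star_subdivision_def)
    qed
    consider "N \<in> T" "\<not> S \<subseteq> N" | B b where "N = insert v (B - {b})" "B \<in> T" "S \<subseteq> B" "b \<in> S"
      using S'(1) by (auto simp: star_complex_def)
    then show "\<tau> \<in> star_subdivision (ray v) (cone_fan T)"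
    proof cases
      case 1
      then show ?thesis using old S'(2) by blast
    next
      case 2
      show ?thesis
      proof (cases "v \<in> S'")
        case False
        then have "S' \<subseteq> B" "\<not> S \<subseteq> S'" using 2 S'(2) by blast+
        then show ?thesis using old 2(2) by blast
      next
        case True
        define S1 where "S1 = S' - {v}"
        have S1: "S1 \<subseteq> B" "\<not> S \<subseteq> S1" "insert v S1 = S'" using 2 S'(2) True by (auto simp: S1_def)
        have "\<tau> = ray v + convex_cone hull S1"
          using S'(3) S1(3) convex_cone_hull_insert_plus[of v S1] by (simp add: ray_def)
        moreover have "convex_cone hull B \<in> cone_fan T" using 2(2) by (auto simp: cone_fan_def)
        moreover have "ray v \<subseteq> convex_cone hull B" using sub[OF 2(2) order_refl] 2(3) by simp
        moreover have "cone_face (convex_cone hull S1) (convex_cone hull B)"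
          using cone_face_hull_subset[OF cone_complexD(1)[OF T 2(2)] S1(1)] .
        moreover have "\<not> ray v \<subseteq> convex_cone hull S1" using sub[OF 2(2) S1(1)] S1(2) by simp
        ultimately show ?thesis unfolding star_subdivision_def by blast
      qed
    qed
  qed
qed

section \<open>Lattice bases and regular subdivisions\<close>

lemma lattice_add: "x \<in> lattice \<Longrightarrow> y \<in> lattice \<Longrightarrow> x + y \<in> lattice"
  by (simp add: lattice_def)

lemma lattice_basis_independent: "lattice_basis B \<Longrightarrow> independent B"
  by (simp add: lattice_basis_def)

lemma lattice_basis_representation_Ints:
  assumes B: "lattice_basis B" and x: "x \<in> lattice"
  shows "representation B x b \<in> \<int>"
proof (cases "b \<in> B")
  case True
  obtain c :: "real^3 \<Rightarrow> int" where "x = (\<Sum>b\<in>B. of_int (c b) *\<^sub>R b)"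
    using B x by (auto simp: lattice_basis_def)
  then show ?thesis using representation_combination[OF lattice_basis_independent[OF B] True] by simp
next
  case False
  then show ?thesis using representation_ne_zero[of B x b] by force
qed

lemma lattice_basis_primitive:
  assumes B: "lattice_basis B" and b: "b \<in> B"
  shows "primitive b"
  unfolding primitive_def
proof (intro conjI allI impI notI)
  note iB = lattice_basis_independent[OF B]
  show "b \<in> lattice" using B b by (auto simp: lattice_basis_def)
  show "b = 0 \<Longrightarrow> False" using iB b dependent_zero by blast
  fix t :: real assume t: "0 < t \<and> t < 1" and "t *\<^sub>R b \<in> lattice"
  then have "representation B (t *\<^sub>R b) b \<in> \<int>" using lattice_basis_representation_Ints[OF B] by blast
  then have "t \<in> \<int>"
    using b by (simp add: representation_scale[OF iB span_base] representation_basis[OF iB])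
  then show False using t by (auto elim: Ints_cases)
qed

lemma primitive_parallel_eq:
  assumes "primitive u" "primitive v" "u = c *\<^sub>R v" "0 \<le> c"
  shows "u = v"
proof -
  have "c \<noteq> 0" using assms by (auto simp: primitive_def)
  then have c: "0 < c" using assms(4) by simp
  have "\<not> c < 1" using assms c by (auto simp: primitive_def)
  moreover have "\<not> 1 < c"
  proof
    assume "1 < c"
    then have "0 < 1 / c \<and> 1 / c < 1" by simp
    moreover have "(1 / c) *\<^sub>R u = v" using assms(3) c by simp
    ultimately show False using assms(1,2) by (metis primitive_def)
  qed
  ultimately show ?thesis using assms(3) by simp
qed

lemma mem_ray_iff: "x \<in> ray v \<longleftrightarrow> (\<exists>c\<ge>0. x = c *\<^sub>R v)"
  by (auto simp: ray_def convex_cone_hull_finite)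

lemma primitive_hull_eq_ray:
  assumes v: "primitive v" and S: "\<forall>s\<in>S. primitive s" and eq: "convex_cone hull S = ray v"
  shows "S = {v}"
proof -
  have "s = v" if "s \<in> S" for s
  proof -
    have "s \<in> ray v" using that eq hull_inc[of s S convex_cone] by simp
    then show ?thesis using primitive_parallel_eq[OF bspec[OF S that] v] by (auto simp: mem_ray_iff)
  qed
  moreover have "S \<noteq> {}"
  proof
    assume "S = {}"
    then have "ray v = {0}" using eq by simp
    moreover have "v \<in> ray v" by (simp add: ray_def hull_inc)
    ultimately show False using v by (simp add: primitive_def)
  qed
  ultimately show ?thesis by blast
qed

lemma primitive_generators_cone:
  assumes S: "independent S" "\<forall>s\<in>S. primitive s"
  shows "primitive_generators (convex_cone hull S) = S"
proof (intro equalityI subsetI)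
  fix v assume "v \<in> primitive_generators (convex_cone hull S)"
  then have v: "primitive v" "cone_face (ray v) (convex_cone hull S)"
    by (auto simp: primitive_generators_def)
  then obtain S' where S': "S' \<subseteq> S" "ray v = convex_cone hull S'"
    using cone_face_iff[OF S(1)] by blast
  then have "S' = {v}"
    using primitive_hull_eq_ray[OF v(1), of S'] S(2) by auto
  then show "v \<in> S" using S'(1) by simp
next
  fix v assume v: "v \<in> S"
  then show "v \<in> primitive_generators (convex_cone hull S)"
    using cone_face_hull_subset[OF S(1), of "{v}"] bspec[OF S(2) v]
    by (simp add: primitive_generators_def ray_def)
qed

lemma primitive_cone_eqD:
  assumes "independent S" "\<forall>s\<in>S. primitive s"
    and "independent S'" "\<forall>s\<in>S'. primitive s"
    and "convex_cone hull S = convex_cone hull S'"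
  shows "S = S'"
  using primitive_generators_cone[OF assms(1,2), unfolded assms(5)] primitive_generators_cone[OF assms(3,4)]
  by (rule trans[OF sym])

section \<open>Regular subdivisions as complexes of lattice bases\<close>

lemma regular_subdivision_cone_fan:
  assumes T: "cone_complex T" and B: "\<forall>B\<in>T. lattice_basis B"
  shows "regular_subdivision (support T) (cone_fan T)"
  unfolding regular_subdivision_def
proof (intro conjI allI impI)
  show "fan (cone_fan T)"
    using fan_cone_fan[OF T] B by (auto simp: lattice_basis_def)
  show "\<Union>(cone_fan T) = support T" by (rule Union_cone_fan)
  fix \<tau> assume m: "maximal_cone (cone_fan T) \<tau>"
  then obtain S B' where SB: "B' \<in> T" "S \<subseteq> B'" "\<tau> = convex_cone hull S"
    by (auto simp: maximal_cone_def cone_fan_def)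
  have "convex_cone hull B' \<in> cone_fan T" using SB(1) by (auto simp: cone_fan_def)
  moreover have "\<tau> \<subseteq> convex_cone hull B'" using SB hull_mono by blast
  ultimately have "\<tau> = convex_cone hull B'" using m by (auto simp: maximal_cone_def)
  then show "\<exists>B. lattice_basis B \<and> \<tau> = convex_cone hull B" using B SB(1) by blast
qed

definition basis_complex :: "(real^3) set set \<Rightarrow> (real^3) set set" where
  "basis_complex \<Sigma> = {B. lattice_basis B \<and> convex_cone hull B \<in> \<Sigma>}"

text \<open>Primitive generators are determined by their cone, so bases and cones correspond one to
  one. The intersection of two such cones is generated by a subset of either basis; both subsets
  span the same cone, hence agree and lie in \<open>B \<inter> B'\<close>.\<close>

lemma regular_subdivision_complex:
  assumes r: "regular_subdivision \<sigma> \<Sigma>"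
  shows "cone_complex (basis_complex \<Sigma>)" "support (basis_complex \<Sigma>) = \<sigma>"
    "cone_fan (basis_complex \<Sigma>) = \<Sigma>"
proof -
  let ?T = "basis_complex \<Sigma>"
  have fan: "fan \<Sigma>" and un: "\<Union>\<Sigma> = \<sigma>"
    and bas: "\<And>\<tau>. maximal_cone \<Sigma> \<tau> \<Longrightarrow> \<exists>B. lattice_basis B \<and> \<tau> = convex_cone hull B"
    using r by (auto simp: regular_subdivision_def)
  have fin: "finite \<Sigma>" using fan by (simp add: fan_def)
  have T: "independent B" "\<forall>b\<in>B. primitive b" "convex_cone hull B \<in> \<Sigma>" if "B \<in> ?T" for B
    using that lattice_basis_primitive lattice_basis_independent by (auto simp: basis_complex_def)
  have inj: "inj_on ((hull) convex_cone) ?T"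
  proof (rule inj_onI)
    fix B B' assume B: "B \<in> ?T" "B' \<in> ?T" and eq: "convex_cone hull B = convex_cone hull B'"
    show "B = B'"
      by (rule primitive_cone_eqD[OF T(1)[OF B(1)] T(2)[OF B(1)] T(1)[OF B(2)] T(2)[OF B(2)] eq])
  qed
  have max: "\<exists>B\<in>?T. \<tau> \<subseteq> convex_cone hull B" if "\<tau> \<in> \<Sigma>" for \<tau>
  proof -
    obtain m where m: "m \<in> \<Sigma>" "\<tau> \<subseteq> m" "\<forall>b\<in>\<Sigma>. m \<subseteq> b \<longrightarrow> m = b"
      using finite_has_maximal2[OF fin \<open>\<tau> \<in> \<Sigma>\<close>] by auto
    then have "maximal_cone \<Sigma> m" by (auto simp: maximal_cone_def)
    then obtain B where "lattice_basis B" "m = convex_cone hull B" using bas by blast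
    then show ?thesis using m by (auto simp: basis_complex_def)
  qed
  show "cone_complex ?T"
    unfolding cone_complex_def
  proof (intro conjI ballI)
    show "finite ?T"
      by (rule inj_on_finite[OF inj _ fin]) (use T(3) in blast)
    show "independent B" if "B \<in> ?T" for B using T that by blast
    fix B B' assume B: "B \<in> ?T" "B' \<in> ?T"
    have f: "cone_face (convex_cone hull B \<inter> convex_cone hull B') (convex_cone hull B)"
      "cone_face (convex_cone hull B \<inter> convex_cone hull B') (convex_cone hull B')"
      using fan T(3)[OF B(1)] T(3)[OF B(2)] by (auto simp: fan_def)
    obtain S where S: "S \<subseteq> B" "convex_cone hull B \<inter> convex_cone hull B' = convex_cone hull S"
      using f(1) cone_face_iff[OF T(1)[OF B(1)]] by blast
    obtain S' where S': "S' \<subseteq> B'" "convex_cone hull B \<inter> convex_cone hull B' = convex_cone hull S'"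
      using f(2) cone_face_iff[OF T(1)[OF B(2)]] by blast
    have "S = S'"
    proof (rule primitive_cone_eqD)
      show "independent S" "independent S'"
        using T(1)[OF B(1)] T(1)[OF B(2)] S(1) S'(1) independent_mono by blast+
      show "\<forall>s\<in>S. primitive s" using T(2)[OF B(1)] S(1) by blast
      show "\<forall>s\<in>S'. primitive s" using T(2)[OF B(2)] S'(1) by blast
      show "convex_cone hull S = convex_cone hull S'" using S(2) S'(2) by simp
    qed
    then have "S \<subseteq> B \<inter> B'" using S(1) S'(1) by blast
    then show "convex_cone hull B \<inter> convex_cone hull B' \<subseteq> convex_cone hull (B \<inter> B')"
      using S(2) hull_mono[of S "B \<inter> B'" convex_cone] by simp
  qed
  show "support ?T = \<sigma>"
  proof
    show "support ?T \<subseteq> \<sigma>" using T(3) un by (auto simp: support_def)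
    show "\<sigma> \<subseteq> support ?T"
    proof
      fix x assume "x \<in> \<sigma>"
      then obtain \<tau> where "\<tau> \<in> \<Sigma>" "x \<in> \<tau>" using un by blast
      then show "x \<in> support ?T" using max[of \<tau>] by (auto simp: support_def)
    qed
  qed
  show "cone_fan ?T = \<Sigma>"
  proof
    show "cone_fan ?T \<subseteq> \<Sigma>"
    proof
      fix \<tau> assume "\<tau> \<in> cone_fan ?T"
      then obtain S B where S: "B \<in> ?T" "S \<subseteq> B" "\<tau> = convex_cone hull S" by (auto simp: cone_fan_def)
      then have "cone_face \<tau> (convex_cone hull B)" using cone_face_hull_subset[OF T(1)[OF S(1)]] by blast
      then show "\<tau> \<in> \<Sigma>" using fan T(3)[OF S(1)] by (auto simp: fan_def)
    qed
    show "\<Sigma> \<subseteq> cone_fan ?T"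
    proof
      fix \<tau> assume t: "\<tau> \<in> \<Sigma>"
      then obtain B where B: "B \<in> ?T" "\<tau> \<subseteq> convex_cone hull B" using max by blast
      have "cone_face (\<tau> \<inter> convex_cone hull B) (convex_cone hull B)"
        using fan t T(3)[OF B(1)] by (auto simp: fan_def)
      then have "cone_face \<tau> (convex_cone hull B)" using B(2) by (simp add: Int_absorb2)
      then show "\<tau> \<in> cone_fan ?T"
        using cone_face_iff[OF T(1)[OF B(1)]] B(1) by (auto simp: cone_fan_def)
    qed
  qed
qed

text \<open>The invariant of an arbitrary chain of star subdivisions. It asks neither for a fan nor
  for simplicial cones, so it passes through each step whatever the intermediate result is.\<close>

definition generated_by :: "(real^3) set \<Rightarrow> (real^3) set set \<Rightarrow> bool" where
  "generated_by G \<Sigma> \<longleftrightarrow> (\<forall>\<sigma>\<in>\<Sigma>. \<exists>S\<subseteq>G. \<sigma> = convex_cone hull S)"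

lemma generated_by_star_subdivision:
  assumes G: "finite G" "v \<in> G" and g: "generated_by G \<Sigma>"
  shows "generated_by G (star_subdivision (ray v) \<Sigma>)"
  unfolding generated_by_def
proof
  fix \<tau> assume "\<tau> \<in> star_subdivision (ray v) \<Sigma>"
  then consider "\<tau> \<in> \<Sigma>" | \<sigma> \<tau>' where "\<tau> = ray v + \<tau>'" "\<sigma> \<in> \<Sigma>" "cone_face \<tau>' \<sigma>"
    by (auto simp: star_subdivision_def)
  then show "\<exists>S\<subseteq>G. \<tau> = convex_cone hull S"
  proof cases
    case 1
    then show ?thesis using g by (simp add: generated_by_def)
  next
    case 2
    obtain S where S: "S \<subseteq> G" "\<sigma> = convex_cone hull S" using 2(2) g by (auto simp: generated_by_def)
    have "finite S" using S(1) G(1) finite_subset by blast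
    then have "\<tau>' = convex_cone hull (S \<inter> \<tau>')" using cone_face_eq_hull 2(3) S(2) by blast
    then have "\<tau> = convex_cone hull insert v (S \<inter> \<tau>')"
      using 2(1) convex_cone_hull_insert_plus[of v "S \<inter> \<tau>'"] by (simp add: ray_def)
    moreover have "insert v (S \<inter> \<tau>') \<subseteq> G" using S(1) G(2) by blast
    ultimately show ?thesis by blast
  qed
qed

lemma generated_by_fold:
  assumes "finite G" "generated_by G \<Sigma>" "\<forall>\<rho>\<in>set \<rho>s. \<exists>v\<in>G. \<rho> = ray v"
  shows "generated_by G (fold star_subdivision \<rho>s \<Sigma>)"
  using assms(2,3)
  by (induction \<rho>s arbitrary: \<Sigma>) (auto intro: generated_by_star_subdivision[OF assms(1)])

text \<open>A basis vector spans an extremal ray, and an extremal ray of a cone generated by part of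
  \<open>G\<close> contains an element of \<open>G\<close>; primitivity turns equality of rays into
  equality of vectors.\<close>

lemma generated_by_basis_subset:
  assumes G: "finite G" "\<forall>g\<in>G. primitive g" and g: "generated_by G \<Sigma>"
    and B: "B \<in> basis_complex \<Sigma>"
  shows "B \<subseteq> G"
proof
  fix b assume b: "b \<in> B"
  have lB: "lattice_basis B" and cB: "convex_cone hull B \<in> \<Sigma>" using B by (auto simp: basis_complex_def)
  obtain S where S: "S \<subseteq> G" "convex_cone hull B = convex_cone hull S"
    using g cB by (auto simp: generated_by_def)
  have fS: "finite S" using S(1) G(1) finite_subset by blast
  have "cone_face (ray b) (convex_cone hull S)"
    using cone_face_hull_subset[OF lattice_basis_independent[OF lB], of "{b}"] b S(2) by (simp add: ray_def)
  then have eq: "ray b = convex_cone hull (S \<inter> ray b)" using cone_face_eq_hull[OF fS] by blast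
  have "S \<inter> ray b = {b}"
    using eq S(1) G(2) by (intro primitive_hull_eq_ray[OF lattice_basis_primitive[OF lB b]]) auto
  then show "b \<in> G" using S(1) by blast
qed

text \<open>The coordinates of \<open>y\<close> are nonnegative integers. As \<open>f y\<close> is
  positive, some generator with positive \<open>f\<close> occurs, with coordinate at least 1, and
  can be subtracted once. With \<open>f\<close> the height this will detect irreducible
  points.\<close>

lemma lattice_cone_peel:
  assumes B: "lattice_basis B" and y: "y \<in> lattice" "y \<in> convex_cone hull B"
    and f: "linear f" "0 < (f y :: real)"
  obtains b where "b \<in> B" "0 < f b" "y - b \<in> convex_cone hull B"
proof -
  note iB = lattice_basis_independent[OF B]
  have rep: "0 \<le> representation B y b" for b using y(2) in_cone_iff[OF iB order_refl, of y] by blast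
  have "\<exists>b\<in>B. 0 < representation B y b * f b"
  proof (rule ccontr)
    assume "\<not> ?thesis"
    then have "(\<Sum>b\<in>B. representation B y b *\<^sub>R f b) \<le> 0" by (intro sum_nonpos) (auto simp: not_less)
    then show False using sum_representation_cone[OF iB y(2) f(1)] f(2) by simp
  qed
  then obtain b where b: "b \<in> B" "0 < representation B y b * f b" by blast
  then have pos: "0 < representation B y b" "0 < f b" using rep[of b] by (auto simp: zero_less_mult_iff)
  obtain n :: int where n: "representation B y b = of_int n"
    using lattice_basis_representation_Ints[OF B y(1), of b] by (auto elim: Ints_cases)
  have one: "1 \<le> representation B y b" using pos(1) n by simp
  have ys: "y \<in> span B" using y(2) convex_cone_hull_subset_span by blast
  have "representation B (y - b) c = representation B y c - (if c = b then 1 else 0)" for c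
    using ys b(1) by (simp add: representation_diff[OF iB] span_base representation_basis[OF iB])
  then have "y - b \<in> convex_cone hull B"
    using ys b(1) y(2) rep one by (auto simp: in_cone_iff[OF iB order_refl] intro: span_diff span_base)
  then show ?thesis using that b(1) pos(2) by blast
qed

lemma lattice_basis_card:
  assumes B: "lattice_basis B"
  shows "card B = 3"
proof -
  note iB = lattice_basis_independent[OF B]
  have "x \<in> span B" if "x \<in> lattice" for x
  proof -
    obtain c :: "real^3 \<Rightarrow> int" where "x = (\<Sum>b\<in>B. of_int (c b) *\<^sub>R b)"
      using B \<open>x \<in> lattice\<close> by (auto simp: lattice_basis_def)
    then show ?thesis by (auto intro: span_sum span_scale span_base)
  qed
  moreover have "(Basis :: (real^3) set) \<subseteq> lattice"
    by (auto simp: Basis_vec_def lattice_def axis_def)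
  ultimately have "Basis \<subseteq> span B" by blast
  then have "UNIV \<subseteq> span B" using span_mono[of Basis "span B"] by (simp add: span_Basis span_span)
  then have "span B = UNIV" by blast
  then have "dim (UNIV :: (real^3) set) = card B" using dim_eq_card[of B UNIV] iB by simp
  then show ?thesis by simp
qed

section \<open>Sheds of simplicial fans\<close>

lemma convex_hull_insert_0:
  fixes S :: "'a::real_vector set"
  assumes "finite S" "0 \<notin> S"
  shows "convex hull insert 0 S = {\<Sum>b\<in>S. c b *\<^sub>R b | c. (\<forall>b\<in>S. 0 \<le> c b) \<and> sum c S \<le> 1}" (is "_ = ?R")
proof (intro equalityI subsetI)
  fix x assume "x \<in> convex hull insert 0 S"
  then obtain u where u: "\<forall>x\<in>insert 0 S. 0 \<le> u x" "sum u (insert 0 S) = 1"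
    "x = (\<Sum>x\<in>insert 0 S. u x *\<^sub>R x)"
    using convex_hull_finite[of "insert 0 S"] assms(1) by auto
  then have "sum u S \<le> 1" "x = (\<Sum>x\<in>S. u x *\<^sub>R x)" using assms by auto
  then show "x \<in> ?R" using u(1) by blast
next
  fix x assume "x \<in> ?R"
  then obtain c where c: "\<forall>b\<in>S. 0 \<le> c b" "sum c S \<le> 1" "x = (\<Sum>b\<in>S. c b *\<^sub>R b)" by blast
  define u where "u = (\<lambda>b. if b = 0 then 1 - sum c S else c b)"
  have s: "sum u S = sum c S" "(\<Sum>b\<in>S. u b *\<^sub>R b) = x"
    using assms(2) c(3) by (auto simp: u_def intro!: sum.cong)
  have "\<forall>x\<in>insert 0 S. 0 \<le> u x" using c by (simp add: u_def)
  moreover have "sum u (insert 0 S) = 1" using s(1) assms by (simp add: u_def)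
  moreover have "(\<Sum>x\<in>insert 0 S. u x *\<^sub>R x) = x" using s(2) assms by simp
  ultimately show "x \<in> convex hull insert 0 S"
    using convex_hull_finite[of "insert 0 S"] assms(1) by blast
qed

text \<open>The simplex on 0 and \<open>B\<close> is the shed of the cone when the generators are
  primitive (\<open>cone_shed_cone\<close>), so comparing sheds becomes comparing sums of
  coordinates.\<close>

lemma in_cone_shed_iff:
  fixes B :: "'a::euclidean_space set"
  assumes B: "independent B"
  shows "x \<in> convex hull insert 0 B \<longleftrightarrow> x \<in> convex_cone hull B \<and> (\<Sum>b\<in>B. representation B x b) \<le> 1"
proof -
  have fB: "finite B" and z: "0 \<notin> B"
    using B independent_imp_finite dependent_zero by blast+
  note h = convex_hull_insert_0[OF fB z] convex_cone_hull_finite[OF fB]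
  show ?thesis
  proof
    assume "x \<in> convex hull insert 0 B"
    then obtain c where c: "x = (\<Sum>b\<in>B. c b *\<^sub>R b)" "\<forall>b\<in>B. 0 \<le> c b" "sum c B \<le> 1"
      unfolding h(1) by blast
    have "x \<in> convex_cone hull B" using c(1,2) unfolding h(2) by blast
    moreover have "(\<Sum>b\<in>B. representation B x b) = sum c B"
      unfolding c(1) using representation_combination[OF B] by (intro sum.cong) auto
    ultimately show "x \<in> convex_cone hull B \<and> (\<Sum>b\<in>B. representation B x b) \<le> 1" using c(3) by simp
  next
    assume a: "x \<in> convex_cone hull B \<and> (\<Sum>b\<in>B. representation B x b) \<le> 1"
    have "x = (\<Sum>b\<in>B. representation B x b *\<^sub>R b)"
      using sum_representation_cone[OF B conjunct1[OF a] linear_id] by simp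
    moreover have "\<forall>b\<in>B. 0 \<le> representation B x b"
      using a in_cone_iff[OF B order_refl, of x] by blast
    ultimately show "x \<in> convex hull insert 0 B" unfolding h(1) using a by blast
  qed
qed

text \<open>The sum of the coordinates is the value at \<open>x\<close> of the form equal to 1 on
  \<open>B\<close>. Together with \<open>weight_le\<close> this compares two cones containing
  \<open>x\<close>: a form at least 1 on one basis and at most 1 on the other separates the two
  sums.\<close>

lemma weight_ge:
  fixes B :: "'a::euclidean_space set"
  assumes B: "independent B" and x: "x \<in> convex_cone hull B" and f: "linear f" "\<And>b. b \<in> B \<Longrightarrow> 1 \<le> f b"
  shows "(\<Sum>b\<in>B. representation B x b) \<le> (f x :: real)"
  unfolding sum_representation_cone[OF B x f(1)]
proof (rule sum_mono)
  fix b assume b: "b \<in> B"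
  have "0 \<le> representation B x b" using x in_cone_iff[OF B order_refl, of x] by blast
  then show "representation B x b \<le> representation B x b *\<^sub>R f b"
    using mult_left_mono[OF f(2)[OF b]] by fastforce
qed

text \<open>The bound on \<open>f\<close> concerns just the generators that occur in
  \<open>x\<close>: some of the forms used for the sheds exceed 1 on other vertices of the
  cell.\<close>

lemma weight_le:
  fixes B :: "'a::euclidean_space set"
  assumes B: "independent B" and x: "x \<in> convex_cone hull B" and f: "linear f"
    "\<And>b. b \<in> B \<Longrightarrow> representation B x b \<noteq> 0 \<Longrightarrow> f b \<le> 1"
  shows "(f x :: real) \<le> (\<Sum>b\<in>B. representation B x b)"
  unfolding sum_representation_cone[OF B x f(1)]
proof (rule sum_mono)
  fix b assume b: "b \<in> B"
  have "0 \<le> representation B x b" using x in_cone_iff[OF B order_refl, of x] by blast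
  then show "representation B x b *\<^sub>R f b \<le> representation B x b"
    using f(2)[OF b] mult_left_mono[of "f b" 1 "representation B x b"]
    by (cases "representation B x b = 0") simp_all
qed

lemma cone_shed_cone:
  assumes S: "independent S" "\<forall>s\<in>S. primitive s"
  shows "cone_shed (convex_cone hull S) = convex hull insert 0 S"
proof -
  have fS: "finite S" using S(1) independent_imp_finite by blast
  have z: "0 \<notin> S" using S(1) dependent_zero by blast
  let ?l = "shed_form (convex_cone hull S)"
  have "\<exists>l::real^3 \<Rightarrow> real. linear l \<and> (\<forall>v\<in>S. l v = 1)"
    using linear_independent_extend[OF S(1), of "\<lambda>_. 1"] by blast
  then have "linear ?l \<and> (\<forall>v\<in>S. ?l v = 1)"
    unfolding shed_form_def primitive_generators_cone[OF S] by (rule someI_ex)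
  then have l: "linear ?l" "\<forall>v\<in>S. ?l v = 1" by blast+
  have lv: "?l (\<Sum>b\<in>S. c b *\<^sub>R b) = sum c S" for c
    using l by (simp add: linear_sum linear_scale)
  have "x \<in> cone_shed (convex_cone hull S) \<longleftrightarrow> x \<in> convex hull insert 0 S" for x
  proof -
    have "x \<in> convex_cone hull S \<longleftrightarrow> (\<exists>c. x = (\<Sum>b\<in>S. c b *\<^sub>R b) \<and> (\<forall>b\<in>S. 0 \<le> c b))"
      unfolding convex_cone_hull_finite[OF fS] by blast
    then have "x \<in> cone_shed (convex_cone hull S) \<longleftrightarrow>
        (\<exists>c. x = (\<Sum>b\<in>S. c b *\<^sub>R b) \<and> (\<forall>b\<in>S. 0 \<le> c b)) \<and> 0 \<le> ?l x \<and> ?l x \<le> 1"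
      by (simp only: cone_shed_def Int_iff vimage_eq atLeastAtMost_iff)
    also have "\<dots> \<longleftrightarrow> (\<exists>c. x = (\<Sum>b\<in>S. c b *\<^sub>R b) \<and> (\<forall>b\<in>S. 0 \<le> c b) \<and> sum c S \<le> 1)"
    proof
      assume "(\<exists>c. x = (\<Sum>b\<in>S. c b *\<^sub>R b) \<and> (\<forall>b\<in>S. 0 \<le> c b)) \<and> 0 \<le> ?l x \<and> ?l x \<le> 1"
      then obtain c where c: "x = (\<Sum>b\<in>S. c b *\<^sub>R b)" "\<forall>b\<in>S. 0 \<le> c b" "?l x \<le> 1" by blast
      have "sum c S \<le> 1" using c(3) unfolding c(1) lv .
      then show "\<exists>c. x = (\<Sum>b\<in>S. c b *\<^sub>R b) \<and> (\<forall>b\<in>S. 0 \<le> c b) \<and> sum c S \<le> 1"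
        using c(1,2) by blast
    next
      assume "\<exists>c. x = (\<Sum>b\<in>S. c b *\<^sub>R b) \<and> (\<forall>b\<in>S. 0 \<le> c b) \<and> sum c S \<le> 1"
      then obtain c where c: "x = (\<Sum>b\<in>S. c b *\<^sub>R b)" "\<forall>b\<in>S. 0 \<le> c b" "sum c S \<le> 1" by blast
      have "?l x = sum c S" unfolding c(1) lv ..
      moreover have "0 \<le> sum c S" using c(2) by (simp add: sum_nonneg)
      ultimately show "(\<exists>c. x = (\<Sum>b\<in>S. c b *\<^sub>R b) \<and> (\<forall>b\<in>S. 0 \<le> c b)) \<and> 0 \<le> ?l x \<and> ?l x \<le> 1"
        using c by auto
    qed
    finally show ?thesis using convex_hull_insert_0[OF fS z] by simp
  qed
  then show ?thesis by blast
qed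

lemma shed_cone_fan:
  assumes T: "cone_complex T" and p: "\<forall>B\<in>T. \<forall>b\<in>B. primitive b"
  shows "shed (cone_fan T) = (\<Union>B\<in>T. convex hull insert 0 B)"
proof (intro equalityI subsetI)
  have eq: "cone_shed (convex_cone hull S) = convex hull insert 0 S" if "B \<in> T" "S \<subseteq> B" for S B
    using p that by (intro cone_shed_cone independent_mono[OF cone_complexD(1)[OF T that(1)] that(2)]) blast
  fix x
  show "x \<in> (\<Union>B\<in>T. convex hull insert 0 B)" if "x \<in> shed (cone_fan T)"
  proof -
    obtain S B where S: "B \<in> T" "S \<subseteq> B" "x \<in> cone_shed (convex_cone hull S)"
      using \<open>x \<in> shed (cone_fan T)\<close> by (auto simp: shed_def cone_fan_def)
    then have "x \<in> convex hull insert 0 S" using eq by blast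
    then show ?thesis using S hull_mono[of "insert 0 S" "insert 0 B" convex] by blast
  qed
  show "x \<in> shed (cone_fan T)" if "x \<in> (\<Union>B\<in>T. convex hull insert 0 B)"
  proof -
    obtain B where B: "B \<in> T" "x \<in> convex hull insert 0 B"
      using \<open>x \<in> (\<Union>B\<in>T. convex hull insert 0 B)\<close> by blast
    then have "convex_cone hull B \<in> cone_fan T" "x \<in> cone_shed (convex_cone hull B)"
      using eq by (auto simp: cone_fan_def)
    then show ?thesis by (auto simp: shed_def)
  qed
qed

lemma compact_shed_cone_fan:
  assumes T: "cone_complex T" and p: "\<forall>B\<in>T. \<forall>b\<in>B. primitive b"
  shows "compact (shed (cone_fan T))"
  unfolding shed_cone_fan[OF assms]
proof (rule compact_UN)
  show "finite T" using T by (simp add: cone_complex_def)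
  show "compact (convex hull insert 0 B)" if "B \<in> T" for B
    using cone_complexD(2)[OF T that] by (simp add: finite_imp_compact_convex_hull)
qed

text \<open>Sheds are compact, hence measurable of finite volume, so inclusion of sheds is
  enough.\<close>

lemma minimal_subdivision_cone_fan:
  assumes T: "cone_complex T" and B: "\<forall>B\<in>T. lattice_basis B"
    and sub: "\<And>\<Sigma>. regular_subdivision (support T) \<Sigma> \<Longrightarrow> shed (cone_fan T) \<subseteq> shed \<Sigma>"
  shows "minimal_subdivision (support T) (cone_fan T)"
  unfolding minimal_subdivision_def
proof (intro conjI allI impI)
  show "regular_subdivision (support T) (cone_fan T)" using regular_subdivision_cone_fan[OF T B] .
  fix \<Sigma> assume r: "regular_subdivision (support T) \<Sigma>"
  have "compact (shed (cone_fan T))"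
    by (rule compact_shed_cone_fan[OF T]) (use B lattice_basis_primitive in blast)
  moreover have "compact (shed \<Sigma>)"
    using compact_shed_cone_fan[OF regular_subdivision_complex(1)[OF r]] lattice_basis_primitive
    unfolding regular_subdivision_complex(3)[OF r] by (auto simp: basis_complex_def)
  ultimately show "measure lebesgue (shed (cone_fan T)) \<le> measure lebesgue (shed \<Sigma>)"
    using sub[OF r] by (intro measure_mono_fmeasurable fmeasurableD lmeasurable_compact)
qed

section \<open>Unimodular triples\<close>

lemma vec3_eq_iff: "(x :: real^3) = y \<longleftrightarrow> x $ 1 = y $ 1 \<and> x $ 2 = y $ 2 \<and> x $ 3 = y $ 3"
  by (simp add: vec_eq_iff forall_3)

definition det3 :: "real^3 \<Rightarrow> real^3 \<Rightarrow> real^3 \<Rightarrow> real" where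
  "det3 a b c = a$1 * (b$2 * c$3 - b$3 * c$2) - a$2 * (b$1 * c$3 - b$3 * c$1)
     + a$3 * (b$1 * c$2 - b$2 * c$1)"

lemma cramer3: "det3 a b c *\<^sub>R x = det3 x b c *\<^sub>R a + det3 a x c *\<^sub>R b + det3 a b x *\<^sub>R c"
  by (simp add: vec3_eq_iff det3_def algebra_simps)

lemma det3_distinct:
  assumes "det3 a b c \<noteq> 0"
  shows "a \<noteq> b" "b \<noteq> c" "a \<noteq> c"
  using assms by (auto simp: det3_def algebra_simps)

lemma det3_independent:
  assumes "det3 a b c \<noteq> 0"
  shows "independent {a, b, c}"
proof
  assume "dependent {a, b, c}"
  then obtain u where u: "\<exists>v\<in>{a, b, c}. u v \<noteq> 0" "(\<Sum>v\<in>{a, b, c}. u v *\<^sub>R v) = 0"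
    using dependent_finite[of "{a, b, c}"] by auto
  have 0: "u a *\<^sub>R a + u b *\<^sub>R b + u c *\<^sub>R c = 0"
    using u(2) det3_distinct[OF assms] by (simp add: add.assoc)
  have "det3 (u a *\<^sub>R a + u b *\<^sub>R b + u c *\<^sub>R c) b c = u a * det3 a b c"
    "det3 a (u a *\<^sub>R a + u b *\<^sub>R b + u c *\<^sub>R c) c = u b * det3 a b c"
    "det3 a b (u a *\<^sub>R a + u b *\<^sub>R b + u c *\<^sub>R c) = u c * det3 a b c"
    by (simp_all add: det3_def algebra_simps)
  moreover have "det3 0 b c = 0" "det3 a 0 c = 0" "det3 a b 0 = 0" by (simp_all add: det3_def)
  ultimately have "u a = 0" "u b = 0" "u c = 0" using assms unfolding 0 by simp_all
  then show False using u(1) by simp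
qed

lemma det3_Ints:
  "a \<in> lattice \<Longrightarrow> b \<in> lattice \<Longrightarrow> c \<in> lattice \<Longrightarrow> det3 a b c \<in> \<int>"
  unfolding det3_def lattice_def by (intro Ints_add Ints_diff Ints_mult) auto

text \<open>A determinant of absolute value 1 is its own inverse, so multiplying
  \<open>cramer3\<close> by it gives integral coefficients.\<close>

lemma det3_lattice_basis:
  assumes lat: "a \<in> lattice" "b \<in> lattice" "c \<in> lattice" and d: "\<bar>det3 a b c\<bar> = 1"
  shows "lattice_basis {a, b, c}"
  unfolding lattice_basis_def
proof (intro conjI ballI)
  have d0: "det3 a b c \<noteq> 0" using d by auto
  show "{a, b, c} \<subseteq> lattice" using lat by simp
  show "independent {a, b, c}" by (rule det3_independent[OF d0])
  fix x assume x: "x \<in> lattice"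
  have sq: "det3 a b c * det3 a b c = 1" using d by (metis abs_mult_self_eq mult_1)
  define f where "f v = (if v = a then det3 a b c * det3 x b c else if v = b then det3 a b c * det3 a x c
    else det3 a b c * det3 a b x)" for v
  have "f v \<in> \<int>" for v
    using lat x by (auto simp: f_def intro!: Ints_mult det3_Ints)
  then have fl: "real_of_int \<lfloor>f v\<rfloor> = f v" for v by (metis Ints_cases floor_of_int)
  have "x = det3 a b c *\<^sub>R (det3 a b c *\<^sub>R x)" using sq by simp
  also have "\<dots> = f a *\<^sub>R a + f b *\<^sub>R b + f c *\<^sub>R c"
    unfolding cramer3[of a b c x] using det3_distinct[OF d0] by (simp add: f_def scaleR_add_right)
  also have "\<dots> = (\<Sum>v\<in>{a, b, c}. of_int \<lfloor>f v\<rfloor> *\<^sub>R v)"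
    using det3_distinct[OF d0] by (simp add: fl add.assoc)
  finally show "\<exists>c' :: real^3 \<Rightarrow> int. x = (\<Sum>v\<in>{a, b, c}. of_int (c' v) *\<^sub>R v)"
    by (intro exI[of _ "\<lambda>v. \<lfloor>f v\<rfloor>"])
qed

section \<open>The chain of lattice points of height one\<close>

locale chain =
  fixes q :: nat
  assumes q2: "2 \<le> q"
begin

abbreviation Q :: int where "Q \<equiv> int q"

definition N :: int where "N = Q\<^sup>2 + Q + 1"

text \<open>The facet inequality \<open>x + (Q^2 + 1) y >= 0\<close> at \<open>x = 1 + Q s\<close>
  bounds \<open>- y\<close> by \<open>(1 + Q s) / (Q^2 + 1)\<close>, and \<open>kap s\<close> is the
  largest such integer. At -1 the quotient would be -1; the value 0 makes \<open>W (-1)\<close>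
  equal to \<open>e\<^sub>3\<close>.\<close>

definition kap :: "int \<Rightarrow> int" where "kap s = (if s = -1 then 0 else (1 + Q * s) div (Q\<^sup>2 + 1))"

definition wx :: "int \<Rightarrow> int" where "wx s = (if s = -1 then 0 else 1 + Q * s)"

text \<open>For \<open>0 \<le> s\<close> this is the lowest lattice point of the cone over \<open>(1 + Q * s, - s)\<close>. In the
  paper's indexing, \<open>W (k * Q + l)\<close> is the vector with parameters \<open>k\<close>, \<open>l\<close>, so
  that \<open>W N\<close>, \<open>up\<close>, \<open>W (-1)\<close> are \<open>e\<^sub>1\<close>, \<open>e\<^sub>2\<close>, \<open>e\<^sub>3\<close>.\<close>

definition W :: "int \<Rightarrow> real^3" where
  "W s = vector [of_int (wx s), - of_int (kap s), - of_int s]"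

definition up :: "real^3" where "up = vector [0, 1, 0]"

text \<open>The 2 by 2 determinant \<open>b * wx a - a * wx b\<close> of the projections to the
  plane, in closed form for \<open>0 \<le> b\<close> (see \<open>cross_eq\<close>). It is positive
  for \<open>-1 \<le> a < b\<close>, so the projections are ordered by angle.\<close>

definition cross :: "int \<Rightarrow> int \<Rightarrow> int" where
  "cross a b = (if a = -1 then 1 + Q * b else b - a)"

lemma Q2: "2 \<le> Q" using q2 by simp

lemma QQ_pos: "0 < 1 + Q * Q" using zero_le_square[of Q] by linarith

lemma kap_eqI:
  assumes "0 \<le> s" "k * (Q\<^sup>2 + 1) \<le> 1 + Q * s" "1 + Q * s < (k + 1) * (Q\<^sup>2 + 1)"
  shows "kap s = k"
proof -
  have "(1 + Q * s) div (Q\<^sup>2 + 1) = k"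
    using assms(2,3) by (intro div_pos_neg_trivial int_div_pos_eq[where r = "1 + Q * s - k * (Q\<^sup>2 + 1)"])
      (auto simp: algebra_simps)
  then show ?thesis using assms(1) by (simp add: kap_def)
qed

lemma kap_bounds:
  assumes "0 \<le> s"
  shows "kap s * (Q\<^sup>2 + 1) \<le> 1 + Q * s" "1 + Q * s < (kap s + 1) * (Q\<^sup>2 + 1)"
proof -
  have p: "0 < Q\<^sup>2 + 1" by (simp add: add_nonneg_pos)
  have k: "kap s = (1 + Q * s) div (Q\<^sup>2 + 1)" using assms by (simp add: kap_def)
  have "(1 + Q * s) div (Q\<^sup>2 + 1) * (Q\<^sup>2 + 1) + (1 + Q * s) mod (Q\<^sup>2 + 1) = 1 + Q * s"
    by (rule div_mult_mod_eq)
  moreover have "0 \<le> (1 + Q * s) mod (Q\<^sup>2 + 1)" "(1 + Q * s) mod (Q\<^sup>2 + 1) < Q\<^sup>2 + 1"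
    using pos_mod_sign[OF p] pos_mod_bound[OF p] by auto
  ultimately show "kap s * (Q\<^sup>2 + 1) \<le> 1 + Q * s" "1 + Q * s < (kap s + 1) * (Q\<^sup>2 + 1)"
    unfolding k by (simp_all add: algebra_simps)
qed

lemma kap_nonneg: "0 \<le> s \<Longrightarrow> 0 \<le> kap s"
  by (auto simp: kap_def intro!: pos_imp_zdiv_nonneg_iff[THEN iffD2] add_nonneg_pos)

lemma kap_minus1 [simp]: "kap (-1) = 0" by (simp add: kap_def)

lemma kap_low:
  assumes "0 \<le> l" "l < Q"
  shows "kap l = 0"
proof (rule kap_eqI)
  have "Q * l \<le> Q * (Q - 1)" using assms by (intro mult_left_mono) auto
  moreover have "Q * (Q - 1) = Q * Q - Q" by (simp add: algebra_simps)
  ultimately show "1 + Q * l < (0 + 1) * (Q\<^sup>2 + 1)" using Q2 unfolding power2_eq_square add_0 mult_1 by linarith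
qed (use assms in auto)

lemma kap_Q: "kap Q = 1"
  by (rule kap_eqI) (simp_all add: power2_eq_square QQ_pos)

lemma kap_column:
  assumes "1 \<le> k" "k \<le> Q" "1 \<le> l" "l \<le> Q"
  shows "kap (k * Q + l) = k"
proof (rule kap_eqI)
  have "Q * l \<le> Q * Q" "Q * 1 \<le> Q * l" using assms by (intro mult_left_mono; simp)+
  moreover have "k * (Q\<^sup>2 + 1) = k * Q * Q + k" "1 + Q * (k * Q + l) = 1 + k * Q * Q + Q * l"
    "(k + 1) * (Q\<^sup>2 + 1) = k * Q * Q + k + Q * Q + 1"
    by (simp_all add: power2_eq_square algebra_simps)
  ultimately show "k * (Q\<^sup>2 + 1) \<le> 1 + Q * (k * Q + l)" "1 + Q * (k * Q + l) < (k + 1) * (Q\<^sup>2 + 1)"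
    using assms by linarith+
qed (use assms in auto)

lemma kap_N: "kap N = Q + 1"
  by (rule kap_eqI) (use Q2 in \<open>simp_all add: N_def power2_eq_square algebra_simps QQ_pos\<close>)

lemma kap_start: "1 \<le> k \<Longrightarrow> k \<le> Q + 1 \<Longrightarrow> kap (k * Q + 1) = k"
  using kap_column[of k 1] kap_N Q2
  by (cases "k = Q + 1") (simp_all add: N_def power2_eq_square algebra_simps)

lemma N_eq: "N = (Q + 1) * Q + 1" by (simp add: N_def power2_eq_square algebra_simps)

text \<open>Positions in a column run from 1 to \<open>Q\<close> because, for
  \<open>k \<ge> 2\<close>, \<open>kap\<close> is still \<open>k - 1\<close> at \<open>k * Q\<close>
  and becomes \<open>k\<close> at \<open>k * Q + 1\<close>. The index \<open>Q\<close> stands apart: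
  there \<open>kap\<close> is already 1.\<close>

lemma index_cases:
  assumes "-1 \<le> s" "s \<le> N"
  obtains (bottom) "s = -1" | (zero) "0 \<le> s" "s < Q" "kap s = 0" | (apex) "s = Q" "kap s = 1"
    | (col) k l where "s = k * Q + l" "1 \<le> k" "k \<le> Q" "1 \<le> l" "l \<le> Q" "kap s = k"
    | (top) "s = N" "kap s = Q + 1"
proof -
  consider "s = -1" | "0 \<le> s" "s < Q" | "s = Q" | "Q < s" "s < N" | "s = N" using assms by linarith
  then show ?thesis
  proof cases
    case 4
    define k where "k = (s - 1) div Q"
    define l where "l = (s - 1) mod Q + 1"
    have s: "s = k * Q + l" by (simp add: k_def l_def)
    have "0 \<le> (s - 1) mod Q" "(s - 1) mod Q < Q" using Q2 by simp_all
    then have l: "1 \<le> l" "l \<le> Q" by (simp_all add: l_def)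
    have "k < Q + 1"
    proof (rule ccontr)
      assume "\<not> k < Q + 1"
      then have "(Q + 1) * Q \<le> k * Q" by (intro mult_right_mono) auto
      then show False using 4 N_eq s l by linarith
    qed
    moreover have "0 < k"
    proof (rule ccontr)
      assume "\<not> 0 < k"
      then have "k * Q \<le> 0" by (simp add: mult_le_0_iff)
      then show False using 4 s l by linarith
    qed
    ultimately have k: "1 \<le> k" "k \<le> Q" by simp_all
    show ?thesis using col s k l kap_column[OF k l] by simp
  qed (use bottom zero apex top kap_low kap_Q kap_N in blast)+
qed

lemma kap_mono:
  assumes "0 \<le> s" "s \<le> t"
  shows "kap s \<le> kap t"
proof -
  have "0 \<le> Q\<^sup>2 + 1" by simp
  then show ?thesis using assms
    by (auto simp: kap_def intro!: zdiv_mono1 mult_left_mono add_nonneg_pos)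
qed

text \<open>Every \<open>W t\<close> with \<open>a < t < b\<close> lies strictly above the cone spanned by \<open>W a\<close> and \<open>W b\<close>;
  recall that \<open>kap\<close> is minus the vertical coordinate.\<close>

definition strict :: "int \<Rightarrow> int \<Rightarrow> bool" where
  "strict a b \<longleftrightarrow> (\<forall>t. a < t \<and> t < b \<longrightarrow> cross a b * kap t < cross t b * kap a + cross a t * kap b)"

text \<open>The next index after \<open>a\<close> at which \<open>kap\<close> increases.\<close>

definition nxt :: "int \<Rightarrow> int" where
  "nxt a = (if a < Q then Q else (kap a + 1) * Q + 1)"

text \<open>The candidates for edges. The third case comes from \<open>kap\<close> being 1 already
  at \<open>Q\<close>: the edge from \<open>W Q\<close> to a later column start runs strictly below
  all \<open>W t\<close> in between.\<close>

definition adj :: "int \<Rightarrow> int \<Rightarrow> bool" where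
  "adj a b \<longleftrightarrow> b = a + 1 \<or> b = nxt a \<or> (a = Q \<and> (\<exists>k. 2 \<le> k \<and> k \<le> Q + 1 \<and> b = k * Q + 1))"

lemma nxt_Q: "nxt Q = 2 * Q + 1" by (simp add: nxt_def kap_Q)

lemma index_column:
  assumes "Q \<le> s" "s \<le> N"
  obtains k l where "s = k * Q + l" "1 \<le> k" "k \<le> Q + 1" "0 \<le> l" "l \<le> Q" "kap s = k"
    "l = 0 \<longrightarrow> s = Q" "k = Q + 1 \<longrightarrow> l = 1"
proof -
  have "-1 \<le> s" using assms(1) Q2 by linarith
  then show ?thesis using assms(2)
  proof (cases rule: index_cases)
    case apex then show ?thesis using that[of 1 0] Q2 by simp
  next
    case (col k l) then show ?thesis using that[of k l] by simp
  next
    case top then show ?thesis using that[of "Q + 1" 1] Q2 N_eq by simp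
  qed (use assms(1) Q2 in linarith)+
qed

text \<open>One intermediate index refutes \<open>strict\<close> in each excluded case: 0,
  \<open>Q\<close>, \<open>a + 1\<close>, \<open>nxt a\<close> or the start of the column of
  \<open>b\<close>. For \<open>a\<close> from \<open>Q\<close> on and \<open>b\<close> beyond
  \<open>nxt a\<close>, the inequality at \<open>nxt a\<close> fails whenever \<open>a\<close> has
  column position \<open>l \<ge> 1\<close>; only \<open>a = Q\<close>, with \<open>l = 0\<close>,
  escapes, which is the third case of \<open>adj\<close>.\<close>

lemma strict_adj:
  assumes ab: "-1 \<le> a" "a < b" "b \<le> N" and st: "strict a b"
  shows "adj a b"
proof (rule ccontr)
  assume n: "\<not> adj a b"
  have b1: "a + 1 < b" and bn: "b \<noteq> nxt a" using n ab by (auto simp: adj_def)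
  have S: "cross a b * kap t < cross t b * kap a + cross a t * kap b" if "a < t" "t < b" for t
    using st that by (simp add: strict_def)
  have cr: "cross s t = t - s" if "0 \<le> s" for s t using that by (simp add: cross_def)
  consider "a = -1" "b < Q" | "a = -1" "Q < b" | "0 \<le> a" "a < Q" "b < Q"
    | "0 \<le> a" "a < Q" "Q < b" | "Q \<le> a"
    using ab bn unfolding nxt_def by (smt (verit))
  then show False
  proof cases
    case 1
    then show ?thesis using S[of 0] b1 kap_low[of b] kap_low[of 0] Q2 by simp
  next
    case 2
    have "cross (-1) b * kap Q < cross Q b * kap (-1) + cross (-1) Q * kap b"
      using S[of Q] 2 Q2 by simp
    then have "1 + Q * b < (1 + Q * Q) * kap b" by (simp add: cross_def kap_Q)
    then show ?thesis using kap_bounds(1)[of b] 2 Q2 by (simp add: power2_eq_square algebra_simps)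
  next
    case 3
    then show ?thesis using S[of "a + 1"] b1 by (simp add: kap_low)
  next
    case 4
    have "Q \<le> b" using 4 by simp
    then obtain k l where k: "b = k * Q + l" "1 \<le> k" "0 \<le> l" "kap b = k" using ab(3) by (rule index_column)
    have "(b - a) * kap Q < (b - Q) * kap a + (Q - a) * kap b"
      using S[of Q] 4 Q2 by (simp add: cr)
    then have "k * Q + l - a < (Q - a) * k" using 4 k by (simp add: kap_Q kap_low)
    moreover have "a * 1 \<le> a * k" using 4 k by (intro mult_left_mono) auto
    ultimately show ?thesis using k by (simp add: algebra_simps)
  next
    case 5
    obtain k l where k: "a = k * Q + l" "1 \<le> k" "k \<le> Q + 1" "0 \<le> l" "l \<le> Q" "kap a = k"
      "l = 0 \<longrightarrow> a = Q" "k = Q + 1 \<longrightarrow> l = 1"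
      using index_column[of a] 5 ab by auto
    have kQ: "k \<le> Q" using k(1,3,8) ab N_eq by (cases "k = Q + 1") auto
    obtain k' l' where k': "b = k' * Q + l'" "1 \<le> k'" "k' \<le> Q + 1" "0 \<le> l'" "l' \<le> Q" "kap b = k'"
      "l' = 0 \<longrightarrow> b = Q" "k' = Q + 1 \<longrightarrow> l' = 1"
      using index_column[of b] 5 ab by auto
    have l'1: "1 \<le> l'" using k'(4,7) 5 ab(2) by (cases "l' = 0") auto
    have nx: "nxt a = (k + 1) * Q + 1" using 5 k(6) by (simp add: nxt_def)
    have kapn: "kap (nxt a) = k + 1" unfolding nx using kap_start[of "k + 1"] k(2) kQ by simp
    consider "b < nxt a" | "nxt a < b" using bn by linarith
    then show ?thesis
    proof cases
      case 1
      have "k \<le> k'" using kap_mono[of a b] k(6) k'(6) 5 ab(2) Q2 by simp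
      have "k' < k + 1"
      proof (rule ccontr)
        assume "\<not> k' < k + 1"
        then have "(k + 1) * Q \<le> k' * Q" by (intro mult_right_mono) auto
        then show False using 1 nx k'(1) l'1 by simp
      qed
      then have kk: "k' = k" using \<open>k \<le> k'\<close> by simp
      have "k \<le> kap (a + 1)" "kap (a + 1) \<le> k"
        using kap_mono[of a "a + 1"] kap_mono[of "a + 1" b] k(6) k'(6) kk 5 b1 Q2 by auto
      then have "(b - a) * k < (b - (a + 1)) * k + 1 * k"
        using S[of "a + 1"] b1 5 Q2 kk k(6) k'(6) by (simp add: cr)
      then show ?thesis by (simp add: algebra_simps)
    next
      case 2
      have an: "a < nxt a" using nx k by (simp add: algebra_simps)
      have "(b - a) * (k + 1) < (b - nxt a) * k + (nxt a - a) * k'"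
        using S[OF an 2] 5 Q2 an by (simp add: cr kapn k(6) k'(6))
      then have "b - a < (nxt a - a) * (k' - k)" by (simp add: algebra_simps)
      moreover have "nxt a - a = Q + 1 - l" "b - a = (k' - k) * Q + l' - l"
        using nx k(1) k'(1) by (simp_all add: algebra_simps)
      ultimately have main: "(k' - k) * (l - 1) < l - l'"
        by (simp add: algebra_simps)
      have kk: "k + 1 \<le> k'"
        using kap_mono[of "nxt a" b] 2 an 5 Q2 k'(6) kapn by simp
      show ?thesis
      proof (cases "l = 0")
        case False
        then have "1 * (l - 1) \<le> (k' - k) * (l - 1)" using k(4) kk by (intro mult_right_mono) auto
        then show ?thesis using main l'1 by simp
      next
        case True
        then have aQ: "a = Q" using k(7) by simp
        have k1: "k = 1" using aQ k(6) kap_Q by simp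
        have "l' \<noteq> 1" using n aQ kk k1 k'(1,3) by (auto simp: adj_def)
        then have l2: "2 \<le> l'" using l'1 by simp
        have t: "kap (k' * Q + 1) = k'" using kap_start k'(2,3) by simp
        have "a < k' * Q + 1" "k' * Q + 1 < b"
          using aQ k'(1,2) l2 Q2 mult_right_mono[of 1 k' Q] by auto
        from S[OF this] have "(b - a) * k' < (b - (k' * Q + 1)) * 1 + (k' * Q + 1 - a) * k'"
          using 5 Q2 k'(2) t k(6) k1 k'(6) by (simp add: cr)
        then have "(b - (k' * Q + 1)) * k' < b - (k' * Q + 1)" by (simp add: algebra_simps)
        moreover have "(b - (k' * Q + 1)) * 1 \<le> (b - (k' * Q + 1)) * k'"
          using k' l2 by (intro mult_left_mono) auto
        ultimately show ?thesis by simp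
      qed
    qed
  qed
qed

section \<open>Linear relations among the chain vectors\<close>

lemma wx_minus1 [simp]: "wx (-1) = 0" and wx_nonneg_eq [simp]: "0 \<le> s \<Longrightarrow> wx s = 1 + Q * s"
  by (auto simp: wx_def)

lemma wx_nonneg: "-1 \<le> s \<Longrightarrow> 0 \<le> wx s"
  by (auto simp: wx_def)

lemma W_component [simp]:
  "W s $ 1 = of_int (wx s)" "W s $ 2 = - of_int (kap s)" "W s $ 3 = - of_int s"
  by (simp_all add: W_def)

lemma up_component [simp]: "up $ 1 = 0" "up $ 2 = 1" "up $ 3 = 0"
  by (simp_all add: up_def)

lemma W_eq_iff [simp]: "W s = W t \<longleftrightarrow> s = t"
proof
  assume "W s = W t"
  then have "W s $ 3 = W t $ 3" by simp
  then show "s = t" by simp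
qed simp

lemma W_neq_up [simp]: "-1 \<le> s \<Longrightarrow> W s \<noteq> up" "-1 \<le> s \<Longrightarrow> up \<noteq> W s"
proof -
  show "W s \<noteq> up" if "-1 \<le> s"
  proof
    assume eq: "W s = up"
    then have "W s $ 3 = up $ 3" "W s $ 1 = up $ 1" by simp_all
    then show False by simp
  qed
  then show "-1 \<le> s \<Longrightarrow> up \<noteq> W s" by metis
qed

lemma cross_eq:
  assumes "-1 \<le> a" "0 \<le> b"
  shows "cross a b = b * wx a - a * wx b"
  using assms by (cases "a = -1") (auto simp: cross_def algebra_simps)

lemma cross_pos: "-1 \<le> a \<Longrightarrow> a < b \<Longrightarrow> 0 < cross a b"
  by (auto simp: cross_def intro: add_pos_nonneg)

text \<open>Three plane vectors satisfy a relation with their 2 by 2 determinants as coefficients.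
  The vertical coordinates miss it by a multiple of \<open>up\<close>, whose sign tells whether
  \<open>W t\<close> lies above or below the cone of \<open>W a\<close> and
  \<open>W b\<close>.\<close>

lemma W_relation:
  assumes "-1 \<le> a" "0 \<le> t" "0 \<le> b"
  shows "of_int (cross t b) *\<^sub>R W a + of_int (cross a t) *\<^sub>R W b = of_int (cross a b) *\<^sub>R W t +
    of_int (cross a b * kap t - cross t b * kap a - cross a t * kap b) *\<^sub>R up"
proof -
  have t: "-1 \<le> t" using assms by simp
  have "real_of_int (cross t b) * of_int (wx a) + of_int (cross a t) * of_int (wx b)
      = of_int (cross a b) * of_int (wx t)"
    "real_of_int (cross t b) * of_int a + of_int (cross a t) * of_int b = of_int (cross a b) * of_int t"
    unfolding of_int_mult[symmetric] of_int_add[symmetric] of_int_eq_iff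
      cross_eq[OF t assms(3)] cross_eq[OF assms(1,2)] cross_eq[OF assms(1,3)]
    by (simp_all add: algebra_simps)
  then show ?thesis by (simp add: vec3_eq_iff)
qed

section \<open>Complexes with all vertical walls\<close>

definition verts :: "(real^3) set" where "verts = insert up (W ` {-1..N})"

definition walled :: "(real^3) set set \<Rightarrow> bool" where
  "walled T \<longleftrightarrow> cone_complex T \<and> support T = sigma_M q \<and> (\<forall>B\<in>T. card B = 3 \<and> B \<subseteq> verts) \<and>
     (\<forall>t\<in>{0..N}. \<exists>B\<in>T. {up, W t} \<subseteq> B)"

text \<open>Two kinds of triples: neighbours together with the next increase of \<open>kap\<close>,
  and the triangles at \<open>W Q\<close> over consecutive column starts. The second kind begins
  with \<open>k = 2\<close>, since \<open>(Q, Q + 1, 2 * Q + 1)\<close> is of the first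
  kind.\<close>

definition cell :: "int \<Rightarrow> int \<Rightarrow> int \<Rightarrow> bool" where
  "cell a b c \<longleftrightarrow> -1 \<le> a \<and> a < b \<and> b < c \<and> c \<le> N \<and>
     (b = a + 1 \<and> c = nxt a \<or> a = Q \<and> (\<exists>k. 2 \<le> k \<and> k \<le> Q \<and> b = k * Q + 1 \<and> c = (k + 1) * Q + 1))"

definition cells :: "(real^3) set set" where
  "cells = {{up, W s, W (s + 1)} | s. -1 \<le> s \<and> s < N} \<union> {{W a, W b, W c} | a b c. cell a b c}"

text \<open>The point lies in the wall spanned by \<open>up\<close> and \<open>W t\<close>, hence in
  the cone of those wall generators that belong to \<open>S\<close>. Without \<open>W t\<close> that
  leaves at most \<open>up\<close>, whose first coordinate is 0.\<close>

lemma wall: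
  assumes T: "cone_complex T" "\<forall>t\<in>{0..N}. \<exists>B\<in>T. {up, W t} \<subseteq> B"
    and B: "B \<in> T" "S \<subseteq> B" and S: "W t \<notin> S" and t: "0 \<le> t" "t \<le> N"
    and x: "c *\<^sub>R W t + d *\<^sub>R up \<in> convex_cone hull S" and cd: "0 < c" "0 \<le> d"
  shows False
proof -
  obtain B1 where B1: "B1 \<in> T" "{up, W t} \<subseteq> B1" using T(2) t by force
  have "c *\<^sub>R W t + d *\<^sub>R up \<in> convex_cone hull {up, W t}"
    using cd by (intro convex_cone_hull_add convex_cone_hull_mul) (simp_all add: hull_inc)
  then have "c *\<^sub>R W t + d *\<^sub>R up \<in> convex_cone hull (S \<inter> {up, W t})"
    using complex_cone_Int[OF T(1) B(1) B1(1) B(2) B1(2)] x by blast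
  moreover have "S \<inter> {up, W t} \<subseteq> {up}" using S by blast
  ultimately have "c *\<^sub>R W t + d *\<^sub>R up \<in> convex_cone hull {up}" using hull_mono by blast
  then have "c *\<^sub>R W t + d *\<^sub>R up \<in> ray up" by (simp add: ray_def)
  then obtain e where "c *\<^sub>R W t + d *\<^sub>R up = e *\<^sub>R up" by (auto simp: mem_ray_iff)
  then have "(c *\<^sub>R W t + d *\<^sub>R up) $ 1 = (e *\<^sub>R up) $ 1" by simp
  then have "c * of_int (wx t) = 0" by simp
  moreover have "0 < wx t" using t by (auto intro: add_pos_nonneg)
  ultimately show False using cd(1) by simp
qed

text \<open>If \<open>W t\<close> were not strictly above, \<open>W_relation\<close> would exhibit a
  point of the edge on the wall over \<open>W t\<close>.\<close>

lemma edge_strict: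
  assumes T: "cone_complex T" "\<forall>t\<in>{0..N}. \<exists>B\<in>T. {up, W t} \<subseteq> B"
    and B: "B \<in> T" "{W a, W b} \<subseteq> B" and ab: "-1 \<le> a" "a < b" "b \<le> N"
  shows "strict a b"
  unfolding strict_def
proof (intro allI impI)
  fix t assume t: "a < t \<and> t < b"
  let ?T = "cross a b * kap t - cross t b * kap a - cross a t * kap b"
  have t0: "0 \<le> t" "t \<le> N" "0 \<le> b" using t ab by auto
  have c: "0 < cross a b" "0 < cross t b" "0 < cross a t" using t ab t0 by (auto intro: cross_pos)
  have "?T < 0"
  proof (rule ccontr)
    assume "\<not> ?T < 0"
    then have T0: "0 \<le> real_of_int ?T" unfolding of_int_0_le_iff by linarith
    have "of_int (cross t b) *\<^sub>R W a + of_int (cross a t) *\<^sub>R W b \<in> convex_cone hull {W a, W b}"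
      using c by (intro convex_cone_hull_add convex_cone_hull_mul) (simp_all add: hull_inc)
    then have "of_int (cross a b) *\<^sub>R W t + of_int ?T *\<^sub>R up \<in> convex_cone hull {W a, W b}"
      unfolding W_relation[OF ab(1) t0(1) t0(3)] .
    then show False
      using wall[OF T B, of t "of_int (cross a b)" "of_int ?T"] t t0 c T0 by auto
  qed
  then show "cross a b * kap t < cross t b * kap a + cross a t * kap b" by simp
qed

lemma edge_sector:
  assumes T: "cone_complex T" "\<forall>t\<in>{0..N}. \<exists>B\<in>T. {up, W t} \<subseteq> B"
    and B: "B \<in> T" "{up, W a, W b} \<subseteq> B" and ab: "-1 \<le> a" "a < b" "b \<le> N"
  shows "b = a + 1"
proof (rule ccontr)
  assume "b \<noteq> a + 1"
  define t where "t = a + 1"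
  have t: "a < t" "t < b" using \<open>b \<noteq> a + 1\<close> ab by (auto simp: t_def)
  let ?T = "cross a b * kap t - cross t b * kap a - cross a t * kap b"
  have t0: "0 \<le> t" "t \<le> N" "0 \<le> b" using t ab by auto
  have c: "0 < cross a b" "0 < cross t b" "0 < cross a t" using t ab t0 by (auto intro: cross_pos)
  define r where "r = real_of_int ?T"
  \<comment> \<open>Since \<open>up\<close> is a generator, adding \<open>\<bar>r\<bar>\<close>
    times \<open>up\<close> stays in the cone and makes the vertical coefficient nonnegative, on
    whichever side of the edge \<open>W t\<close> lies.\<close>
  have "of_int (cross t b) *\<^sub>R W a + of_int (cross a t) *\<^sub>R W b + \<bar>r\<bar> *\<^sub>R up
      \<in> convex_cone hull {up, W a, W b}"
    using c by (intro convex_cone_hull_add convex_cone_hull_mul) (simp_all add: hull_inc)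
  then have "of_int (cross a b) *\<^sub>R W t + (r + \<bar>r\<bar>) *\<^sub>R up \<in> convex_cone hull {up, W a, W b}"
    unfolding W_relation[OF ab(1) t0(1) t0(3)] r_def[symmetric] by (simp add: scaleR_add_left add.assoc)
  moreover have "W t \<notin> {up, W a, W b}" using t t0 by simp
  moreover have "0 \<le> r + \<bar>r\<bar>" by linarith
  ultimately show False
    using wall[OF T B, of t "of_int (cross a b)" "r + \<bar>r\<bar>"] t0 c by simp
qed

lemma adj_cell:
  assumes "-1 \<le> a" "a < b" "b < c" "c \<le> N" "adj a b" "adj b c" "adj a c"
  shows "cell a b c"
proof -
  have c1: "c = nxt a \<or> a = Q \<and> (\<exists>k. 2 \<le> k \<and> k \<le> Q + 1 \<and> c = k * Q + 1)"
    using assms by (auto simp: adj_def)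
  show ?thesis
  proof (cases "b = a + 1 \<and> c = nxt a")
    case True
    then show ?thesis using assms by (auto simp: cell_def)
  next
    case False
    have aQ: "a = Q"
    proof (rule ccontr)
      assume "a \<noteq> Q"
      then have "c = nxt a" "b = a + 1 \<or> b = nxt a" using c1 assms(5) by (auto simp: adj_def)
      then show False using False assms(3) by auto
    qed
    have cc: "\<exists>k. 2 \<le> k \<and> k \<le> Q + 1 \<and> c = k * Q + 1" using c1 aQ nxt_Q Q2 by force
    then obtain k where k: "2 \<le> k" "k \<le> Q + 1" "c = k * Q + 1" by blast
    have "\<exists>j. 1 \<le> j \<and> j \<le> Q + 1 \<and> b = j * Q + 1"
    proof -
      consider "b = Q + 1" | "b = nxt Q" | "\<exists>k. 2 \<le> k \<and> k \<le> Q + 1 \<and> b = k * Q + 1"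
        using assms(5) aQ by (auto simp: adj_def)
      then show ?thesis
      proof cases
        case 1 then show ?thesis using Q2 by (intro exI[of _ 1]) simp
      next
        case 2 then show ?thesis using Q2 nxt_Q by (intro exI[of _ 2]) simp
      next
        case 3 then show ?thesis by force
      qed
    qed
    then obtain j where j: "1 \<le> j" "j \<le> Q + 1" "b = j * Q + 1" by blast
    have bQ: "b \<noteq> Q" using assms(2) aQ by simp
    have "c \<noteq> b + 1"
    proof
      assume "c = b + 1"
      then have "(k - j) * Q = 1" using j(3) k(3) by (simp add: algebra_simps)
      then show False using Q2 by (simp add: zmult_eq_1_iff)
    qed
    then have "c = nxt b" using assms(6) bQ by (simp add: adj_def)
    moreover have "kap b = j" using kap_start j by simp
    ultimately have cj: "c = (j + 1) * Q + 1" using assms(2) aQ by (simp add: nxt_def)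
    then have "k = j + 1" using k(3) Q2 mult_right_cancel[of Q k "j + 1"] by linarith
    then have jQ: "j \<le> Q" using k(2) by simp
    show ?thesis
    proof (cases "j = 1")
      case True
      then have "b = a + 1" "c = nxt a" using j(3) aQ cj nxt_Q by simp_all
      then show ?thesis using False by blast
    next
      case False
      then have "2 \<le> j" using j(1) by simp
      then show ?thesis using assms aQ j(3) cj jQ unfolding cell_def by blast
    qed
  qed
qed

lemma walled_subset_cells:
  assumes "walled T"
  shows "T \<subseteq> cells"
proof
  fix B assume B: "B \<in> T"
  have T: "cone_complex T" "\<forall>t\<in>{0..N}. \<exists>B\<in>T. {up, W t} \<subseteq> B" and cB: "card B = 3" "B \<subseteq> verts"
    using assms B by (auto simp: walled_def)
  show "B \<in> cells"
  proof (cases "up \<in> B")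
    case True
    have "card (B - {up}) = 2" using cB(1) True by simp
    then obtain x y where xy: "B - {up} = {x, y}" "x \<noteq> y" by (auto simp: card_2_iff)
    then have "x \<in> W ` {-1..N}" "y \<in> W ` {-1..N}" using cB(2) by (auto simp: verts_def)
    then obtain a b where ab: "x = W a" "y = W b" "-1 \<le> a" "a \<le> N" "-1 \<le> b" "b \<le> N" by auto
    have BB: "B = {up, W a, W b}" using xy(1) True ab by blast
    have "a \<noteq> b" using xy(2) ab by auto
    then consider "a < b" | "b < a" by linarith
    then show ?thesis
    proof cases
      case 1
      have "b = a + 1" by (rule edge_sector[OF T B]) (use BB 1 ab in auto)
      then show ?thesis using BB 1 ab unfolding cells_def by auto
    next
      case 2
      have "a = b + 1" by (rule edge_sector[OF T B]) (use BB 2 ab in auto)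
      then have "B = {up, W b, W (b + 1)}" "b < N" using BB 2 ab by auto
      then show ?thesis using ab unfolding cells_def by auto
    qed
  next
    case False
    then have "B \<subseteq> W ` {-1..N}" using cB(2) by (auto simp: verts_def)
    then obtain I where I: "I \<subseteq> {-1..N}" "B = W ` I" by (auto simp: subset_image_iff)
    have "card I = 3" using cB(1) I(2) card_image[of W I] by (simp add: inj_on_def)
    then obtain i j k where ijk: "I = {i, j, k}" "i \<noteq> j" "j \<noteq> k" "i \<noteq> k" by (auto simp: card_3_iff)
    have "\<exists>a b c. I = {a, b, c} \<and> a < b \<and> b < c"
    proof -
      consider "i < j" "j < k" | "i < k" "k < j" | "j < i" "i < k" | "j < k" "k < i"
        | "k < i" "i < j" | "k < j" "j < i" using ijk by linarith
      then show ?thesis using ijk(1) by cases blast+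
    qed
    then obtain a b c where abc: "I = {a, b, c}" "a < b" "b < c" by blast
    have BB: "B = {W a, W b, W c}" and r: "-1 \<le> a" "c \<le> N" using I abc by auto
    have "adj a b" "adj b c" "adj a c"
      using r abc BB by (auto intro!: strict_adj edge_strict[OF T B])
    then have "cell a b c" using adj_cell r abc by blast
    then show ?thesis using BB unfolding cells_def by blast
  qed
qed

lemma walledD:
  assumes "walled T"
  shows "cone_complex T" "support T = sigma_M q" "\<forall>B\<in>T. card B = 3" "\<And>B. B \<in> T \<Longrightarrow> B \<subseteq> verts"
    "\<forall>t\<in>{0..N}. \<exists>B\<in>T. {up, W t} \<subseteq> B"
  using assms by (auto simp: walled_def)

section \<open>Facets of the cone and sides of the vertical walls\<close>

lemma sigma_M_eq: "sigma_M q = convex_cone hull {W N, up, W (-1)}"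
proof -
  have N0: "0 \<le> N" by (simp add: N_def)
  have "real_of_int (wx N) = real q ^ 3 + real q ^ 2 + real q + 1"
    using N0 by (simp add: N_def algebra_simps power2_eq_square power3_eq_cube)
  moreover have "real_of_int N = real q ^ 2 + real q + 1" by (simp add: N_def)
  ultimately have "vector [real q ^ 3 + real q ^ 2 + real q + 1, - (real q + 1), - (real q ^ 2 + real q + 1)] = W N"
    by (simp add: vec3_eq_iff kap_N)
  moreover have "vector [0, 1, 0] = up" "vector [0, 0, 1] = W (-1)"
    by (simp_all add: vec3_eq_iff)
  ultimately show ?thesis by (simp add: sigma_M_def)
qed

lemma convex_cone_sigma_M: "convex_cone (sigma_M q)"
  by (simp add: sigma_M_eq convex_cone_convex_cone_hull)

lemma N_pos: "0 < N" "Q < N"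
  using Q2 by (simp_all add: N_def add_nonneg_pos power2_eq_square add_pos_pos)

text \<open>One inequality per facet. In the second one the factor \<open>q + 1\<close>, common to
  the first two coordinates of \<open>W N\<close>, has been cancelled.\<close>

lemma sigma_M_iff:
  "x \<in> sigma_M q \<longleftrightarrow> 0 \<le> x $ 1 \<and> 0 \<le> x $ 1 + (real q ^ 2 + 1) * x $ 2 \<and>
     0 \<le> of_int N * x $ 1 + of_int (wx N) * x $ 3" (is "_ \<longleftrightarrow> ?R x")
proof
  have wN: "0 < real_of_int (wx N)" using N_pos by (simp add: add_pos_nonneg)
  have wN': "real_of_int (wx N) = (real q ^ 2 + 1) * (real q + 1)"
    using N_pos by (simp add: N_def algebra_simps power2_eq_square)
  have R: "convex_cone {x. ?R x}"
    unfolding convex_cone_iff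
  proof (intro conjI ballI allI impI)
    fix x y assume "x \<in> {x. ?R x}" "y \<in> {x. ?R x}"
    then show "x + y \<in> {x. ?R x}" by (simp add: algebra_simps)
  next
    fix x and c :: real assume x: "x \<in> {x. ?R x}" and c: "0 \<le> c"
    have "0 \<le> c * x $ 1" "0 \<le> c * (x $ 1 + (real q ^ 2 + 1) * x $ 2)"
      "0 \<le> c * (of_int N * x $ 1 + of_int (wx N) * x $ 3)"
      using x c by simp_all
    then show "c *\<^sub>R x \<in> {x. ?R x}" by (simp add: algebra_simps)
  qed simp
  have "{W N, up, W (-1)} \<subseteq> {x. ?R x}"
    using N_pos wN by (simp add: kap_N wN' algebra_simps del: wx_nonneg_eq)
  then show "x \<in> sigma_M q \<Longrightarrow> ?R x"
    unfolding sigma_M_eq using hull_minimal[of _ "{x. ?R x}" convex_cone] R by blast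
  assume r: "?R x"
  define a where "a = x $ 1 / of_int (wx N)"
  have a: "x $ 1 = a * of_int (wx N)" "0 \<le> a" using wN r by (simp_all add: a_def)
  have b: "0 \<le> x $ 2 + a * (real q + 1)"
  proof -
    have "x $ 1 + (real q ^ 2 + 1) * x $ 2 = (real q ^ 2 + 1) * (x $ 2 + a * (real q + 1))"
      by (simp add: a(1) wN' algebra_simps)
    then have "0 \<le> (real q ^ 2 + 1) * (x $ 2 + a * (real q + 1))" using r by simp
    moreover have "0 < real q ^ 2 + 1" by (simp add: add_nonneg_pos)
    ultimately show ?thesis
      using zero_le_mult_iff[of "real q ^ 2 + 1" "x $ 2 + a * (real q + 1)"] by linarith
  qed
  have c: "0 \<le> x $ 3 + a * of_int N"
  proof -
    have "of_int N * x $ 1 + of_int (wx N) * x $ 3 = of_int (wx N) * (x $ 3 + a * of_int N)"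
      by (simp add: a(1) algebra_simps)
    then have "0 \<le> of_int (wx N) * (x $ 3 + a * of_int N)" using r by simp
    then show ?thesis using wN zero_le_mult_iff[of "of_int (wx N)" "x $ 3 + a * of_int N"] by linarith
  qed
  have "a *\<^sub>R W N + (x $ 2 + a * (real q + 1)) *\<^sub>R up + (x $ 3 + a * of_int N) *\<^sub>R W (-1) \<in> sigma_M q"
    unfolding sigma_M_eq using a b c
    by (intro convex_cone_hull_add convex_cone_hull_mul) (simp_all add: hull_inc)
  moreover have "a *\<^sub>R W N + (x $ 2 + a * (real q + 1)) *\<^sub>R up + (x $ 3 + a * of_int N) *\<^sub>R W (-1) = x"
    using a(1) by (simp add: vec3_eq_iff kap_N) (simp add: algebra_simps)
  ultimately show "x \<in> sigma_M q" by simp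
qed

lemma W_in_sigma_M:
  assumes "-1 \<le> s" "s \<le> N"
  shows "W s \<in> sigma_M q"
proof (cases "s = -1")
  case True
  then show ?thesis by (simp add: sigma_M_eq hull_inc)
next
  case False
  then have s: "0 \<le> s" using assms(1) by simp
  have "real_of_int (kap s * (Q\<^sup>2 + 1)) \<le> of_int (1 + Q * s)"
    using kap_bounds(1)[OF s] by (simp only: of_int_le_iff)
  then have 2: "0 \<le> real_of_int (wx s) + (real q ^ 2 + 1) * (- of_int (kap s))"
    using s by (simp add: algebra_simps)
  have "0 \<le> N * wx s - wx N * s" using s assms(2) N_pos by (simp add: algebra_simps)
  then have "0 \<le> real_of_int (N * wx s - wx N * s)" by (simp only: of_int_0_le_iff)
  then have 3: "0 \<le> real_of_int N * of_int (wx s) + of_int (wx N) * (- of_int s)"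
    by (simp del: wx_nonneg_eq)
  show ?thesis unfolding sigma_M_iff W_component using 2 3 wx_nonneg[OF assms(1)] by simp
qed

lemma up_in_sigma_M: "up \<in> sigma_M q"
  by (simp add: sigma_M_eq hull_inc)

text \<open>The sign of \<open>side t v\<close> tells on which side of the wall spanned by \<open>up\<close> and \<open>W t\<close> the
  vector \<open>v\<close> lies.\<close>

definition side :: "int \<Rightarrow> real^3 \<Rightarrow> real" where
  "side t v = - of_int t * v $ 1 - of_int (wx t) * v $ 3"

lemma side_linear: "linear (side t)"
  by (rule linearI) (simp_all add: side_def algebra_simps)

lemma side_up [simp]: "side t up = 0" by (simp add: side_def)

lemma side_W:
  assumes "-1 \<le> t" "0 \<le> s"
  shows "side t (W s) = of_int (cross t s)"
  by (simp add: side_def cross_eq[OF assms])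

lemma side_W_self [simp]: "side t (W t) = 0"
  by (simp add: side_def)

lemma side_antisym: "side t (W s) = - side s (W t)"
  by (simp add: side_def)

lemma side_W_pos: "-1 \<le> t \<Longrightarrow> t < s \<Longrightarrow> 0 < side t (W s)"
  using side_W[of t s] cross_pos[of t s] by simp

lemma side_W_neg: "-1 \<le> s \<Longrightarrow> s < t \<Longrightarrow> side t (W s) < 0"
  using side_W_pos[of s t] side_antisym[of t s] by simp

text \<open>The test point \<open>y\<close> lies between the walls of \<open>W s\<close> and
  \<open>W (s + 1)\<close>, raised until its second coordinate is 1. Only \<open>up\<close> among
  the vertices has positive second coordinate, so the cone containing \<open>y\<close> is a sector,
  and the signs of \<open>side\<close> at \<open>y\<close> identify it.\<close>

lemma walled_sector:
  assumes g: "walled T" and s: "-1 \<le> s" "s < N"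
  shows "{up, W s, W (s + 1)} \<in> T"
proof -
  define y where "y = W s + W (s + 1) + of_int (kap s + kap (s + 1) + 1) *\<^sub>R up"
  have k0: "0 \<le> kap s" "0 \<le> kap (s + 1)" using kap_nonneg[of s] kap_nonneg[of "s + 1"] s by (cases "s = -1", auto)
  have "y \<in> support T"
    unfolding walledD(2)[OF g] y_def using s k0 W_in_sigma_M[of s] W_in_sigma_M[of "s + 1"] up_in_sigma_M
    by (intro convex_cone_add[OF convex_cone_sigma_M] convex_cone_scaleR[OF convex_cone_sigma_M]) auto
  then obtain B where B: "B \<in> T" "y \<in> convex_cone hull B" by (auto simp: support_def)
  have y2: "y $ 2 = 1" by (simp add: y_def)
  have upB: "up \<in> B"
  proof (rule ccontr)
    assume "up \<notin> B"
    then have "B \<subseteq> W ` {-1..N}" using walledD(4)[OF g B(1)] by (auto simp: verts_def)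
    moreover have "0 \<le> - W i $ 2" if "-1 \<le> i" for i
      using that kap_nonneg[of i] by (cases "i = -1") auto
    ultimately have "0 \<le> - b $ 2" if "b \<in> B" for b
      using that by force
    then have "0 \<le> - y $ 2"
      by (intro linear_nonneg_on_cone[OF _ _ B(2), of "\<lambda>v. - v $ 2"]) (auto intro: linearI)
    then show False using y2 by simp
  qed
  have "B \<in> cells" using walled_subset_cells[OF g] B(1) by blast
  then obtain r where r: "B = {up, W r, W (r + 1)}" "-1 \<le> r" "r < N"
    using upB W_neq_up by (force simp: cells_def cell_def)
  have "side t y = side t (W s) + side t (W (s + 1))" for t
    by (simp add: y_def linear_add[OF side_linear] linear_scale[OF side_linear])
  moreover have "0 \<le> side r y"
    using side_W_pos[of r "r + 1"] r
    by (intro linear_nonneg_on_cone[OF side_linear _ B(2)]) (auto simp: less_imp_le)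
  moreover have "0 \<le> - side (r + 1) y"
    using side_W_neg[of r "r + 1"] r
    by (intro linear_nonneg_on_cone[OF _ _ B(2), of "\<lambda>v. - side (r + 1) v"])
       (auto simp: less_imp_le intro: linear_compose_neg side_linear)
  ultimately have 1: "0 \<le> side r (W s) + side r (W (s + 1))"
    "side (r + 1) (W s) + side (r + 1) (W (s + 1)) \<le> 0" by simp_all
  have "\<not> s < r"
  proof
    assume "s < r"
    then have "side r (W s) < 0" "side r (W (s + 1)) \<le> 0"
      using side_W_neg[of s r] side_W_neg[of "s + 1" r] s by (cases "s + 1 = r"; simp)+
    then show False using 1 by simp
  qed
  moreover have "\<not> r < s"
  proof
    assume "r < s"
    then have "0 < side (r + 1) (W (s + 1))" "0 \<le> side (r + 1) (W s)"
      using side_W_pos[of "r + 1" s] side_W_pos[of "r + 1" "s + 1"] r by (cases "r + 1 = s"; simp)+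
    then show False using 1 by simp
  qed
  ultimately have "r = s" by simp
  then show ?thesis using B(1) r(1) by simp
qed

lemma cells_no_up:
  assumes "B \<in> cells" "up \<notin> B"
  obtains i j l where "B = {W i, W j, W l}" "cell i j l"
  using assms unfolding cells_def by blast

text \<open>The negative coefficient of \<open>up\<close> puts \<open>W c\<close> across the facet
  of \<open>W a\<close> and \<open>W b\<close> from the sector. It is exactly -1 because
  \<open>kap\<close> agrees at \<open>a\<close> and \<open>b\<close> and is one larger at
  \<open>c\<close>.\<close>

lemma cell_left_relation:
  assumes c: "cell a b c" and k: "b = a + 1" "c = nxt a"
  shows "W c = (- of_int (cross b c)) *\<^sub>R W a + of_int (cross a c) *\<^sub>R W b - 1 *\<^sub>R up"
proof -
  have r: "-1 \<le> a" "a < b" "b < c" "c \<le> N" using c by (auto simp: cell_def)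
  have t0: "0 \<le> b" "0 \<le> c" using r by auto
  have cr: "0 < cross a b" "0 < cross a c" "0 < cross b c" using r by (auto intro: cross_pos)
  have ab1: "cross a b = 1" using k(1) r(1) by (cases "a = -1") (auto simp: cross_def)
  have neg: "cross a c * kap b - cross b c * kap a - cross a b * kap c = -1"
  proof (cases "a = -1")
    case True
    then show ?thesis using k kap_Q kap_low[of 0] Q2 by (simp add: cross_def nxt_def)
  next
    case False
    then have a0: "0 \<le> a" using r(1) by simp
    have "kap b = kap a \<and> kap c = kap a + 1"
    proof (cases "a < Q")
      case True
      then show ?thesis using a0 k r kap_low[of a] kap_low[of b] kap_Q by (simp add: nxt_def)
    next
      case False
      then have "Q \<le> a" "a \<le> N" using r by simp_all
      then obtain j l where j: "a = j * Q + l" "1 \<le> j" "j \<le> Q + 1" "0 \<le> l" "l \<le> Q" "kap a = j"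
        "l = 0 \<longrightarrow> a = Q" "j = Q + 1 \<longrightarrow> l = 1"
        by (rule index_column)
      have jQ: "j \<le> Q" using j(1,3,8) r N_eq by (cases "j = Q + 1") auto
      have cj: "c = (j + 1) * Q + 1" using k(2) False j(6) by (simp add: nxt_def)
      have bj: "b = j * Q + (l + 1)" using k(1) j(1) by simp
      then have "l + 1 \<le> Q" using r(3) cj by (simp add: algebra_simps)
      then show ?thesis using kap_column[OF j(2) jQ, of "l + 1"] kap_start[of "j + 1"] j jQ bj cj by simp
    qed
    then show ?thesis using a0 r k(1) by (simp add: cross_def algebra_simps)
  qed
  have "of_int (cross b c) *\<^sub>R W a + W c = of_int (cross a c) *\<^sub>R W b + (-1) *\<^sub>R up"
    using W_relation[OF r(1) t0, unfolded neg] by (simp add: ab1)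
  then show "W c = (- of_int (cross b c)) *\<^sub>R W a + of_int (cross a c) *\<^sub>R W b - 1 *\<^sub>R up"
    by (simp add: algebra_simps)
qed

text \<open>Crossing the facet from the sector yields a cell with the edge from \<open>a\<close> to
  \<open>a + 1\<close>. If the cell starts with this edge, it is the wanted one; if it ends with it,
  then \<open>nxt a = a + 1\<close>, which \<open>b < c\<close> excludes.\<close>

lemma walled_cell_left:
  assumes g: "walled T" and c: "cell a b c" and k: "b = a + 1" "c = nxt a"
  shows "{W a, W b, W c} \<in> T"
proof -
  have r: "-1 \<le> a" "a < b" "b < c" "c \<le> N" using c by (auto simp: cell_def)
  note T = walledD[OF g]
  have B1: "{W a, W b, up} \<in> T"
    using walled_sector[OF g r(1)] r k(1) by (simp add: insert_commute)
  note rel = cell_left_relation[OF c k]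
  obtain z' where z': "z' \<notin> {W a, W b, up}" "{W a, W b, z'} \<in> T"
    using complex_across_facet[OF T(1,3) B1 _ _ _ _ _ rel] r W_in_sigma_M[of c] convex_cone_sigma_M
    by (auto simp: T(2))
  have "{W a, W b, z'} \<in> cells" using z'(2) walled_subset_cells[OF g] by blast
  moreover have "up \<notin> {W a, W b, z'}" using z'(1) r by auto
  ultimately obtain i j l where ijl: "{W a, W b, z'} = {W i, W j, W l}" "cell i j l"
    by (rule cells_no_up)
  have o: "i < j" "j < l" using ijl(2) by (auto simp: cell_def)
  have "W a \<in> {W i, W j, W l}" "W b \<in> {W i, W j, W l}" unfolding ijl(1)[symmetric] by simp_all
  then have "a \<in> {i, j, l}" "b \<in> {i, j, l}" by simp_all
  then consider "i = a" "j = b" | "j = a" "l = b" using o r k(1) by auto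
  then show ?thesis
  proof cases
    case 1
    have "b \<noteq> m * Q + 1 \<or> a \<noteq> Q" if "2 \<le> m" for m
      using mult_right_mono[of 2 m Q] that k(1) Q2 by auto
    then have "l = c" using ijl(2) 1 k unfolding cell_def by blast
    then show ?thesis using ijl(1) z'(2) 1 by simp
  next
    case 2
    have "nxt a = a + 1"
    proof -
      have cc: "cell i a (a + 1)" using ijl(2) 2 k(1) by simp
      have "a \<noteq> m * Q + 1 \<or> a + 1 \<noteq> (m + 1) * Q + 1" for m
        using Q2 by (auto simp: algebra_simps)
      then have i: "a = i + 1" "a + 1 = nxt i" "-1 \<le> i" "a + 1 \<le> N"
        using cc unfolding cell_def by blast+
      show ?thesis
      proof (cases "i < Q")
        case True
        then show ?thesis using i by (simp add: nxt_def)
      next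
        case False
        then have "Q \<le> i" "i \<le> N" using i by simp_all
        then obtain m n where m: "i = m * Q + n" "1 \<le> m" "m \<le> Q + 1" "0 \<le> n" "n \<le> Q" "kap i = m"
          "n = 0 \<longrightarrow> i = Q" "m = Q + 1 \<longrightarrow> n = 1"
          by (rule index_column)
        have mQ: "m \<le> Q" using m(1,3,8) i N_eq by (cases "m = Q + 1") auto
        have am: "a = m * Q + Q" using i(2) False m(6) by (simp add: nxt_def algebra_simps)
        then have "kap a = m" using kap_column[of m Q] m(2) mQ Q2 by simp
        then show ?thesis using am i(1) False by (simp add: nxt_def algebra_simps)
      qed
    qed
    then show ?thesis using r k by simp
  qed
qed

text \<open>The triple \<open>(b, b + 1, c)\<close> is a cell of the first kind, and the relation
  places \<open>W Q\<close> across its facet of \<open>W b\<close> and \<open>W c\<close>, again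
  with coefficient -1.\<close>

lemma cell_bottom_facts:
  assumes k: "2 \<le> k" "k \<le> Q" "b = k * Q + 1" "c = (k + 1) * Q + 1"
  shows "Q < b" "b + 1 < c" "c \<le> N" "c = nxt b" "cell b (b + 1) c"
    "W Q = of_int (k + 1) *\<^sub>R W b + (- of_int (k - 1)) *\<^sub>R W c - 1 *\<^sub>R W (b + 1)"
proof -
  have kb: "kap b = k" "kap c = k + 1" using kap_start[of k] kap_start[of "k + 1"] k by simp_all
  have kb1: "kap (b + 1) = k" using kap_column[of k 2] k Q2 by (simp add: add.assoc)
  have Qb: "Q < b" using k(1,3) mult_right_mono[of 1 k Q] by simp
  have bc: "b + 1 < c" "b + Q = c" using k(3,4) Q2 by (simp_all add: algebra_simps)
  have cN: "c \<le> N" using k N_eq mult_right_mono[of "k + 1" "Q + 1" Q] by simp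
  have nb: "c = nxt b" using kb(1) Qb k(4) by (simp add: nxt_def)
  have "cell b (b + 1) c" using Qb bc cN nb Q2 by (simp add: cell_def)
  have "W Q = of_int (k + 1) *\<^sub>R W b + (- of_int (k - 1)) *\<^sub>R W c - 1 *\<^sub>R W (b + 1)"
    using Q2 Qb bc(1) kb kb1 kap_Q by (simp add: vec3_eq_iff) (simp add: k(3,4) algebra_simps)
  show "Q < b" "b + 1 < c" "c \<le> N" "c = nxt b" "cell b (b + 1) c"
    "W Q = of_int (k + 1) *\<^sub>R W b + (- of_int (k - 1)) *\<^sub>R W c - 1 *\<^sub>R W (b + 1)"
    by fact+
qed

lemma walled_cell_bottom:
  assumes g: "walled T" and k: "2 \<le> k" "k \<le> Q" "b = k * Q + 1" "c = (k + 1) * Q + 1"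
  shows "{W Q, W b, W c} \<in> T"
proof -
  note T = walledD[OF g]
  note Qb = cell_bottom_facts(1)[OF k] and cN = cell_bottom_facts(3)[OF k]
    and nb = cell_bottom_facts(4)[OF k] and rel = cell_bottom_facts(6)[OF k]
  have bc: "b + 1 < c" "b + Q = c" using cell_bottom_facts(2)[OF k] k by (simp_all add: algebra_simps)
  have B1: "{W b, W c, W (b + 1)} \<in> T"
    using walled_cell_left[OF g cell_bottom_facts(5)[OF k] refl nb] by (simp add: insert_commute)
  obtain z' where z': "z' \<notin> {W b, W c, W (b + 1)}" "{W b, W c, z'} \<in> T"
    using complex_across_facet[OF T(1,3) B1 _ _ _ _ _ rel] bc Qb N_pos Q2 W_in_sigma_M[of Q]
      convex_cone_sigma_M by (auto simp: T(2))
  have "z' \<noteq> up"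
  proof
    assume "z' = up"
    then have "c = b + 1"
      by (intro edge_sector[OF T(1,5) z'(2)]) (use Qb bc cN Q2 in auto)
    then show False using bc by simp
  qed
  then have "up \<notin> {W b, W c, z'}" using Qb bc Q2 by auto
  moreover have "{W b, W c, z'} \<in> cells" using walled_subset_cells[OF g] z'(2) by blast
  ultimately obtain i j l where ijl: "{W b, W c, z'} = {W i, W j, W l}" "cell i j l"
    using cells_no_up by blast
  have o: "i < j" "j < l" using ijl(2) by (auto simp: cell_def)
  have "W b \<in> {W i, W j, W l}" "W c \<in> {W i, W j, W l}" unfolding ijl(1)[symmetric] by simp_all
  then have "b \<in> {i, j, l}" "c \<in> {i, j, l}" by simp_all
  then consider "i = b" "j = c" | "i = b" "l = c" | "j = b" "l = c" using o bc by auto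
  then show ?thesis
  proof cases
    case 1
    then show ?thesis using ijl(2) bc Qb by (simp add: cell_def)
  next
    case 2
    then have "j = b + 1" using ijl(2) Qb by (simp add: cell_def)
    then have "W (b + 1) \<in> {W b, W c, z'}" unfolding ijl(1) by simp
    then show ?thesis using z'(1) bc by auto
  next
    case 3
    have "i = Q"
    proof (rule ccontr)
      assume "i \<noteq> Q"
      \<comment> \<open>A first index other than \<open>Q\<close> would be the last one of column
        \<open>k - 1\<close>, but the next increase of \<open>kap\<close> after it is at
        \<open>b\<close>, not at \<open>c\<close>.\<close>
      then have i: "b = i + 1" "c = nxt i" using ijl(2) 3 by (auto simp: cell_def)
      then have "i = (k - 1) * Q + Q" using k(3) by (simp add: algebra_simps)
      then have "kap i = k - 1" using kap_column[of "k - 1" Q] k Q2 by simp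
      then have "nxt i = k * Q + 1" using i(1) Qb \<open>i \<noteq> Q\<close> by (simp add: nxt_def)
      then show False using i(2) bc k(3) by simp
    qed
    then show ?thesis using ijl(1) z'(2) 3 by simp
  qed
qed

lemma walled_eq_cells:
  assumes g: "walled T"
  shows "T = cells"
proof
  show "T \<subseteq> cells" by (rule walled_subset_cells[OF g])
  show "cells \<subseteq> T"
  proof
    fix B assume "B \<in> cells"
    then consider s where "B = {up, W s, W (s + 1)}" "-1 \<le> s" "s < N"
      | a b c where "B = {W a, W b, W c}" "cell a b c" by (auto simp: cells_def)
    then show "B \<in> T"
    proof cases
      case 1
      then show ?thesis using walled_sector[OF g] by simp
    next
      case 2
      then consider "b = a + 1" "c = nxt a"
        | k where "a = Q" "2 \<le> k" "k \<le> Q" "b = k * Q + 1" "c = (k + 1) * Q + 1"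
        unfolding cell_def by blast
      then show ?thesis
      proof cases
        case 1
        then show ?thesis using walled_cell_left[OF g 2(2)] 2(1) by simp
      next
        case 2
        then show ?thesis using walled_cell_bottom[OF g] \<open>B = {W a, W b, W c}\<close> by simp
      qed
    qed
  qed
qed

section \<open>Unimodularity of the cells\<close>

lemma wx_pos: "0 \<le> t \<Longrightarrow> 0 < wx t"
  by (simp add: add_pos_nonneg)

lemma W_lattice: "W s \<in> lattice" and up_lattice: "up \<in> lattice"
  by (simp_all add: lattice_def forall_3)

lemma det3_up: "det3 u v up = u $ 3 * v $ 1 - u $ 1 * v $ 3"
  by (simp add: det3_def)

lemma det3_sector:
  assumes "-1 \<le> a" "0 \<le> b"
  shows "det3 (W a) (W b) up = of_int (cross a b)"
  by (simp add: det3_up cross_eq[OF assms] algebra_simps)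

text \<open>Sectors have determinant 1. Each facet crossing replaces a vertex by a vector whose
  coefficient at that vertex is -1, so the absolute value of the determinant persists.\<close>

lemma cells_lattice_basis:
  assumes "B \<in> cells"
  shows "lattice_basis B"
proof -
  have sector: "det3 (W a) (W (a + 1)) up = 1" if "-1 \<le> a" for a
    using det3_sector[OF that, of "a + 1"] that by (cases "a = -1") (auto simp: cross_def)
  have left: "det3 (W a) (W b) (W c) = -1" if c: "cell a b c" "b = a + 1" "c = nxt a" for a b c
  proof -
    have "det3 (W a) (W b) (W c) = - det3 (W a) (W b) up"
      unfolding cell_left_relation[OF c] by (simp add: det3_def algebra_simps)
    then show ?thesis using sector[of a] c(1,2) by (simp add: cell_def)
  qed
  consider s where "B = {up, W s, W (s + 1)}" "-1 \<le> s"
    | a b c where "B = {W a, W b, W c}" "cell a b c" using assms by (auto simp: cells_def)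
  then show ?thesis
  proof cases
    case 1
    then have "B = {W s, W (s + 1), up}" by auto
    then show ?thesis using det3_lattice_basis[OF W_lattice W_lattice up_lattice] sector[OF 1(2)] by simp
  next
    case 2
    then consider "b = a + 1" "c = nxt a"
      | k where "a = Q" "2 \<le> k" "k \<le> Q" "b = k * Q + 1" "c = (k + 1) * Q + 1"
      unfolding cell_def by blast
    then have "\<bar>det3 (W a) (W b) (W c)\<bar> = 1"
    proof cases
      case 1
      then show ?thesis using left[OF 2(2)] by simp
    next
      case k: 2
      note f = cell_bottom_facts[OF k(2-5)]
      have "det3 (W a) (W b) (W c) = det3 (W b) (W (b + 1)) (W c)"
        unfolding k(1) f(6) by (simp add: det3_def algebra_simps)
      then show ?thesis using left[OF f(5) refl f(4)] by simp
    qed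
    then show ?thesis using 2(1) det3_lattice_basis[OF W_lattice W_lattice W_lattice] by simp
  qed
qed

section \<open>Inserting the rays one by one\<close>

text \<open>The invariant once the rays with index in \<open>S\<close> are in place. It prescribes
  the sectors over consecutive indices and leaves open the cones below them, which may depend on the
  order of insertion.\<close>

definition chain_complex :: "int set \<Rightarrow> (real^3) set set \<Rightarrow> bool" where
  "chain_complex S T \<longleftrightarrow> cone_complex T \<and> support T = sigma_M q \<and>
     (\<forall>B\<in>T. card B = 3 \<and> B \<subseteq> insert up (W ` S)) \<and>
     (\<forall>a\<in>S. \<forall>b\<in>S. a < b \<and> {a<..<b} \<inter> S = {} \<longrightarrow> {up, W a, W b} \<in> T)"

text \<open>\<open>W t\<close> lies on or above the cone spanned by \<open>W a\<close> and \<open>W b\<close>.\<close>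

definition above :: "int \<Rightarrow> int \<Rightarrow> int \<Rightarrow> bool" where
  "above a t b \<longleftrightarrow> cross a b * kap t \<le> cross t b * kap a + cross a t * kap b"

text \<open>\<open>W t\<close> is strictly between the two walls, so the smallest cone containing it
  involves both \<open>W a\<close> and \<open>W b\<close>, and the exchange creates the two new
  sectors whether \<open>W t\<close> is on the edge or above it. The other sectors do not contain
  both \<open>W a\<close> and \<open>W b\<close> and stay untouched.\<close>

lemma chain_step:
  assumes C: "chain_complex S T" and S: "S \<subseteq> {-1..N}"
    and ab: "a \<in> S" "b \<in> S" "a < t" "t < b" "{a<..<b} \<inter> S = {}" and v: "above a t b"
  shows "\<exists>T'. chain_complex (insert t S) T' \<and>
    star_subdivision (ray (W t)) (cone_fan T) = cone_fan T'"
proof -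
  have cx: "cone_complex T" "support T = sigma_M q" "\<And>B. B \<in> T \<Longrightarrow> card B = 3"
    "\<And>B. B \<in> T \<Longrightarrow> B \<subseteq> insert up (W ` S)"
    "\<And>a b. a \<in> S \<Longrightarrow> b \<in> S \<Longrightarrow> a < b \<Longrightarrow> {a<..<b} \<inter> S = {} \<Longrightarrow> {up, W a, W b} \<in> T"
    using C unfolding chain_complex_def by blast+
  have r: "-1 \<le> a" "b \<le> N" "0 \<le> t" "0 \<le> b" using ab S by auto
  let ?B0 = "{up, W a, W b}"
  have tS: "t \<notin> S" using ab by auto
  have B0: "?B0 \<in> T" using cx(5) ab by auto
  have cr: "0 < cross a b" "0 < cross t b" "0 < cross a t" using r ab by (auto intro: cross_pos)
  let ?d = "cross a b * kap t - cross t b * kap a - cross a t * kap b"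
  have d: "0 \<le> - real_of_int ?d" using v unfolding above_def of_int_minus[symmetric] of_int_0_le_iff by linarith
  have "of_int (cross a b) *\<^sub>R W t =
      of_int (cross t b) *\<^sub>R W a + of_int (cross a t) *\<^sub>R W b + (- of_int ?d) *\<^sub>R up"
    unfolding W_relation[OF r(1,3,4)] by (simp add: scaleR_add_left[symmetric])
  also have "\<dots> \<in> convex_cone hull ?B0"
    using cr d by (intro convex_cone_hull_add convex_cone_hull_mul) (simp_all add: hull_inc)
  finally have "of_int (cross a b) *\<^sub>R W t \<in> convex_cone hull ?B0" .
  then have vB0: "W t \<in> convex_cone hull ?B0"
    using convex_cone_hull_mul[of "of_int (cross a b) *\<^sub>R W t" ?B0 "1 / of_int (cross a b)"] cr by simp
  define Sc where "Sc = {b. representation ?B0 (W t) b \<noteq> 0}"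
  interpret star_center T "W t" ?B0 "representation ?B0 (W t)" Sc
  proof
    show "W t \<noteq> 0"
    proof
      assume "W t = 0"
      then have "W t $ 1 = 0" by simp
      then have "wx t = 0" by (simp del: wx_nonneg_eq)
      then show False using wx_pos[OF r(3)] by simp
    qed
    show "W t \<notin> B" if "B \<in> T" for B
      using cx(4)[OF that] tS r by auto
  qed (use cx(1) B0 vB0 Sc_def in auto)
  have sub: "{W a, W b} \<subseteq> Sc"
  proof -
    have "W a \<in> Sc"
    proof (rule ccontr)
      assume "W a \<notin> Sc"
      then have "Sc \<subseteq> {up, W b}" using S_subset by blast
      then have in_b: "W t \<in> convex_cone hull {up, W b}"
        using v_in_S hull_mono[of Sc "{up, W b}" convex_cone] by blast
      have "0 \<le> side b (W t)"
        by (rule linear_nonneg_on_cone[OF side_linear _ in_b]) auto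
      then show False using side_W_neg[of t b] ab r by simp
    qed
    moreover have "W b \<in> Sc"
    proof (rule ccontr)
      assume "W b \<notin> Sc"
      then have "Sc \<subseteq> {up, W a}" using S_subset by blast
      then have in_a: "W t \<in> convex_cone hull {up, W a}"
        using v_in_S hull_mono[of Sc "{up, W a}" convex_cone] by blast
      have "0 \<le> - side a (W t)"
        by (rule linear_nonneg_on_cone[OF linear_compose_neg[OF side_linear] _ in_a]) auto
      then show False using side_W_pos[of a t] ab r by simp
    qed
    ultimately show ?thesis by simp
  qed
  let ?T' = "star_complex Sc (W t) T"
  have nb: "W a \<noteq> W b" "W a \<noteq> up" "W b \<noteq> up" using ab r by auto
  have "chain_complex (insert t S) ?T'"
    unfolding chain_complex_def
  proof (intro conjI ballI impI)
    show "cone_complex ?T'" by (rule cone_complex_star)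
    show "support ?T' = sigma_M q" using support_star cx(2) by simp
    fix B assume "B \<in> ?T'"
    then consider "B \<in> T" | B1 b1 where "B = insert (W t) (B1 - {b1})" "B1 \<in> T" "Sc \<subseteq> B1" "b1 \<in> Sc"
      by (auto simp: star_complex_def)
    then have "card B = 3 \<and> B \<subseteq> insert up (W ` insert t S)"
    proof cases
      case 1
      then show ?thesis using cx(3,4) by blast
    next
      case 2
      have "W t \<notin> B1 - {b1}" using vT[OF 2(2)] by blast
      moreover have "card (B1 - {b1}) = 2" using cx(3)[OF 2(2)] 2(3,4) by (simp add: subset_iff)
      moreover have "finite (B1 - {b1})" using cone_complexD(2)[OF cx(1) 2(2)] by simp
      ultimately have "card B = 3" using 2(1) by simp
      then show ?thesis using cx(4)[OF 2(2)] 2(1) by auto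
    qed
    then show "card B = 3" "B \<subseteq> insert up (W ` insert t S)" by blast+
  next
    fix x y assume xy: "x \<in> insert t S" "y \<in> insert t S" "x < y \<and> {x<..<y} \<inter> insert t S = {}"
    have new: "insert (W t) (?B0 - {w}) \<in> ?T'" if "w \<in> {W a, W b}" for w
      using B0 S_subset sub that unfolding star_complex_def by blast
    have g1: "\<not> (a < s \<and> s < b)" if "s \<in> S" for s
    proof
      assume "a < s \<and> s < b"
      then have "s \<in> {a<..<b} \<inter> S" using that by simp
      then show False unfolding ab(5) by simp
    qed
    have g2: "\<not> (x < s \<and> s < y)" if "s \<in> insert t S" for s
    proof
      assume "x < s \<and> s < y"
      then have "s \<in> {x<..<y} \<inter> insert t S" using that by simp
      then show False using xy(3) by simp
    qed
    consider "x = t" | "y = t" | "x \<in> S" "y \<in> S" "x \<noteq> t" "y \<noteq> t" using xy by blast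
    then show "{up, W x, W y} \<in> ?T'"
    proof cases
      case 1
      then have "y \<in> S" using xy by auto
      moreover have "\<not> y < b" using g1[OF \<open>y \<in> S\<close>] ab(3) xy(3) 1 by auto
      moreover have "\<not> b < y" using g2[of b] ab(2,4) 1 by auto
      ultimately have "y = b" by simp
      moreover have "insert (W t) (?B0 - {W a}) = {up, W t, W b}" using nb by auto
      ultimately show ?thesis using new[of "W a"] 1 by simp
    next
      case 2
      then have "x \<in> S" using xy by auto
      moreover have "\<not> a < x" using g1[OF \<open>x \<in> S\<close>] ab(4) xy(3) 2 by auto
      moreover have "\<not> x < a" using g2[of a] ab(1,3) 2 by auto
      ultimately have "x = a" by simp
      moreover have "insert (W t) (?B0 - {W b}) = {up, W a, W t}" using nb by auto
      ultimately show ?thesis using new[of "W b"] 2 by simp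
    next
      case 3
      then have "{up, W x, W y} \<in> T" using cx(5) xy by auto
      moreover have "\<not> Sc \<subseteq> {up, W x, W y}"
      proof
        assume "Sc \<subseteq> {up, W x, W y}"
        then have "{W a, W b} \<subseteq> {up, W x, W y}" using sub by blast
        then have "a \<in> {x, y}" "b \<in> {x, y}" using nb by auto
        then have "a = x" "b = y" using xy(3) ab(3,4) by auto
        then show False using g2[of t] ab(3,4) by simp
      qed
      ultimately show ?thesis by (simp add: star_complex_def)
    qed
  qed
  moreover have "star_subdivision (ray (W t)) (cone_fan T) = cone_fan ?T'"
    by (rule star_subdivision_cone_fan) (rule star_center_axioms)
  ultimately show ?thesis by blast
qed

text \<open>The last hypothesis covers every possible stage \<open>S'\<close> and the neighbours of
  \<open>t\<close> in it, so that \<open>ts\<close> may come in any order.\<close>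

lemma chain_fold:
  assumes "chain_complex S T" "S \<subseteq> {-1..N}" "-1 \<in> S" "N \<in> S"
    "distinct ts" "set ts \<inter> S = {}" "set ts \<subseteq> {-1..N}"
    and "\<And>S' a t b. S \<subseteq> S' \<Longrightarrow> S' \<subseteq> S \<union> set ts \<Longrightarrow> t \<in> set ts \<Longrightarrow> a \<in> S' \<Longrightarrow> b \<in> S' \<Longrightarrow> a < t \<Longrightarrow> t < b \<Longrightarrow>
      {a<..<b} \<inter> S' = {} \<Longrightarrow> above a t b"
  shows "\<exists>T'. chain_complex (S \<union> set ts) T' \<and>
    fold star_subdivision (map (\<lambda>t. ray (W t)) ts) (cone_fan T) = cone_fan T'"
  using assms
proof (induction ts arbitrary: S T)
  case Nil
  then show ?case by auto
next
  case (Cons t ts)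
  have fS: "finite S" using Cons.prems(2) finite_subset by blast
  have t: "t \<in> {-1..N}" "t \<notin> S" using Cons.prems by auto
  have t': "-1 < t" "t < N" using t Cons.prems(3,4) by (auto simp: le_less)
  define a where "a = Max {s \<in> S. s < t}"
  define b where "b = Min {s \<in> S. t < s}"
  have fa: "finite {s \<in> S. s < t}" "{s \<in> S. s < t} \<noteq> {}" and fb: "finite {s \<in> S. t < s}" "{s \<in> S. t < s} \<noteq> {}"
    using fS Cons.prems(3,4) t' by auto
  have a: "a \<in> S" "a < t" using Max_in[OF fa] by (auto simp: a_def)
  have b: "b \<in> S" "t < b" using Min_in[OF fb] by (auto simp: b_def)
  have gap: "{a<..<b} \<inter> S = {}"
  proof (intro equals0I)
    fix s assume s: "s \<in> {a<..<b} \<inter> S"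
    then have "s \<noteq> t" using t by auto
    then consider "s < t" | "t < s" by linarith
    then show False
    proof cases
      case 1
      then have "s \<le> a" using Max_ge[OF fa(1), of s] s by (simp add: a_def)
      then show ?thesis using s by simp
    next
      case 2
      then have "b \<le> s" using Min_le[OF fb(1), of s] s by (simp add: b_def)
      then show ?thesis using s by simp
    qed
  qed
  have "above a t b" by (rule Cons.prems(8)[of S]) (use a b gap in auto)
  then obtain T1 where T1: "chain_complex (insert t S) T1"
    "star_subdivision (ray (W t)) (cone_fan T) = cone_fan T1"
    using chain_step[OF Cons.prems(1,2) a(1) b(1) a(2) b(2) gap] by blast
  have "\<exists>T'. chain_complex (insert t S \<union> set ts) T' \<and>
    fold star_subdivision (map (\<lambda>t. ray (W t)) ts) (cone_fan T1) = cone_fan T'"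
  proof (rule Cons.IH[OF T1(1)])
    fix S' a t' b assume S': "insert t S \<subseteq> S'" "S' \<subseteq> insert t S \<union> set ts" "t' \<in> set ts"
      and ab: "a \<in> S'" "b \<in> S'" "a < t'" "t' < b" "{a<..<b} \<inter> S' = {}"
    show "above a t' b" by (rule Cons.prems(8)[of S' t' a b]) (use S' ab in auto)
  qed (use Cons.prems t in auto)
  then show ?case using T1(2) by simp
qed

lemma above_zero: "0 \<le> kap a \<Longrightarrow> 0 \<le> kap b \<Longrightarrow> kap t = 0 \<Longrightarrow> -1 \<le> a \<Longrightarrow> a < t \<Longrightarrow> t < b \<Longrightarrow> above a t b"
  using cross_pos[of a t] cross_pos[of t b] by (simp add: above_def less_imp_le)

lemma above_const:
  assumes "0 \<le> a" "a < t" "t < b" "kap a = kap t" "kap t \<le> kap b"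
  shows "above a t b"
proof -
  have "(t - a) * kap t \<le> (t - a) * kap b" using assms by (intro mult_left_mono) auto
  then show ?thesis using assms by (simp add: above_def cross_def algebra_simps)
qed

lemma chain_complex_base: "chain_complex {-1, N} {{W N, up, W (-1)}}"
  and face_fan_sigma_M: "face_fan (sigma_M q) = cone_fan {{W N, up, W (-1)}}"
proof -
  have N0: "-1 < N" using N_pos by simp
  have "det3 (W (-1)) (W N) up \<noteq> 0"
    using det3_sector[of "-1" N] cross_pos[of "-1" N] N0 by simp
  then have ind: "independent {W (-1), W N, up}" by (rule det3_independent)
  have ind': "independent {W N, up, W (-1)}" using ind by (simp add: insert_commute)
  show "chain_complex {-1, N} {{W N, up, W (-1)}}"
    unfolding chain_complex_def
  proof (intro conjI ballI impI)
    show "cone_complex {{W N, up, W (-1)}}" using ind' by (simp add: cone_complex_def)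
    show "support {{W N, up, W (-1)}} = sigma_M q" by (simp add: support_def sigma_M_eq)
    show "card B = 3" "B \<subseteq> insert up (W ` {-1, N})" if "B \<in> {{W N, up, W (-1)}}" for B
      using that N0 by auto
    show "{up, W a, W b} \<in> {{W N, up, W (-1)}}"
      if "a \<in> {-1, N}" "b \<in> {-1, N}" "a < b \<and> {a<..<b} \<inter> {-1, N} = {}" for a b
      using that N0 by auto
  qed
  show "face_fan (sigma_M q) = cone_fan {{W N, up, W (-1)}}"
    unfolding face_fan_def sigma_M_eq cone_face_iff[OF ind'] cone_fan_def by blast
qed

lemma walled_chain_complex:
  assumes "chain_complex {-1..N} T"
  shows "walled T"
  unfolding walled_def
proof (intro conjI ballI)
  show "cone_complex T" "support T = sigma_M q" using assms by (simp_all add: chain_complex_def)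
  show "card B = 3" "B \<subseteq> verts" if "B \<in> T" for B
    using assms that by (auto simp: chain_complex_def verts_def)
  fix t assume t: "t \<in> {0..N}"
  then have "{t - 1<..<t} \<inter> {-1..N} = {}" by auto
  then have "{up, W (t - 1), W t} \<in> T" using assms t by (simp add: chain_complex_def)
  then show "\<exists>B\<in>T. {up, W t} \<subseteq> B"
    by (rule bexI[rotated]) simp
qed

section \<open>Irreducible lattice points and essential rays\<close>

definition height :: "real^3 \<Rightarrow> real" where "height v = v $ 1 + real q * v $ 3"

lemma height_linear: "linear height"
  by (rule linearI) (simp_all add: height_def algebra_simps)

lemma height_W [simp]: "0 \<le> s \<Longrightarrow> height (W s) = 1" and height_bottom [simp]: "height (W (-1)) = real q"
  and height_up [simp]: "height up = 0"
  by (simp_all add: height_def)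

text \<open>A positive multiple of the height is a positive combination of the two facet forms that
  vanish on \<open>up\<close>. Hence it is nonnegative on the cone and zero only along
  \<open>up\<close>.\<close>

lemma height_eq:
  "of_int (wx N) * height v = v $ 1 + real q * (of_int N * v $ 1 + of_int (wx N) * v $ 3)"
  using N_pos by (simp add: height_def algebra_simps)

lemma height_nonneg:
  assumes "v \<in> sigma_M q"
  shows "0 \<le> height v"
proof -
  have "0 \<le> of_int (wx N) * height v" unfolding height_eq using assms by (simp add: sigma_M_iff del: wx_nonneg_eq)
  moreover have "0 < real_of_int (wx N)" using wx_pos[of N] N_pos by (simp del: wx_nonneg_eq)
  ultimately show ?thesis using zero_le_mult_iff[of "of_int (wx N)" "height v"] by linarith
qed

lemma height_zero:
  assumes v: "v \<in> sigma_M q" and h: "height v = 0"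
  shows "v = v $ 2 *\<^sub>R up" "0 \<le> v $ 2"
proof -
  let ?z = "of_int N * v $ 1 + of_int (wx N) * v $ 3"
  have f: "0 \<le> v $ 1" "0 \<le> ?z" "0 \<le> v $ 1 + (real q ^ 2 + 1) * v $ 2"
    using v by (auto simp: sigma_M_iff simp del: wx_nonneg_eq)
  have "v $ 1 + real q * ?z = 0" using height_eq[of v] h by simp
  moreover have "0 \<le> real q * ?z" using f by (intro mult_nonneg_nonneg) auto
  ultimately have 1: "v $ 1 = 0" using f by linarith
  have 3: "v $ 3 = 0" using h 1 q2 by (simp add: height_def)
  show "v = v $ 2 *\<^sub>R up" using 1 3 by (simp add: vec3_eq_iff)
  have "0 \<le> (real q ^ 2 + 1) * v $ 2" using f(3) 1 by simp
  moreover have "0 < real q ^ 2 + 1" by (simp add: add_nonneg_pos)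
  ultimately show "0 \<le> v $ 2" using zero_le_mult_iff[of "real q ^ 2 + 1" "v $ 2"] by linarith
qed

lemma height_Ints: "v \<in> lattice \<Longrightarrow> height v \<in> \<int>"
  by (simp add: height_def lattice_def)

lemma verts_in_cells:
  assumes "v \<in> verts"
  obtains B where "B \<in> cells" "v \<in> B"
proof -
  have "\<exists>s. -1 \<le> s \<and> s < N \<and> v \<in> {up, W s, W (s + 1)}"
  proof (cases "v = up \<or> v = W (-1)")
    case True
    then show ?thesis using N_pos by (intro exI[of _ "-1"]) auto
  next
    case False
    then obtain t where "v = W t" "t \<in> {-1..N}" using assms by (auto simp: verts_def)
    then show ?thesis using False by (intro exI[of _ "t - 1"]) (auto simp: le_less)
  qed
  then show ?thesis using that unfolding cells_def by blast
qed

lemma verts_primitive: "v \<in> verts \<Longrightarrow> primitive v"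
  using verts_in_cells cells_lattice_basis lattice_basis_primitive by metis

lemma up_verts: "up \<in> verts" and W_verts: "-1 \<le> s \<Longrightarrow> s \<le> N \<Longrightarrow> W s \<in> verts"
  by (auto simp: verts_def)

lemma finite_verts: "finite verts" by (simp add: verts_def)

lemma cells_subset_verts: "B \<in> cells \<Longrightarrow> B \<subseteq> verts"
  by (auto simp: cells_def cell_def verts_def)

lemma height_ge_1:
  assumes "primitive b" "b \<in> sigma_M q" "b \<noteq> up"
  shows "1 \<le> height b"
proof -
  have "height b \<noteq> 0"
  proof
    assume "height b = 0"
    from primitive_parallel_eq[OF assms(1) verts_primitive[OF up_verts] height_zero[OF assms(2) this]]
    show False using assms(3) by simp
  qed
  then have "0 < height b" using height_nonneg[OF assms(2)] by simp
  moreover obtain n :: int where "height b = of_int n"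
    using height_Ints[of b] assms(1) Ints_cases unfolding primitive_def by metis
  ultimately show ?thesis by simp
qed

text \<open>\<open>kap s\<close> is the integer part in the facet inequality, so going down from
  \<open>W s\<close> by a full unit leaves the cone.\<close>

lemma W_minus_up_notin:
  assumes "0 \<le> s" "W s - c *\<^sub>R up \<in> sigma_M q"
  shows "c < 1"
proof (rule ccontr)
  assume "\<not> c < 1"
  have "0 \<le> real_of_int (wx s) + (real q ^ 2 + 1) * (- of_int (kap s) - c)"
    using assms(2) by (simp add: sigma_M_iff)
  moreover have "(real q ^ 2 + 1) * (- of_int (kap s) - c) \<le> (real q ^ 2 + 1) * (- of_int (kap s) - 1)"
    using \<open>\<not> c < 1\<close> by (intro mult_left_mono) auto
  ultimately have "0 \<le> real_of_int (wx s - (Q\<^sup>2 + 1) * (kap s + 1))"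
    by (simp add: algebra_simps)
  then have "0 \<le> wx s - (Q\<^sup>2 + 1) * (kap s + 1)" by (simp only: of_int_0_le_iff)
  then show False using kap_bounds(2)[OF assms(1)] assms(1) by (simp add: algebra_simps)
qed

text \<open>A generator of positive height subtracted from \<open>W s\<close> uses up its whole
  height 1. The remainder is a nonnegative integral multiple of \<open>up\<close>, and it is 0
  because \<open>W s\<close> is lowest.\<close>

lemma W_irreducible:
  assumes r: "regular_subdivision (sigma_M q) \<Sigma>" and s: "0 \<le> s" "s \<le> N"
  obtains B where "B \<in> basis_complex \<Sigma>" "W s \<in> B"
proof -
  note T = regular_subdivision_complex[OF r]
  have "W s \<in> support (basis_complex \<Sigma>)" unfolding T(2) using W_in_sigma_M s by simp
  then obtain B where B: "B \<in> basis_complex \<Sigma>" "W s \<in> convex_cone hull B" by (auto simp: support_def)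
  have lB: "lattice_basis B" using B(1) by (simp add: basis_complex_def)
  have sub: "convex_cone hull B \<subseteq> sigma_M q" using B(1) T(2) by (auto simp: support_def)
  obtain b where b: "b \<in> B" "0 < height b" "W s - b \<in> convex_cone hull B"
    using lattice_cone_peel[OF lB W_lattice B(2) height_linear] s by auto
  have bp: "primitive b" by (rule lattice_basis_primitive[OF lB b(1)])
  have bs: "b \<in> sigma_M q" using hull_inc[OF b(1), of convex_cone] sub by blast
  have "b \<noteq> up" using b(2) by auto
  then have "1 \<le> height b" using height_ge_1 bp bs by blast
  moreover have y: "W s - b \<in> sigma_M q" using b(3) sub by blast
  moreover have "height (W s - b) = 1 - height b" using s by (simp add: linear_diff[OF height_linear])
  ultimately have "height (W s - b) = 0" using height_nonneg[OF y] by simp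
  note c = height_zero[OF y this]
  define c where "c = (W s - b) $ 2"
  have beq: "b = W s - c *\<^sub>R up" using c(1) unfolding c_def by (metis diff_diff_eq2 add_diff_cancel_left')
  have "c < 1" using W_minus_up_notin[OF s(1)] bs beq by simp
  moreover have "c \<in> \<int>" using bp W_lattice[of s] by (simp add: c_def primitive_def lattice_def)
  moreover have "0 \<le> c" unfolding c_def by (rule c(2))
  ultimately have "c = 0" by (auto elim: Ints_cases)
  then have "b = W s" using beq by simp
  then show ?thesis using that B(1) b(1) by blast
qed

text \<open>The index \<open>N\<close> is left out because \<open>W N\<close> is
  \<open>e\<^sub>1\<close>, whose ray is a face of the cone.\<close>

lemma essential_ray_W:
  assumes s: "0 \<le> s" "s < N"
  shows "essential_ray (sigma_M q) (ray (W s))"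
  unfolding essential_ray_def exceptional_ray_def
proof (intro conjI allI impI)
  have p: "primitive (W s)" using verts_primitive W_verts s by simp
  then show "\<exists>v. primitive v \<and> ray (W s) = ray v" by blast
  show "ray (W s) \<subseteq> sigma_M q"
    using ray_subset_iff[OF convex_cone_sigma_M] W_in_sigma_M s by simp
  show "\<not> cone_face (ray (W s)) (sigma_M q)"
  proof
    assume "cone_face (ray (W s)) (sigma_M q)"
    then have "ray (W s) \<in> face_fan (sigma_M q)" by (simp add: face_fan_def)
    then obtain S where S: "S \<subseteq> {W N, up, W (-1)}" "ray (W s) = convex_cone hull S"
      unfolding face_fan_sigma_M cone_fan_def by auto
    have "\<forall>b\<in>S. primitive b"
      using S(1) verts_primitive up_verts W_verts[of N] W_verts[of "-1"] N_pos by auto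
    then have "S = {W s}" using primitive_hull_eq_ray[OF p] S(2) by simp
    then show False using S(1) s by auto
  qed
  fix \<Sigma> assume r: "regular_subdivision (sigma_M q) \<Sigma>"
  obtain B where "B \<in> basis_complex \<Sigma>" "W s \<in> B" using W_irreducible[OF r, of s] s by auto
  then have "ray (W s) \<in> cone_fan (basis_complex \<Sigma>)" unfolding cone_fan_def ray_def by blast
  then show "ray (W s) \<in> \<Sigma>" using regular_subdivision_complex(3)[OF r] by simp
qed

text \<open>A vertex of positive height subtracted from \<open>W t + up\<close> inside the cone
  leaves height 0, hence third coordinate 0, so it is \<open>W t\<close>. The remainder
  \<open>up\<close> in turn requires the generator \<open>up\<close>, the only vertex with positive
  second coordinate.\<close>

lemma regular_walled:
  assumes r: "regular_subdivision (sigma_M q) \<Sigma>" and g: "generated_by verts \<Sigma>"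
  shows "walled (basis_complex \<Sigma>)"
  unfolding walled_def
proof (intro conjI ballI)
  note T = regular_subdivision_complex[OF r]
  show "cone_complex (basis_complex \<Sigma>)" "support (basis_complex \<Sigma>) = sigma_M q" by (rule T(1), rule T(2))
  have sub: "B \<subseteq> verts" if "B \<in> basis_complex \<Sigma>" for B
    using generated_by_basis_subset[OF finite_verts _ g that] verts_primitive by blast
  show "card B = 3" "B \<subseteq> verts" if "B \<in> basis_complex \<Sigma>" for B
    using that lattice_basis_card sub by (auto simp: basis_complex_def)
  fix t assume t: "t \<in> {0..N}"
  have "W t + up \<in> support (basis_complex \<Sigma>)"
    unfolding T(2) using convex_cone_add[OF convex_cone_sigma_M W_in_sigma_M up_in_sigma_M] t by simp
  then obtain B where B: "B \<in> basis_complex \<Sigma>" "W t + up \<in> convex_cone hull B" by (auto simp: support_def)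
  have lB: "lattice_basis B" using B(1) by (simp add: basis_complex_def)
  have subs: "convex_cone hull B \<subseteq> sigma_M q" using B(1) T(2) by (auto simp: support_def)
  have "0 < height (W t + up)" using t by (simp add: linear_add[OF height_linear])
  then obtain b where b: "b \<in> B" "0 < height b" "W t + up - b \<in> convex_cone hull B"
    using lattice_cone_peel[OF lB lattice_add[OF W_lattice up_lattice] B(2) height_linear] by blast
  have y: "W t + up - b \<in> sigma_M q" using b(3) subs by blast
  have hy: "height (W t + up - b) = 1 - height b"
    using t by (simp add: linear_diff[OF height_linear] linear_add[OF height_linear])
  then have "height b \<le> 1" using height_nonneg[OF y] by simp
  then have "b \<noteq> up" "b \<noteq> W (-1)" using b(2) q2 by auto
  then have "b \<in> W ` ({-1..N} - {-1})" using b(1) sub[OF B(1)] unfolding verts_def by blast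
  then obtain s where s': "b = W s" "s \<in> {-1..N} - {-1}" by blast
  then have s: "b = W s" "0 \<le> s" by auto
  have "height (W t + up - b) = 0" using hy s by simp
  from height_zero(1)[OF y this] have "(W t + up - b) $ 3 = 0" by (metis up_component(3) vector_scaleR_component mult_zero_right real_scaleR_def)
  then have "s = t" using s by simp
  then have "W t \<in> B" "up \<in> convex_cone hull B" using b s by simp_all
  moreover have "up \<in> B"
  proof -
    have "linear (\<lambda>v::real^3. v $ 2)" by (rule linearI) simp_all
    then obtain b1 where b1: "b1 \<in> B" "0 < b1 $ 2"
      using lattice_cone_peel[OF lB up_lattice \<open>up \<in> convex_cone hull B\<close>, of "\<lambda>v. v $ 2"] by auto
    have "\<not> 0 < W i $ 2" if "-1 \<le> i" for i
      using kap_nonneg[of i] that by (cases "i = -1") auto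
    then have "b1 = up" using b1 sub[OF B(1)] by (auto simp: verts_def)
    then show ?thesis using b1(1) by simp
  qed
  ultimately show "\<exists>B\<in>basis_complex \<Sigma>. {up, W t} \<subseteq> B" using B(1) by blast
qed

section \<open>Minimality of the shed\<close>

lemma integral_form_ge_1:
  assumes f: "linear f" "\<And>v. v \<in> lattice \<Longrightarrow> f v \<in> \<int>"
    "0 < f (W N)" "0 < f up" "0 < f (W (-1))"
    and v: "v \<in> lattice" "v \<in> sigma_M q" "v \<noteq> 0"
  shows "(1::real) \<le> f v"
proof -
  have "0 < f v"
    by (rule linear_pos_on_cone[OF _ f(1) _ v(2)[unfolded sigma_M_eq] v(3)]) (use f(3-5) in auto)
  moreover obtain n :: int where "f v = of_int n" using f(2)[OF v(1)] by (auto elim: Ints_cases)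
  ultimately show ?thesis by simp
qed

text \<open>The linear form with value 1 on \<open>up\<close>, \<open>W s\<close> and \<open>W (s + 1)\<close>.\<close>

definition sector_form :: "int \<Rightarrow> real^3 \<Rightarrow> real" where
  "sector_form s v = height v + v $ 2 - of_int (kap s) * side (s + 1) v + of_int (kap (s + 1)) * side s v"

lemma sector_form_linear: "linear (sector_form s)"
  by (rule linearI) (simp_all add: sector_form_def height_def side_def algebra_simps)

lemma sector_coordinates:
  assumes "0 \<le> s"
  shows "v = (- side (s + 1) v) *\<^sub>R W s + side s v *\<^sub>R W (s + 1) + (sector_form s v - height v) *\<^sub>R up"
    "height v = - side (s + 1) v + side s v"
  using assms by (simp_all add: vec3_eq_iff sector_form_def height_def side_def algebra_simps)

text \<open>The floor bound for \<open>kap\<close> and the facet inequality for \<open>v $ 2\<close>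
  combine to \<open>height v \<le> (q^2 + 1) * sector_form s v\<close>. So the form is positive at
  \<open>v\<close>, and it is integral there.\<close>

lemma sector_form_ge_1:
  assumes s: "0 \<le> s" and v: "v \<in> lattice" "v \<in> sigma_M q"
    and sd: "0 \<le> side s v" "side (s + 1) v \<le> 0" and h: "1 \<le> height v"
  shows "1 \<le> sector_form s v"
proof -
  let ?A = "- side (s + 1) v" and ?B = "side s v" and ?p = "real q ^ 2 + 1"
  have kb: "of_int (wx t) - real q ^ 2 \<le> of_int (kap t) * ?p" if "0 \<le> t" for t
  proof -
    have "wx t - Q\<^sup>2 \<le> kap t * (Q\<^sup>2 + 1)" using kap_bounds(2)[OF that] that by (simp add: algebra_simps)
    then have "real_of_int (wx t - Q\<^sup>2) \<le> of_int (kap t * (Q\<^sup>2 + 1))" by (simp only: of_int_le_iff)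
    then show ?thesis by (simp del: wx_nonneg_eq)
  qed
  have hAB: "height v = ?A + ?B" using sector_coordinates(2)[OF s] .
  have v1: "v $ 1 = ?A * of_int (wx s) + ?B * of_int (wx (s + 1))"
    using s by (simp add: side_def algebra_simps)
  have "?p * (sector_form s v - height v)
      = ?p * v $ 2 + ?A * (of_int (kap s) * ?p) + ?B * (of_int (kap (s + 1)) * ?p)"
    by (simp add: sector_form_def algebra_simps)
  moreover have "?A * (of_int (wx s) - real q ^ 2) \<le> ?A * (of_int (kap s) * ?p)"
    "?B * (of_int (wx (s + 1)) - real q ^ 2) \<le> ?B * (of_int (kap (s + 1)) * ?p)"
    using sd s kb[of s] kb[of "s + 1"] by (intro mult_left_mono; simp)+
  moreover have "- v $ 1 \<le> ?p * v $ 2" using v(2) by (simp add: sigma_M_iff)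
  moreover have "?A * (of_int (wx s) - real q ^ 2) + ?B * (of_int (wx (s + 1)) - real q ^ 2) - v $ 1
      = - (real q ^ 2 * height v)"
    unfolding v1 hAB by (simp add: algebra_simps del: wx_nonneg_eq)
  ultimately have "- (real q ^ 2 * height v) \<le> ?p * (sector_form s v - height v)" by linarith
  then have "height v \<le> ?p * sector_form s v" by (simp add: algebra_simps)
  then have "0 < ?p * sector_form s v" using h by linarith
  moreover have "0 < ?p" by (simp add: add_nonneg_pos)
  ultimately have "0 < sector_form s v" using zero_less_mult_pos by blast
  moreover have "sector_form s v \<in> \<int>"
    using v(1) unfolding sector_form_def side_def height_def lattice_def
    by (intro Ints_add Ints_diff Ints_mult) auto
  ultimately show ?thesis by (auto elim!: Ints_cases)
qed

text \<open>Were \<open>W t\<close> strictly between \<open>u\<close> and \<open>v\<close>, it would be an integral combination of \<open>up\<close>, \<open>u\<close>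
  and \<open>v\<close> in which \<open>u\<close> and \<open>v\<close> both have positive coefficients, hence of height at least two.\<close>

lemma basis_same_side:
  assumes B: "lattice_basis {up, u, v}" "card {up, u, v} = 3"
    and h: "1 \<le> height u" "1 \<le> height v" and t: "0 \<le> t"
    and sd: "side t u < 0"
  shows "side t v \<le> 0"
proof (rule ccontr)
  assume "\<not> side t v \<le> 0"
  then have v: "0 < side t v" by simp
  note iB = lattice_basis_independent[OF B(1)]
  have ne: "up \<noteq> u" "up \<noteq> v" "u \<noteq> v" using B(2) by (auto simp: card_insert_if split: if_splits)
  obtain c :: "real^3 \<Rightarrow> int" where c: "W t = (\<Sum>b\<in>{up, u, v}. of_int (c b) *\<^sub>R b)"
    using B(1) W_lattice[of t] by (auto simp: lattice_basis_def)
  then have W: "W t = of_int (c up) *\<^sub>R up + (of_int (c u) *\<^sub>R u + of_int (c v) *\<^sub>R v)" using ne by simp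
  have "side t (W t) = of_int (c u) * side t u + of_int (c v) * side t v"
    by (subst W) (simp add: linear_add[OF side_linear] linear_scale[OF side_linear])
  then have s0: "of_int (c v) * side t v = of_int (c u) * (- side t u)" by simp
  have "height (W t) = of_int (c u) * height u + of_int (c v) * height v"
    by (subst W) (simp add: linear_add[OF height_linear] linear_scale[OF height_linear])
  then have h1: "of_int (c u) * height u + of_int (c v) * height v = 1" using t by simp
  have sgn: "0 < real_of_int (c u) \<longleftrightarrow> 0 < real_of_int (c v)"
    using s0 v sd by (metis neg_0_less_iff_less zero_less_mult_pos2 mult_pos_pos)
  show False
  proof (cases "0 < c u")
    case True
    then have "1 \<le> real_of_int (c u)" "1 \<le> real_of_int (c v)" using sgn by simp_all
    then have "1 * 1 \<le> real_of_int (c u) * height u" "1 * 1 \<le> real_of_int (c v) * height v"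
      using h by (intro mult_mono; simp)+
    then show False using h1 by simp
  next
    case False
    then have "real_of_int (c u) \<le> 0" "real_of_int (c v) \<le> 0" using sgn by simp_all
    then have "real_of_int (c u) * height u \<le> 0" "real_of_int (c v) * height v \<le> 0"
      using h by (simp_all add: mult_nonpos_nonneg)
    then show False using h1 by simp
  qed
qed

lemma side_N_nonpos: "v \<in> sigma_M q \<Longrightarrow> side N v \<le> 0"
  by (simp add: sigma_M_iff side_def del: wx_nonneg_eq)

text \<open>No wall over a \<open>W t\<close> separates \<open>u\<close> from \<open>v\<close>, by
  \<open>basis_same_side\<close>; the sector begins at the largest \<open>s < N\<close> with both
  vectors on the nonnegative side. The first alternative is the part next to
  \<open>W (-1)\<close>.\<close>

lemma basis_sector:
  assumes B: "lattice_basis {up, u, v}" "card {up, u, v} = 3"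
    and h: "1 \<le> height u" "1 \<le> height v" and m: "u \<in> sigma_M q" "v \<in> sigma_M q"
  obtains "side 0 u \<le> 0" "side 0 v \<le> 0"
  | s where "0 \<le> s" "s < N" "0 \<le> side s u" "0 \<le> side s v" "side (s + 1) u \<le> 0" "side (s + 1) v \<le> 0"
proof -
  have B': "lattice_basis {up, v, u}" "card {up, v, u} = 3" using B by (simp_all add: insert_commute)
  define P where "P t \<longleftrightarrow> 0 \<le> side t u \<and> 0 \<le> side t v" for t
  have nP: "side t u \<le> 0 \<and> side t v \<le> 0" if "0 \<le> t" "\<not> P t" for t
    using basis_same_side[OF B h that(1)] basis_same_side[OF B' h(2,1) that(1)] that(2)
    unfolding P_def by linarith
  show ?thesis
  proof (cases "P 0")
    case False
    then show ?thesis using nP[of 0] that(1) by simp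
  next
    case True
    let ?F = "{t \<in> {0..<N}. P t}"
    define s where "s = Max ?F"
    have "0 \<in> ?F" using True N_pos by simp
    then have F: "finite ?F" "?F \<noteq> {}" by (auto intro: finite_subset[of _ "{0..<N}"])
    have s: "0 \<le> s" "s < N" "P s" using Max_in[OF F] by (auto simp: s_def)
    have "side (s + 1) u \<le> 0 \<and> side (s + 1) v \<le> 0"
    proof (cases "s + 1 = N")
      case True
      then show ?thesis using side_N_nonpos m by simp
    next
      case False
      then have "\<not> P (s + 1)" using Max_ge[OF F(1), of "s + 1"] s by (auto simp: s_def)
      then show ?thesis using nP s by simp
    qed
    then show ?thesis using that(2) s by (simp add: P_def)
  qed
qed

lemma cells_bottom:
  assumes "B \<in> cells" "W (-1) \<in> B"
  shows "B = {up, W (-1), W 0} \<or> B = {W (-1), W 0, W Q}"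
proof -
  consider s where "B = {up, W s, W (s + 1)}" "-1 \<le> s" | a b c where "B = {W a, W b, W c}" "cell a b c"
    using assms(1) by (auto simp: cells_def)
  then show ?thesis
  proof cases
    case 1
    then have "s = -1" using assms(2) W_neq_up(1)[of "-1"] by auto
    then show ?thesis using 1 by simp
  next
    case 2
    then have "a = -1" using assms(2) by (auto simp: cell_def)
    then have "b = 0" "c = Q" using 2(2) Q2 by (auto simp: cell_def nxt_def)
    then show ?thesis using 2(1) \<open>a = -1\<close> by simp
  qed
qed

text \<open>With \<open>c = 1\<close> and \<open>c = q\<^sup>2 - q\<close> this takes the value 1 on the generators of the two
  maximal cones that contain \<open>e\<^sub>3\<close>.\<close>

definition bottom_form :: "real \<Rightarrow> real^3 \<Rightarrow> real" where
  "bottom_form c v = v $ 1 + c * v $ 2 + v $ 3"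

text \<open>At \<open>W N\<close> the value is \<open>q^3 - c * (q + 1)\<close>, which is exactly
  \<open>q\<close> for the second constant. Positivity on the three extremal rays and integrality
  suffice.\<close>

lemma bottom_form_ge_1:
  assumes c: "c = 1 \<or> c = real q ^ 2 - real q" and v: "v \<in> lattice" "v \<in> sigma_M q" "v \<noteq> 0"
  shows "1 \<le> bottom_form c v"
proof (rule integral_form_ge_1[OF _ _ _ _ _ v])
  have q: "2 \<le> real q" using q2 by simp
  have q2': "2 * real q \<le> real q ^ 2" using q by (simp add: power2_eq_square)
  have q3: "2 * real q ^ 2 \<le> real q ^ 3" using q by (simp add: power3_eq_cube power2_eq_square mult_right_mono)
  show "linear (bottom_form c)" by (rule linearI) (simp_all add: bottom_form_def algebra_simps)
  show "bottom_form c v \<in> \<int>" if "v \<in> lattice" for v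
    using that c unfolding bottom_form_def lattice_def
    by (intro Ints_add Ints_mult) auto
  have "real_of_int (wx N) = real q ^ 3 + real q ^ 2 + real q + 1" "real_of_int N = real q ^ 2 + real q + 1"
    using N_pos by (simp_all add: N_def algebra_simps power2_eq_square power3_eq_cube)
  then have e: "bottom_form c (W N) = real q ^ 3 - c * (real q + 1)"
    by (simp add: bottom_form_def kap_N algebra_simps del: wx_nonneg_eq)
  show "0 < bottom_form c (W N)"
    using c
  proof
    assume "c = 1"
    then show ?thesis using e q q2' q3 by simp
  next
    assume "c = real q ^ 2 - real q"
    then have "bottom_form c (W N) = real q ^ 3 - (real q ^ 2 - real q) * (real q + 1)" using e by simp
    also have "\<dots> = real q" by (simp add: algebra_simps power2_eq_square power3_eq_cube)
    finally have "bottom_form c (W N) = real q" .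
    then show ?thesis using q by simp
  qed
  have "0 < c" using c q q2' by (elim disjE) linarith+
  then show "0 < bottom_form c up" by (simp add: bottom_form_def)
  show "0 < bottom_form c (W (-1))" by (simp add: bottom_form_def)
qed

text \<open>For \<open>x\<close> in the shed of a cell \<open>B\<close> and a cone \<open>B'\<close>
  of the other subdivision containing \<open>x\<close>, it suffices to find a form that is at least
  1 on \<open>B'\<close> and at most 1 at \<open>x\<close>. Its choice depends on whether
  \<open>W (-1)\<close> is in \<open>B\<close> and \<open>up\<close> is in
  \<open>B'\<close>.\<close>

lemma shed_cells_subset:
  assumes cx: "cone_complex cells" "support cells = sigma_M q" and r: "regular_subdivision (sigma_M q) \<Sigma>"
  shows "shed (cone_fan cells) \<subseteq> shed \<Sigma>"
proof
  note T = regular_subdivision_complex[OF r]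
  have prim: "\<forall>B\<in>basis_complex \<Sigma>. \<forall>b\<in>B. primitive b"
    using lattice_basis_primitive by (auto simp: basis_complex_def)
  have prim': "\<forall>B\<in>cells. \<forall>b\<in>B. primitive b"
    using lattice_basis_primitive cells_lattice_basis by blast
  fix x assume "x \<in> shed (cone_fan cells)"
  then obtain B where B: "B \<in> cells" "x \<in> convex hull insert 0 B"
    unfolding shed_cone_fan[OF cx(1) prim'] by blast
  note iB = lattice_basis_independent[OF cells_lattice_basis[OF B(1)]]
  have xB: "x \<in> convex_cone hull B" and sumB: "(\<Sum>b\<in>B. representation B x b) \<le> 1"
    using B(2) unfolding in_cone_shed_iff[OF iB] by blast+
  have "x \<in> sigma_M q" using xB B(1) cx(2) by (auto simp: support_def)
  then obtain B' where B': "B' \<in> basis_complex \<Sigma>" "x \<in> convex_cone hull B'"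
    using T(2) by (auto simp: support_def)
  have lB': "lattice_basis B'" using B'(1) by (simp add: basis_complex_def)
  note iB' = lattice_basis_independent[OF lB']
  have mem: "primitive b \<and> b \<in> lattice \<and> b \<noteq> 0 \<and> b \<in> sigma_M q" if "b \<in> B'" for b
  proof -
    have "b \<in> support (basis_complex \<Sigma>)" using hull_inc[OF that] B'(1) by (auto simp: support_def)
    then show ?thesis using lattice_basis_primitive[OF lB' that] T(2) by (simp add: primitive_def)
  qed
  have height1: "1 \<le> height b" if "b \<in> B'" "b \<noteq> up" for b
    using height_ge_1 mem[OF that(1)] that(2) by blast
  have le: "(\<Sum>b\<in>B'. representation B' x b) \<le> f x" if "linear f" "\<And>b. b \<in> B' \<Longrightarrow> 1 \<le> f b" for f
    by (rule weight_ge[OF iB' B'(2) that])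
  have ge: "f x \<le> 1" if "linear f" "\<And>b. b \<in> B \<Longrightarrow> representation B x b \<noteq> 0 \<Longrightarrow> f b \<le> 1" for f :: "real^3 \<Rightarrow> real"
    using weight_le[OF iB xB that] sumB by simp
  have bottom_linear: "linear (bottom_form c)" for c
    by (rule linearI) (simp_all add: bottom_form_def algebra_simps)
  have "(\<Sum>b\<in>B'. representation B' x b) \<le> 1"
  proof (cases "W (-1) \<in> B")
    case True
    define c where "c = (if up \<in> B then 1 else real q ^ 2 - real q)"
    have c: "c = 1 \<or> c = real q ^ 2 - real q" by (simp add: c_def)
    have "bottom_form c b \<le> 1" if "b \<in> B" for b
      using cells_bottom[OF B(1) True]
    proof
      assume "B = {up, W (-1), W 0}"
      then show ?thesis using that kap_low[of 0] Q2 by (auto simp: bottom_form_def c_def)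
    next
      assume "B = {W (-1), W 0, W Q}"
      moreover have "up \<notin> {W (-1), W 0, W Q}" using Q2 by simp
      ultimately show ?thesis using that kap_low[of 0] kap_Q Q2
        by (auto simp: bottom_form_def c_def power2_eq_square)
    qed
    then show ?thesis
      using le[OF bottom_linear bottom_form_ge_1[OF c]] ge[OF bottom_linear] mem by (meson order_trans)
  next
    case False
    have Bup: "b = up \<or> (\<exists>s\<ge>0. b = W s)" if b: "b \<in> B" for b
    proof (cases "b = up")
      case n: False
      then obtain s where "b = W s" "s \<in> {-1..N}"
        using b cells_subset_verts[OF B(1)] unfolding verts_def by blast
      then have "0 \<le> s" using False b by (cases "s = -1") auto
      then show ?thesis using \<open>b = W s\<close> by blast
    qed simp
    have hB: "height b \<le> 1" if "b \<in> B" for b using Bup[OF that] by auto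
    have hx: "height x \<le> 1" by (rule ge[OF height_linear hB])
    show ?thesis
    proof (cases "up \<in> B'")
      case False
      then have "(\<Sum>b\<in>B'. representation B' x b) \<le> height x"
        using height1 by (intro le[OF height_linear]) blast
      then show ?thesis using hx by simp
    next
      case True
      have "card (B' - {up}) = 2" using lattice_basis_card[OF lB'] True by simp
      then obtain u v where uv: "B' - {up} = {u, v}" "u \<noteq> v" by (auto simp: card_2_iff)
      then have eq: "B' = {up, u, v}" using True by blast
      have un: "u \<in> B'" "u \<noteq> up" "v \<in> B'" "v \<noteq> up" using uv(1) by blast+
      note h = height1[OF un(1,2)] height1[OF un(3,4)]
      have sig: "u \<in> sigma_M q" "v \<in> sigma_M q" using mem un by blast+
      have lb: "lattice_basis {up, u, v}" "card {up, u, v} = 3" using lB' lattice_basis_card[OF lB'] eq by simp_all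
      show ?thesis
        using lb h sig
      proof (cases rule: basis_sector)
        case 1
        \<comment> \<open>\<open>B'\<close> and \<open>B\<close> lie on opposite sides of the wall
          over \<open>W 0\<close>, so \<open>x\<close> is in the wall itself. Only \<open>up\<close>
          and \<open>W 0\<close> can occur in it, and on these \<open>bottom_form 1\<close> is
          1.\<close>
        have "0 \<le> - side 0 x"
          by (rule linear_nonneg_on_cone[OF linear_compose_neg[OF side_linear] _ B'(2)]) (use 1 eq in auto)
        then have s0: "side 0 x \<le> 0" by simp
        have rep: "0 \<le> representation B x b" for b using xB in_cone_iff[OF iB order_refl, of x] by blast
        have sB: "0 \<le> side 0 b" if "b \<in> B" for b
          using Bup[OF that] side_W_pos[of 0] by (auto simp: less_imp_le le_less)
        have nn: "0 \<le> representation B x b * side 0 b" if "b \<in> B" for b using rep sB[OF that] by simp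
        have fB: "finite B" using iB independent_imp_finite by blast
        have "(\<Sum>b\<in>B. representation B x b * side 0 b) \<le> 0"
          using s0 sum_representation_cone[OF iB xB side_linear, of 0] by simp
        then have "(\<Sum>b\<in>B. representation B x b * side 0 b) = 0" using nn by (meson order_antisym sum_nonneg)
        then have z: "representation B x b * side 0 b = 0" if "b \<in> B" for b
          using sum_nonneg_eq_0_iff[OF fB, of "\<lambda>b. representation B x b * side 0 b"] nn that by blast
        have "bottom_form 1 b \<le> 1" if b: "b \<in> B" "representation B x b \<noteq> 0" for b
        proof -
          have "side 0 b = 0" using z[OF b(1)] b(2) by simp
          then have "b = up \<or> b = W 0" using Bup[OF b(1)] side_W_pos[of 0] by (force simp: le_less)
          then show ?thesis using kap_low[of 0] Q2 by (auto simp: bottom_form_def)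
        qed
        then show ?thesis
          using le[OF bottom_linear bottom_form_ge_1[of 1]] ge[OF bottom_linear, of 1] mem
          by (meson order_trans)
      next
        case (2 s)
        have "1 \<le> sector_form s b" if b: "b \<in> B'" for b
        proof -
          consider "b = up" | "b = u" | "b = v" using b eq by blast
          then show ?thesis
          proof cases
            case 1
            then show ?thesis by (simp add: sector_form_def)
          qed (use 2 h sig mem un in \<open>auto intro!: sector_form_ge_1\<close>)
        qed
        then have upper: "(\<Sum>b\<in>B'. representation B' x b) \<le> sector_form s x"
          by (rule le[OF sector_form_linear])
        have A: "0 \<le> side s x"
          by (rule linear_nonneg_on_cone[OF side_linear _ B'(2)]) (use 2 eq in auto)
        have "0 \<le> - side (s + 1) x"
          by (rule linear_nonneg_on_cone[OF linear_compose_neg[OF side_linear] _ B'(2)]) (use 2 eq in auto)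
        note AB = A this
        \<comment> \<open>The difference to the height is the coefficient of \<open>up\<close> in
          \<open>sector_coordinates\<close>. If it is positive, \<open>x\<close> lies in the sector
          cell, and only generators on which the form is 1 occur in it.\<close>
        have "sector_form s x \<le> 1"
        proof (cases "sector_form s x \<le> height x")
          case True
          then show ?thesis using hx by simp
        next
          case False
          let ?S = "{up, W s, W (s + 1)}"
          have S: "?S \<in> cells" using 2 unfolding cells_def by auto
          have "(- side (s + 1) x) *\<^sub>R W s + side s x *\<^sub>R W (s + 1) + (sector_form s x - height x) *\<^sub>R up
              \<in> convex_cone hull ?S"
            using AB False by (intro convex_cone_hull_add convex_cone_hull_mul) (simp_all add: hull_inc)
          then have xS: "x \<in> convex_cone hull ?S" using sector_coordinates(1)[OF 2(1), of x] by simp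
          have supp: "{b. representation B x b \<noteq> 0} \<subseteq> ?S"
            by (rule complex_carrier[OF cx(1) B(1) S order_refl xB xS])
          have one: "sector_form s b = 1" if "b \<in> ?S" for b
            using that side_W[of s "s + 1"] side_W_self[of s] side_antisym[of "s + 1" s] 2(1)
            by (auto simp: sector_form_def cross_def)
          show ?thesis
            by (rule ge[OF sector_form_linear]) (use supp one in force)
        qed
        then show ?thesis using upper by simp
      qed
    qed
  qed
  then have "x \<in> convex hull insert 0 B'" using B'(2) in_cone_shed_iff[OF iB'] by blast
  then show "x \<in> shed \<Sigma>"
    using shed_cone_fan[OF T(1) prim] B'(1) unfolding T(3) by blast
qed

text \<open>Essential rays lie in every regular subdivision, in particular in
  \<open>cone_fan cells\<close>, so all centres of the chain are spanned by elements of
  \<open>verts\<close> and \<open>generated_by\<close> applies.\<close>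

lemma essential_unique:
  assumes cx: "cone_complex cells" "support cells = sigma_M q" and e: "essential_subdivision (sigma_M q) \<Sigma>"
  shows "\<Sigma> = cone_fan cells"
proof -
  obtain \<rho>s where \<rho>s: "\<forall>\<rho>\<in>set \<rho>s. essential_ray (sigma_M q) \<rho>"
    and \<Sigma>: "\<Sigma> = fold star_subdivision \<rho>s (face_fan (sigma_M q))"
    and r: "regular_subdivision (sigma_M q) \<Sigma>"
    using e by (auto simp: essential_subdivision_def)
  have reg: "regular_subdivision (sigma_M q) (cone_fan cells)"
    using regular_subdivision_cone_fan[OF cx(1)] cells_lattice_basis cx(2) by simp
  have "\<exists>v\<in>verts. \<rho> = ray v" if "\<rho> \<in> set \<rho>s" for \<rho>
  proof -
    have "essential_ray (sigma_M q) \<rho>" using \<rho>s that by blast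
    then obtain v where v: "primitive v" "\<rho> = ray v" "\<rho> \<in> cone_fan cells"
      using reg by (auto simp: essential_ray_def exceptional_ray_def)
    then obtain S B where S: "B \<in> cells" "S \<subseteq> B" "ray v = convex_cone hull S" by (auto simp: cone_fan_def)
    have "S \<subseteq> verts" using S cells_subset_verts by blast
    then have "S = {v}" using primitive_hull_eq_ray[OF v(1), of S] S(3) verts_primitive by auto
    then show ?thesis using \<open>S \<subseteq> verts\<close> v(2) by blast
  qed
  moreover have "generated_by verts (face_fan (sigma_M q))"
  proof -
    have sub: "{W N, up, W (-1)} \<subseteq> verts" using up_verts W_verts[of N] W_verts[of "-1"] N_pos by simp
    show ?thesis unfolding generated_by_def
    proof
      fix \<sigma> assume "\<sigma> \<in> face_fan (sigma_M q)"
      then obtain S where "S \<subseteq> {W N, up, W (-1)}" "\<sigma> = convex_cone hull S"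
        unfolding face_fan_sigma_M cone_fan_def by auto
      then show "\<exists>S\<subseteq>verts. \<sigma> = convex_cone hull S"
        using subset_trans[OF _ sub] by (intro exI[of _ S]) simp
    qed
  qed
  ultimately have "generated_by verts \<Sigma>"
    unfolding \<Sigma> by (intro generated_by_fold[OF finite_verts]) auto
  then have "basis_complex \<Sigma> = cells" using walled_eq_cells[OF regular_walled[OF r]] by simp
  then show ?thesis using regular_subdivision_complex(3)[OF r] by simp
qed

section \<open>The star subdivisions of the theorem\<close>

text \<open>This is an equality: \<open>W Q\<close> lies on the facet spanned by \<open>W N\<close>
  and \<open>W (-1)\<close>.\<close>

lemma above_apex: "above (-1) Q N"
proof -
  have "cross (-1) N * kap Q = 1 + Q * N" "cross Q N * kap (-1) = 0"
    "cross (-1) Q * kap N = (1 + Q * Q) * (Q + 1)"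
    by (simp_all add: cross_def kap_Q kap_N)
  moreover have "1 + Q * N = (1 + Q * Q) * (Q + 1)" by (simp add: N_eq algebra_simps)
  ultimately show ?thesis by (simp add: above_def)
qed

text \<open>If the left neighbour is \<open>Q\<close>, the two sides of the inequality differ by
  \<open>j' - k\<close>. If it is a column start they are equal, since the
  \<open>W (k * Q + 1)\<close> are equally spaced on a line.\<close>

lemma above_row:
  assumes a: "a = Q \<or> (\<exists>j\<ge>1. a = j * Q + 1 \<and> j \<le> Q + 1)" and b: "b = j' * Q + 1" "1 \<le> j'" "j' \<le> Q + 1"
    and t: "t = k * Q + 1" "1 \<le> k" "k \<le> Q" and o: "a < t" "t < b"
  shows "above a t b"
proof -
  have kt: "kap t = k" "kap b = j'" using kap_start t b by simp_all
  have "0 \<le> j * Q + 1" if "1 \<le> j" for j using that by simp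
  then have "0 \<le> a" "0 \<le> t" using a t Q2 by auto
  then have cr: "cross a b = b - a" "cross t b = b - t" "cross a t = t - a"
    by (simp_all add: cross_def)
  from a show ?thesis
  proof
    assume aQ: "a = Q"
    have "0 < (j' - k) * Q" using o(2) b(1) t(1) by (simp add: algebra_simps)
    then have "k \<le> j'" using Q2 by (simp add: zero_less_mult_iff)
    then show ?thesis unfolding above_def cr kt using aQ kap_Q b(1) t(1) by (simp add: algebra_simps)
  next
    assume "\<exists>j\<ge>1. a = j * Q + 1 \<and> j \<le> Q + 1"
    then obtain j where j: "1 \<le> j" "a = j * Q + 1" "j \<le> Q + 1" by blast
    have "kap a = j" using kap_start j by simp
    then show ?thesis unfolding above_def cr kt using j(2) b(1) t(1) by (simp add: algebra_simps)
  qed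
qed

text \<open>The lower bound on \<open>a\<close> comes from the column start having been inserted
  earlier. It puts \<open>a\<close> into the column of \<open>t\<close>, where \<open>kap\<close> is
  constant.\<close>

lemma above_column:
  assumes k: "1 \<le> k" "k \<le> Q" and l: "2 \<le> l" "l \<le> Q" and t: "t = k * Q + l"
    and o: "k * Q + 1 \<le> a" "a < t" "t < b"
  shows "above a t b"
proof (rule above_const)
  have p: "0 \<le> k * Q + 1" using k by (simp add: add_nonneg_pos)
  show "0 \<le> a" using o(1) p by linarith
  have kt: "kap t = k" using kap_column k l t by simp
  have "kap (k * Q + 1) \<le> kap a" "kap a \<le> kap t" using o p by (auto intro: kap_mono)
  then show "kap a = kap t" using kap_start[of k] k kt by simp
  have "0 \<le> t" using t k l by simp
  then show "kap t \<le> kap b" using o(3) by (simp add: kap_mono)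
qed (use o in auto)

lemma gap_le:
  assumes "{a<..<b} \<inter> S = {}" "s \<in> S" "a < t" "t < b" "s < t"
  shows "s \<le> (a :: int)"
proof (rule ccontr)
  assume "\<not> s \<le> a"
  then have "a < s" "s < b" using assms(4,5) by linarith+
  then have "s \<in> {a<..<b} \<inter> S" using assms(2) by simp
  then show False unfolding assms(1) by simp
qed

lemma column_inj:
  assumes "k * Q + l = k' * Q + l'" "1 \<le> l" "l \<le> Q" "1 \<le> l'" "l' \<le> Q"
  shows "k = k' \<and> l = l'"
proof -
  have e: "(k - k') * Q = l' - l" using assms(1) by (simp add: algebra_simps)
  have "k = k'"
  proof (rule ccontr)
    assume "k \<noteq> k'"
    then have "Q \<le> \<bar>k - k'\<bar> * Q" using mult_right_mono[of 1 "\<bar>k - k'\<bar>" Q] by simp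
    also have "\<dots> = \<bar>l' - l\<bar>" using e[symmetric] by (simp add: abs_mult)
    finally show False using assms(2-5) by linarith
  qed
  then show ?thesis using assms(1) by simp
qed

lemma Sigma_min_eq:
  "Sigma_min q = fold star_subdivision (map (\<lambda>t. ray (W t)) [Q, 0]) (face_fan (sigma_M q))"
proof -
  have "vector [real q ^ 2 + 1, - 1, - real q] = W Q" "vector [1, 0, 0] = W 0"
    using kap_Q kap_low[of 0] Q2 by (simp_all add: vec3_eq_iff power2_eq_square)
  then show ?thesis by (simp add: Sigma_min_def)
qed

lemma first_center_eq:
  assumes "1 \<le> k" "k \<le> q"
  shows "first_center q k = ray (W (int k * Q + 1))"
proof -
  have "kap (int k * Q + 1) = int k" using kap_start assms by simp
  then have "vector [real k * real q ^ 2 + real q + 1, - real k, - (real k * real q + 1)] = W (int k * Q + 1)"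
    by (simp add: vec3_eq_iff power2_eq_square algebra_simps)
  then show ?thesis by (simp add: first_center_def)
qed

lemma second_center_eq:
  assumes "1 \<le> k \<and> k \<le> q \<and> 2 \<le> l \<and> l \<le> q \<or> k = 0 \<and> 1 \<le> l \<and> l \<le> q - 1"
  shows "second_center q (k, l) = ray (W (int k * Q + int l))"
proof -
  have "kap (int k * Q + int l) = int k"
    using assms kap_column[of "int k" "int l"] kap_low[of "int l"] q2 by auto
  then have "vector [real k * real q ^ 2 + real l * real q + 1, - real k, - (real k * real q + real l)]
      = W (int k * Q + int l)"
    by (simp add: vec3_eq_iff power2_eq_square algebra_simps)
  then show ?thesis by (simp add: second_center_def)
qed

text \<open>There are four stages: \<open>Q\<close>, 0, the column starts and the remaining indices.
  Points of earlier stages bound the left neighbour of a new index from below: by \<open>Q\<close>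
  for a column start, by the column start or by 0 for a remaining index. The order inside a stage is
  free.\<close>

lemma fold_centers:
  assumes ks: "distinct ks" "set ks = {1..q}"
    and kls: "distinct kls" "set kls = {(k, l). 1 \<le> k \<and> k \<le> q \<and> 2 \<le> l \<and> l \<le> q}
                 \<union> {(k, l). k = 0 \<and> 1 \<le> l \<and> l \<le> q - 1}"
  shows "\<exists>\<rho>s. (\<forall>\<rho>\<in>set \<rho>s. \<exists>t. 0 \<le> t \<and> t < N \<and> \<rho> = ray (W t)) \<and>
      fold star_subdivision (map (second_center q) kls)
        (fold star_subdivision (map (first_center q) ks) (Sigma_min q)) =
      fold star_subdivision \<rho>s (face_fan (sigma_M q))"
    and "fold star_subdivision (map (second_center q) kls)
        (fold star_subdivision (map (first_center q) ks) (Sigma_min q)) = cone_fan cells"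
    and "cone_complex cells" "support cells = sigma_M q"
proof -
  define ts1 where "ts1 = map (\<lambda>k. int k * Q + 1) ks"
  define ts2 where "ts2 = map (\<lambda>(k, l). int k * Q + int l) kls"
  define \<rho>s where "\<rho>s = map (\<lambda>t. ray (W t)) ([Q, 0] @ ts1 @ ts2)"
  have c1: "map (first_center q) ks = map (\<lambda>t. ray (W t)) ts1"
    unfolding ts1_def using ks(2) first_center_eq by (simp add: o_def)
  have c2: "map (second_center q) kls = map (\<lambda>t. ray (W t)) ts2"
    unfolding ts2_def using kls(2) second_center_eq by (auto simp: o_def)
  have eq: "fold star_subdivision (map (second_center q) kls)
        (fold star_subdivision (map (first_center q) ks) (Sigma_min q)) =
      fold star_subdivision \<rho>s (face_fan (sigma_M q))"
    unfolding c1 c2 Sigma_min_eq by (simp add: \<rho>s_def)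
  have s1: "set ts1 = {k * Q + 1 | k. 1 \<le> k \<and> k \<le> Q}"
  proof (intro equalityI subsetI)
    fix t assume "t \<in> {k * Q + 1 | k. 1 \<le> k \<and> k \<le> Q}"
    then obtain k where k: "t = k * Q + 1" "1 \<le> k" "k \<le> Q" by blast
    then have "nat k \<in> set ks" "t = int (nat k) * Q + 1" using ks(2) by auto
    then show "t \<in> set ts1" unfolding ts1_def set_map by (intro image_eqI[of _ _ "nat k"])
  qed (auto simp: ts1_def ks(2))
  have s2: "set ts2 = {k * Q + l | k l. 1 \<le> k \<and> k \<le> Q \<and> 2 \<le> l \<and> l \<le> Q} \<union> {1..Q - 1}"
  proof (intro equalityI subsetI)
    fix t assume "t \<in> {k * Q + l | k l. 1 \<le> k \<and> k \<le> Q \<and> 2 \<le> l \<and> l \<le> Q} \<union> {1..Q - 1}"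
    then consider k l where "t = k * Q + l" "1 \<le> k" "k \<le> Q" "2 \<le> l" "l \<le> Q" | "1 \<le> t" "t \<le> Q - 1" by auto
    then show "t \<in> set ts2"
    proof cases
      case 1
      then have "(nat k, nat l) \<in> set kls" unfolding kls(2) by auto
      then show ?thesis unfolding ts2_def using 1 by force
    next
      case 2
      then have "(0, nat t) \<in> set kls" unfolding kls(2) by auto
      then show ?thesis unfolding ts2_def using 2 by force
    qed
  next
    fix t assume "t \<in> set ts2"
    then obtain k l where kl: "(k, l) \<in> set kls" "t = int k * Q + int l" by (auto simp: ts2_def)
    from kl(1) consider "1 \<le> k" "k \<le> q" "2 \<le> l" "l \<le> q" | "k = 0" "1 \<le> l" "l \<le> q - 1"
      unfolding kls(2) by auto
    then show "t \<in> {k * Q + l | k l. 1 \<le> k \<and> k \<le> Q \<and> 2 \<le> l \<and> l \<le> Q} \<union> {1..Q - 1}"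
    proof cases
      case 1
      then have "1 \<le> int k \<and> int k \<le> Q \<and> 2 \<le> int l \<and> int l \<le> Q" by simp
      then show ?thesis using kl(2) by blast
    next
      case 2
      then show ?thesis using kl(2) q2 by auto
    qed
  qed
  have d1: "distinct ts1"
    unfolding ts1_def distinct_map using ks(1) Q2 by (auto intro!: inj_onI)
  have d2: "distinct ts2"
    unfolding ts2_def distinct_map
  proof (intro conjI inj_onI)
    show "distinct kls" by fact
    fix x y assume xy: "x \<in> set kls" "y \<in> set kls" and e: "(case x of (k, l) \<Rightarrow> int k * Q + int l) = (case y of (k, l) \<Rightarrow> int k * Q + int l)"
    obtain k l k' l' where p: "x = (k, l)" "y = (k', l')" by (cases x, cases y)
    have "int k = int k' \<and> int l = int l'"
      by (rule column_inj) (use xy e p q2 in \<open>auto simp: kls(2)\<close>)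
    then show "x = y" using p by simp
  qed
  have colpos: "Q + 1 \<le> k * Q + l" "k * Q + l < N" if "1 \<le> k" "k \<le> Q" "1 \<le> l" "l \<le> Q" for k l
  proof -
    have "1 * Q \<le> k * Q" "k * Q \<le> Q * Q" using that by (intro mult_right_mono; simp)+
    moreover have "N = Q * Q + Q + 1" by (simp add: N_eq algebra_simps)
    ultimately show "Q + 1 \<le> k * Q + l" "k * Q + l < N" using that Q2 by linarith+
  qed
  have r1: "Q + 1 \<le> t" "t < N" if "t \<in> set ts1" for t
    using that colpos[of _ 1] Q2 unfolding s1 by auto
  have r2: "1 \<le> t" "t < N" "t \<noteq> Q" "t \<notin> set ts1" if "t \<in> set ts2" for t
  proof -
    from that consider k l where "t = k * Q + l" "1 \<le> k" "k \<le> Q" "2 \<le> l" "l \<le> Q" | "1 \<le> t" "t \<le> Q - 1"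
      unfolding s2 by auto
    then have "1 \<le> t \<and> t < N \<and> t \<noteq> Q \<and> t \<notin> set ts1"
    proof cases
      case 1
      have "t \<notin> set ts1"
        unfolding s1 using column_inj[of k l _ 1] 1 Q2 by auto
      then show ?thesis using colpos[of k l] 1 Q2 by simp
    next
      case 2
      then show ?thesis using r1[of t] N_pos by auto
    qed
    then show "1 \<le> t" "t < N" "t \<noteq> Q" "t \<notin> set ts1" by blast+
  qed
  show "\<exists>\<rho>s. (\<forall>\<rho>\<in>set \<rho>s. \<exists>t. 0 \<le> t \<and> t < N \<and> \<rho> = ray (W t)) \<and>
      fold star_subdivision (map (second_center q) kls)
        (fold star_subdivision (map (first_center q) ks) (Sigma_min q)) =
      fold star_subdivision \<rho>s (face_fan (sigma_M q))"
  proof (intro exI[of _ \<rho>s] conjI ballI)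
    fix \<rho> assume "\<rho> \<in> set \<rho>s"
    then obtain t where t: "\<rho> = ray (W t)" "t = Q \<or> t = 0 \<or> t \<in> set ts1 \<or> t \<in> set ts2"
      unfolding \<rho>s_def by auto
    then have "0 \<le> t \<and> t < N" using r1[of t] r2[of t] N_pos Q2 by auto
    then show "\<exists>t. 0 \<le> t \<and> t < N \<and> \<rho> = ray (W t)" using t(1) by blast
  qed (rule eq)
  obtain T1 where T1: "chain_complex ({-1, N} \<union> set [Q]) T1"
    "fold star_subdivision (map (\<lambda>t. ray (W t)) [Q]) (face_fan (sigma_M q)) = cone_fan T1"
  proof -
    have "\<exists>T'. chain_complex ({-1, N} \<union> set [Q]) T' \<and>
      fold star_subdivision (map (\<lambda>t. ray (W t)) [Q]) (cone_fan {{W N, up, W (-1)}}) = cone_fan T'"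
    proof (rule chain_fold[OF chain_complex_base])
      fix S' a t b assume S': "S' \<subseteq> {-1, N} \<union> set [Q]" "t \<in> set [Q]" "a \<in> S'" "b \<in> S'" "a < t" "t < b"
      then have "a \<in> {-1, N} \<union> set [Q]" "b \<in> {-1, N} \<union> set [Q]" by blast+
      then have "a = -1" "b = N" "t = Q" using S'(2,5,6) N_pos Q2 by auto
      then show "above a t b" using above_apex by simp
    qed (use N_pos Q2 in auto)
    then show thesis using that unfolding face_fan_sigma_M by blast
  qed
  obtain T2 where T2: "chain_complex ({-1, N} \<union> set [Q] \<union> set [0]) T2"
    "fold star_subdivision (map (\<lambda>t. ray (W t)) [0]) (cone_fan T1) = cone_fan T2"
  proof -
    have "\<exists>T'. chain_complex ({-1, N} \<union> set [Q] \<union> set [0]) T' \<and>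
      fold star_subdivision (map (\<lambda>t. ray (W t)) [0]) (cone_fan T1) = cone_fan T'"
    proof (rule chain_fold[OF T1(1)])
      fix S' a t b assume S': "S' \<subseteq> {-1, N} \<union> set [Q] \<union> set [0]" "t \<in> set [0]" "a \<in> S'" "b \<in> S'" "a < t" "t < b"
      then have "a \<in> {-1, N} \<union> set [Q] \<union> set [0]" by blast
      then have "a = -1" "t = 0" "0 \<le> b" using S'(2,5,6) N_pos Q2 by auto
      then show "above a t b"
        using kap_nonneg[of b] kap_low[of 0] Q2 \<open>t < b\<close> by (intro above_zero) auto
    qed (use N_pos Q2 in auto)
    then show thesis using that by blast
  qed
  let ?S2 = "{-1, N} \<union> set [Q] \<union> set [0]"
  have A1: "s \<le> Q \<or> (\<exists>j. 1 \<le> j \<and> j \<le> Q + 1 \<and> s = j * Q + 1)" if "s \<in> ?S2 \<union> set ts1" for s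
  proof -
    from that consider "s \<le> Q" | "s = N" | "s \<in> set ts1" using Q2 by auto
    then show ?thesis
    proof cases
      case 2
      then show ?thesis using N_eq Q2 by (intro disjI2 exI[of _ "Q + 1"]) simp
    next
      case 3
      then show ?thesis unfolding s1 by force
    qed simp
  qed
  obtain T3 where T3: "chain_complex (?S2 \<union> set ts1) T3"
    "fold star_subdivision (map (\<lambda>t. ray (W t)) ts1) (cone_fan T2) = cone_fan T3"
  proof -
    have "\<exists>T'. chain_complex (?S2 \<union> set ts1) T' \<and>
      fold star_subdivision (map (\<lambda>t. ray (W t)) ts1) (cone_fan T2) = cone_fan T'"
    proof (rule chain_fold[OF T2(1)])
      fix S' a t b assume S': "?S2 \<subseteq> S'" "S' \<subseteq> ?S2 \<union> set ts1" "t \<in> set ts1" "a \<in> S'" "b \<in> S'"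
        and o: "a < t" "t < b" "{a<..<b} \<inter> S' = {}"
      have "Q \<in> S'" using S'(1) by simp
      then have "Q \<le> a" using gap_le[OF o(3) _ o(1,2)] r1[OF S'(3)] by simp
      moreover have ab: "a \<in> ?S2 \<union> set ts1" "b \<in> ?S2 \<union> set ts1" using S'(2,4,5) by blast+
      ultimately have a: "a = Q \<or> (\<exists>j\<ge>1. a = j * Q + 1 \<and> j \<le> Q + 1)"
        using A1[OF ab(1)] by force
      obtain j' where b: "b = j' * Q + 1" "1 \<le> j'" "j' \<le> Q + 1"
        using A1[OF ab(2)] o(2) r1(1)[OF S'(3)] by force
      obtain k where "t = k * Q + 1" "1 \<le> k" "k \<le> Q" using S'(3) unfolding s1 by blast
      then show "above a t b" using above_row[OF a b] o(1,2) by blast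
    next
      show "set ts1 \<inter> ?S2 = {}" using r1 Q2 by fastforce
      show "set ts1 \<subseteq> {-1..N}" using r1 Q2 by fastforce
    qed (use N_pos Q2 d1 in auto)
    then show thesis using that by blast
  qed
  obtain T4 where T4: "chain_complex (?S2 \<union> set ts1 \<union> set ts2) T4"
    "fold star_subdivision (map (\<lambda>t. ray (W t)) ts2) (cone_fan T3) = cone_fan T4"
  proof -
    have "\<exists>T'. chain_complex (?S2 \<union> set ts1 \<union> set ts2) T' \<and>
      fold star_subdivision (map (\<lambda>t. ray (W t)) ts2) (cone_fan T3) = cone_fan T'"
    proof (rule chain_fold[OF T3(1)])
      fix S' a t b assume S': "?S2 \<union> set ts1 \<subseteq> S'" "S' \<subseteq> ?S2 \<union> set ts1 \<union> set ts2" "t \<in> set ts2" "a \<in> S'" "b \<in> S'"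
        and o: "a < t" "t < b" "{a<..<b} \<inter> S' = {}"
      from S'(3) consider k l where "t = k * Q + l" "1 \<le> k" "k \<le> Q" "2 \<le> l" "l \<le> Q" | "1 \<le> t" "t \<le> Q - 1"
        unfolding s2 by auto
      then show "above a t b"
      proof cases
        case 1
        have "k * Q + 1 \<in> S'" using S'(1) 1(2,3) unfolding s1 by blast
        then have "k * Q + 1 \<le> a" using gap_le[OF o(3) _ o(1,2)] 1 by simp
        then show ?thesis using above_column[OF 1(2,3,4,5,1)] o(1,2) by blast
      next
        case 2
        have "0 \<in> S'" using S'(1) by simp
        then have "0 \<le> a" using gap_le[OF o(3) _ o(1,2)] 2 by simp
        then show ?thesis
          using kap_nonneg[of a] kap_nonneg[of b] kap_low[of t] 2 o by (intro above_zero) auto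
      qed
    next
      show "set ts2 \<inter> (?S2 \<union> set ts1) = {}" using r2 Q2 by fastforce
      show "set ts2 \<subseteq> {-1..N}" using r2 by fastforce
      show "?S2 \<union> set ts1 \<subseteq> {-1..N}" using r1 N_pos Q2 by fastforce
    qed (use d2 in auto)
    then show thesis using that by blast
  qed
  have "?S2 \<union> set ts1 \<union> set ts2 = {-1..N}"
  proof
    show "?S2 \<union> set ts1 \<union> set ts2 \<subseteq> {-1..N}" using r1 r2 N_pos Q2 by fastforce
    show "{-1..N} \<subseteq> ?S2 \<union> set ts1 \<union> set ts2"
    proof
      fix s assume "s \<in> {-1..N}"
      then have "-1 \<le> s" "s \<le> N" by auto
      then show "s \<in> ?S2 \<union> set ts1 \<union> set ts2"
      proof (cases rule: index_cases)
        case zero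
        then show ?thesis by (cases "s = 0") (auto simp: s2)
      next
        case (col k l)
        then show ?thesis by (cases "l = 1") (auto simp: s1 s2)
      qed auto
    qed
  qed
  then have g: "walled T4" using walled_chain_complex T4(1) by simp
  then have "T4 = cells" by (rule walled_eq_cells)
  then show "cone_complex cells" "support cells = sigma_M q" using walledD(1,2)[OF g] by simp_all
  have "fold star_subdivision \<rho>s (face_fan (sigma_M q)) = cone_fan T4"
    using T1(2) T2(2) T3(2) T4(2) by (simp add: \<rho>s_def)
  then show "fold star_subdivision (map (second_center q) kls)
        (fold star_subdivision (map (first_center q) ks) (Sigma_min q)) = cone_fan cells"
    using eq \<open>T4 = cells\<close> by simp
qed

end

theorem theorem4p1:
  fixes q :: nat
    and ks :: "nat list"
    and kls :: "(nat \<times> nat) list"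
    and \<Sigma>ess :: "(real^3) set set"
    and M_ess :: "((int^3) \<Rightarrow>\<^sub>0 ('a::{field,finite}) poly) set set"
  assumes "q = CARD('a)"
    and "distinct ks" and "set ks = {1..q}"
    and "distinct kls"
    and "set kls = {(k, l). 1 \<le> k \<and> k \<le> q \<and> 2 \<le> l \<and> l \<le> q}
                 \<union> {(k, l). k = 0 \<and> 1 \<le> l \<and> l \<le> q - 1}"
    and "\<Sigma>ess = fold star_subdivision (map (second_center q) kls)
                 (fold star_subdivision (map (first_center q) ks) (Sigma_min q))"
    and "M_ess = toric_scheme \<Sigma>ess"
  shows "essential_subdivision (sigma_M q) \<Sigma>ess
       \<and> minimal_subdivision (sigma_M q) \<Sigma>ess
       \<and> (\<forall>\<Sigma>. essential_subdivision (sigma_M q) \<Sigma> \<longrightarrow> \<Sigma> = \<Sigma>ess)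
       \<and> essential_smooth_model (sigma_M q) M_ess
       \<and> minimal_smooth_model (sigma_M q) M_ess
       \<and> (\<forall>X :: ((int^3) \<Rightarrow>\<^sub>0 'a poly) set set.
            essential_smooth_model (sigma_M q) X \<longrightarrow> X = M_ess)"
proof -
  \<comment> \<open>The distinct elements 0 and 1 give \<open>2 \<le> q\<close>, the assumption of
    \<open>chain\<close>.\<close>
  have "card {0, 1 :: 'a} \<le> CARD('a)" by (rule card_mono) auto
  then interpret chain q using assms(1) by unfold_locales simp
  note F = fold_centers[OF assms(2-5)]
  have \<Sigma>: "\<Sigma>ess = cone_fan cells" using F(2) assms(6) by simp
  have reg: "regular_subdivision (sigma_M q) \<Sigma>ess"
    using regular_subdivision_cone_fan[OF F(3)] cells_lattice_basis F(4) \<Sigma> by simp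
  obtain \<rho>s where \<rho>s: "\<forall>\<rho>\<in>set \<rho>s. \<exists>t. 0 \<le> t \<and> t < N \<and> \<rho> = ray (W t)"
    "\<Sigma>ess = fold star_subdivision \<rho>s (face_fan (sigma_M q))"
    using F(1) assms(6) by auto
  have "\<forall>\<rho>\<in>set \<rho>s. essential_ray (sigma_M q) \<rho>"
    using \<rho>s(1) essential_ray_W by auto
  then have ess: "essential_subdivision (sigma_M q) \<Sigma>ess"
    using reg \<rho>s(2) by (auto simp: essential_subdivision_def)
  have min: "minimal_subdivision (sigma_M q) \<Sigma>ess"
    using minimal_subdivision_cone_fan[OF F(3)] cells_lattice_basis shed_cells_subset[OF F(3,4)]
    by (simp add: F(4) \<Sigma>)
  have uniq: "\<Sigma> = \<Sigma>ess" if "essential_subdivision (sigma_M q) \<Sigma>" for \<Sigma>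
    using essential_unique[OF F(3,4) that] \<Sigma> by simp
  show ?thesis
  proof (intro conjI allI impI)
    show "essential_smooth_model (sigma_M q) M_ess"
      unfolding essential_smooth_model_def using ess assms(7) by blast
    show "minimal_smooth_model (sigma_M q) M_ess"
      unfolding minimal_smooth_model_def using min assms(7) by blast
    fix X :: "((int^3) \<Rightarrow>\<^sub>0 'a poly) set set"
    assume "essential_smooth_model (sigma_M q) X"
    then obtain \<Sigma> where "essential_subdivision (sigma_M q) \<Sigma>" "X = toric_scheme \<Sigma>"
      unfolding essential_smooth_model_def by blast
    then show "X = M_ess" using uniq[of \<Sigma>] assms(7) by simp
  qed (fact ess, fact min, rule uniq)
qed

end
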